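(* Let $r$ be an integer with $1\le r\le 24$ and let $n$ be a positive integer. Put $k = 2 + r/2$ and $m = -n + r/24$ (so $m\le 0$, with $m=0$ exactly when $r=24$ and $n=1$). Then the number $p_r(n)$ of $r$-color partitions of $n$ is $$p_r(n) = -c_{r/24},$$ where $c_{r/24}$ is the coefficient of $q^{r/24}$ in the Fourier expansion of the Poincaré series $P_{k,m} = P_{2+r/2,\,-n+r/24}$, which is given explicitly as follows. (a) If $m<0$, then $$c_{r/24} = 2\pi\, i^{-k} \left(\frac{r/24}{|m|}\right)^{\frac{k-1}{2}} \sum_{c=1}^\infty \frac{A(m, r/24; c)}{c}\, I_{k-1}\!\left(\frac{4\pi\sqrt{|m|\, r/24}}{c}\right).$$ (b) If $m=0$ (that is, $r=24$, $n=1$, $k=14$), then $$c_{r/24} = c_1 = \frac{(-1)^{k/2}(2\pi)^k}{(k-1)!}\sum_{c=1}^\infty \frac{A(0,1;c)}{c^k} = \frac{(-1)^{k/2}(2\pi)^k}{(k-1)!\,\zeta(k)}\,\sigma_{k-1}(1) = -\frac{2k}{B_k}\,\sigma_{k-1}(1).$$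
   Context: $p_r(n)$ is the number of $r$-color partitions of $n>0$, i.e. partitions of $n$ into positive integer parts in which each part may appear in $r$ different colors (order disregarded), with $p_r(0)=1$; equivalently $\sum_{n\ge 0} p_r(n)q^n = \prod_{n\ge1}(1-q^n)^{-r}$. Let $\mathbb{H} = \{x+iy : y>0\}$, $q = e^{2\pi i\tau}$ for $\tau\in\mathbb{H}$ (with $q^s = e^{2\pi i s\tau}$), $\Gamma = SL_2(\mathbb{Z})$ acting on $\mathbb{H}$ by Möbius transformations. Roots and powers of $z\in\mathbb{C}^\times$ are taken with $-\pi\le\arg z<\pi$ (in particular $i^{-k} = e^{-\pi i k/2}$). The Dedekind eta-function is $\eta(\tau) = q^{1/24}\prod_{n=1}^\infty(1-q^n)$. The eta multiplier $v_\eta$ is the function from $\Gamma$ to the 24th roots of unity determined by $$\eta(M\tau) = v_\eta(M)\sqrt{c\tau+d}\;\eta(\tau)\quad\text{for all }\tau\in\mathbb{H},\ M = \begin{pmatrix} * & * \\ c & d\end{pmatrix}\in\Gamma.$$ Poincaré series: let $k\in\frac12\mathbb{Z}$, $k\ge 5/2$, and $m\in\frac1{24}\mathbb{Z}$ with $k-12m\in 2\mathbb{Z}$ (this holds for $k=2+r/2$, $m=-n+r/24$). Let $\Gamma_\infty$ be the subgroup of $\Gamma$ generated by $\begin{pmatrix}1&1\\0&1\end{pmatrix}$ and $-I$. Then $$P_{k,m}(\tau) = \sum_{M\in\Gamma_\infty\backslash\Gamma} v_\eta(M)^{-24m}(c\tau+d)^{-k}e^{2\pi i m M\tau},\qquad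 M=\begin{pmatrix} * & * \\ c & d\end{pmatrix},$$ the sum running over a set of coset representatives (it is well-defined and converges absolutely and uniformly on compact subsets of $\mathbb{H}$). It satisfies $P_{k,m}(\tau+1)=e^{2\pi i m}P_{k,m}(\tau)$ and so has a Fourier expansion $P_{k,m}(\tau)=\sum_{\nu\in\mathbb{Z}+m}c_\nu q^\nu$, with $c_\nu = \int_0^1 P_{k,m}(x+iy)e^{-2\pi i\nu(x+iy)}\,dx$ for any fixed $y>0$. For $m\in\frac1{24}\mathbb{Z}$, $\nu\in\mathbb{Z}+m$ and a positive integer $c$, the generalized Kloosterman sum is $$A(m,\nu;c) = \sum_{\substack{d\ (\mathrm{mod}\ c)\\(c,d)=1}} v_\eta(M)^{-24m}\,e^{2\pi i\frac{ma+\nu d}{c}},$$ where for each $d$ in a set of representatives of the residue classes modulo $c$ coprime to $c$, $M=\begin{pmatrix}a&*\\c&d\end{pmatrix}$ is any element of $\Gamma$ with lower row $(c,d)$ and $a$ is its upper left entry (the summand does not depend on the choices). $I_{s}$ is the modified Bessel function of the first kind of order $s$; $\sigma_{k-1}(n)=\sum_{d\mid n,\,d>0}d^{k-1}$; $\zeta$ is the Riemann zeta-function; $B_k$ is the $k$th Bernoulli number. *)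

theory Defs
  imports "HOL-Analysis.Analysis" "HOL-Algebra.Generated_Groups"
begin

definition color_partitions :: "nat \<Rightarrow> nat \<Rightarrow> (nat \<times> nat) multiset set" where
  \<comment> \<open>a pair \<open>(j, i)\<close> is the part \<open>j\<close> in the color \<open>i\<close>\<close>
  "color_partitions r n =
     {P. set_mset P \<subseteq> {1..} \<times> {..<r} \<and> sum_mset (image_mset fst P) = n}"

definition num_color_partitions :: "nat \<Rightarrow> nat \<Rightarrow> nat" where
  "num_color_partitions r n = card (color_partitions r n)"

text \<open>
  Roots and powers use the argument in \<open>[-\<pi>, \<pi>)\<close>, whereas the library functions \<open>Arg\<close>,
  \<open>csqrt\<close> and \<open>powr\<close> use \<open>(-\<pi>, \<pi>]\<close>; the two differ on the negative real axis, which is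
  hit by \<open>c\<tau> + d\<close> when \<open>c = 0\<close> and \<open>d = -1\<close>. The power is meant for \<open>z \<noteq> 0\<close>.
\<close>

definition arg_left :: "complex \<Rightarrow> real" where
  "arg_left z = (if Arg z = pi then - pi else Arg z)"

definition cpow :: "complex \<Rightarrow> real \<Rightarrow> complex" where
  "cpow z s = of_real (norm z powr s) * cis (s * arg_left z)"

definition qpow :: "real \<Rightarrow> complex \<Rightarrow> complex" where
  "qpow s \<tau> = exp (2 * of_real pi * \<i> * of_real s * \<tau>)"

definition dedekind_eta :: "complex \<Rightarrow> complex" where
  "dedekind_eta \<tau> = qpow (1/24) \<tau> * (\<Prod>n. 1 - qpow 1 \<tau> ^ Suc n)"

definition SL2Z :: "(int^2^2) monoid" where
  "SL2Z = \<lparr>carrier = {M. det M = 1}, mult = (**), one = mat 1\<rparr>"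

definition aut_factor :: "int^2^2 \<Rightarrow> complex \<Rightarrow> complex" where
  "aut_factor M \<tau> = of_int (M$2$1) * \<tau> + of_int (M$2$2)"

definition moebius :: "int^2^2 \<Rightarrow> complex \<Rightarrow> complex" where
  "moebius M \<tau> = (of_int (M$1$1) * \<tau> + of_int (M$1$2)) / aut_factor M \<tau>"

definition eta_mult :: "int^2^2 \<Rightarrow> complex" where
  "eta_mult M = (THE v. \<forall>\<tau>. Im \<tau> > 0 \<longrightarrow>
     dedekind_eta (moebius M \<tau>) = v * cpow (aut_factor M \<tau>) (1/2) * dedekind_eta \<tau>)"

definition Gamma_inf :: "(int^2^2) set" where
  "Gamma_inf = generate SL2Z {vector [vector [1, 1], vector [0, 1]], - mat 1}"

text \<open>
  \<open>\<Gamma>\<^sub>\<infinity> \ SL\<^sub>2(\<int>)\<close> is the set of right cosets \<open>\<Gamma>\<^sub>\<infinity> M\<close>. For \<open>24m \<in> \<int>\<close> and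
  \<open>k - 12m \<in> 2\<int>\<close> the summand takes the same value at all elements of a coset, so that
  the choice of the representative is immaterial.
\<close>

definition poincare_series :: "real \<Rightarrow> real \<Rightarrow> complex \<Rightarrow> complex" where
  "poincare_series k m \<tau> =
     (\<Sum>\<^sub>\<infinity>C \<in> rcosets\<^bsub>SL2Z\<^esub> Gamma_inf.
        let M = (SOME M. M \<in> C)
        in cpow (eta_mult M) (- 24 * m) * cpow (aut_factor M \<tau>) (- k) * qpow m (moebius M \<tau>))"

definition fourier_coeff :: "(complex \<Rightarrow> complex) \<Rightarrow> real \<Rightarrow> real \<Rightarrow> complex" where
  \<comment> \<open>computed on the horizontal line at height \<open>y\<close>\<close>
  "fourier_coeff f y \<nu> = integral {0..1} (\<lambda>x. f (Complex x y) * qpow (- \<nu>) (Complex x y))"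

definition kloosterman :: "real \<Rightarrow> real \<Rightarrow> nat \<Rightarrow> complex" where
  \<comment> \<open>for \<open>24m \<in> \<int>\<close> and \<open>\<nu> \<in> \<int> + m\<close> the summand depends neither on the choice of \<open>M\<close> nor on
    that of \<open>d\<close> in its residue class\<close>
  "kloosterman m \<nu> c =
     (\<Sum>d | d \<in> {0..<int c} \<and> coprime (int c) d.
        let M = (SOME M. M \<in> carrier SL2Z \<and> M$2$1 = int c \<and> M$2$2 = d)
        in cpow (eta_mult M) (- 24 * m) *
           exp (2 * of_real pi * \<i> * of_real ((m * of_int (M$1$1) + \<nu> * of_int d) / of_nat c)))"

definition bessel_I :: "real \<Rightarrow> real \<Rightarrow> real" where
  \<comment> \<open>for \<open>x > 0\<close>\<close>
  "bessel_I s x = (\<Sum>j. (x / 2) powr (s + 2 * real j) * rGamma (s + real j + 1) / fact j)"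

definition divisor_sigma :: "nat \<Rightarrow> nat \<Rightarrow> nat" where
  "divisor_sigma s n = (\<Sum>d | d dvd n. d ^ s)"

definition riemann_zeta :: "complex \<Rightarrow> complex" where
  \<comment> \<open>only for \<open>Re s > 1\<close>\<close>
  "riemann_zeta s = (\<Sum>n. 1 / of_nat (Suc n) powr s)"

fun bernoulli_number :: "nat \<Rightarrow> real" where
  \<comment> \<open>from \<open>\<Sum>j\<le>n. (n + 1 choose j) * B j = 0\<close> for \<open>n > 0\<close>\<close>
  "bernoulli_number 0 = 1"
| "bernoulli_number (Suc n) =
     - (\<Sum>j\<le>n. real (n + 2 choose j) * bernoulli_number j) / (real n + 2)"

end

theory Submission
  imports Defs "HOL-Complex_Analysis.Complex_Analysis"
begin


text \<open>
  Write \<open>k = 2 + r/2\<close>, \<open>m = r/24 - n\<close> and \<open>\<nu> = r/24\<close>, and let \<open>g(\<tau>) = q^m / \<eta>(\<tau>)^r\<close>. Since \<open>\<nu> - m = n\<close>,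
  \<open>g\<close> is \<open>q^(-n)\<close> times the generating function of the coloured partitions, so it has integral
  exponents and its constant term is \<open>p\<^sub>r(n)\<close>. The multiplier and the automorphy factor of the
  Poincare series are made so that \<open>\<eta>(\<tau>)^r\<close> can be taken out of every term:
  \<open>P(\<tau>) = \<eta>(\<tau>)^r f(\<tau>)\<close> with \<open>f(\<tau>) = \<Sum> (c\<tau> + d)^(-2) g(M\<tau>)\<close>, a holomorphic form of weight two for the
  full modular group (\<open>poincare_term_eq\<close>, \<open>weight2_form_modular\<close>).

  A form of weight two has no constant term (\<open>weight_2_constant_term\<close>). A primitive of \<open>f\<close> changes by a
  constant under every element of the group; the constant is zero for the inversion because \<open>\<i>\<close> is
  fixed, and then also for the translation because the two act alike on \<open>\<rho>\<close>. On the other hand, with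
  \<open>P = q^m + R\<close>, where \<open>R\<close> collects the cosets with \<open>c \<noteq> 0\<close>, the function \<open>f = g + R / \<eta>^r\<close> has the constant
  term \<open>p\<^sub>r(n) + c\<^sub>\<nu>\<close>: \<open>R\<close> tends to zero at the cusp, so that none of its coefficients below \<open>q^\<nu>\<close>
  contributes. This is \<open>num_color_partitions_eq_fourier_coeff\<close>.

  The coefficient \<open>c\<^sub>\<nu>\<close> is computed by unfolding. The terms with fixed \<open>c\<close> and \<open>d\<close> in a fixed class modulo \<open>c\<close>
  are translates of one another, so their integrals over the unit interval add up to one integral
  over the line (\<open>sums_fourier_coeff_poincare\<close>). After the expansion of \<open>exp (\<mu> / w)\<close> that integral
  is a sum of inverse Laplace transforms of powers, which are evaluated in \<open>bromwich_powr\<close>. For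
  \<open>m < 0\<close> the sum is a Bessel function, for \<open>m = 0\<close> only one summand survives. In the latter case
  the Kloosterman sums are Ramanujan sums, whose Dirichlet series is \<open>1 / \<zeta>\<close>, and the expression with
  the Bernoulli number is the number of 24-colour partitions of one.

  All this needs the transformation law of \<open>\<eta>\<close>, without which even the defining property of the
  multiplier is void. Up to a constant factor the logarithmic derivative of \<open>\<eta>\<close> is the Eisenstein series of
  weight two, summed by rows; the transition to columns produces the extra term \<open>2\<pi>\<i>/\<tau>\<close> (\<open>eis_transform\<close>).
\<close>

section \<open>Complex powers and exponentials\<close>

lemma norm_cis_arg_left: "z \<noteq> 0 \<Longrightarrow> of_real (norm z) * cis (arg_left z) = z"
proof -
  assume "z \<noteq> 0"
  have "cis (arg_left z) = cis (Arg z)"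
    by (auto simp: arg_left_def complex_eq_iff)
  thus ?thesis using \<open>z \<noteq> 0\<close> by (metis cis_Arg complex_sgn_def mult.commute scaleR_conv_of_real rcis_cmod_Arg rcis_def)
qed

lemma cpow_nonzero [simp]: "z \<noteq> 0 \<Longrightarrow> cpow z s \<noteq> 0"
  by (simp add: cpow_def)

lemma norm_cpow: "norm (cpow z s) = norm z powr s"
  by (simp add: cpow_def norm_mult)

lemma cpow_0 [simp]: "z \<noteq> 0 \<Longrightarrow> cpow z 0 = 1"
  by (simp add: cpow_def)

lemma cpow_1: "z \<noteq> 0 \<Longrightarrow> cpow z 1 = z"
  by (simp add: cpow_def norm_cis_arg_left)

lemma cpow_add: "cpow z (s + t) = cpow z s * cpow z t"
  by (simp add: cpow_def powr_add distrib_right flip: cis_mult)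

lemma cpow_minus: "z \<noteq> 0 \<Longrightarrow> cpow z (- s) = inverse (cpow z s)"
  using cpow_add[of z s "-s"] by (simp add: field_simps)

lemma cpow_mult_nat: "z \<noteq> 0 \<Longrightarrow> cpow z (real n * s) = cpow z s ^ n"
  by (induction n) (simp_all add: distrib_right cpow_add)

lemma cpow_mult_int: "z \<noteq> 0 \<Longrightarrow> cpow z (of_int n * s) = cpow z s powi n"
proof (cases n rule: int_cases4)
  case (nonneg k)
  assume "z \<noteq> 0" thus ?thesis using nonneg by (simp add: cpow_mult_nat)
next
  case (neg k)
  assume "z \<noteq> 0"
  have "cpow z (of_int n * s) = inverse (cpow z (real k * s))"
    using cpow_minus[OF \<open>z \<noteq> 0\<close>, of "real k * s"] neg by simp
  thus ?thesis using neg \<open>z \<noteq> 0\<close> by (simp add: cpow_mult_nat power_int_minus)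
qed

lemma cpow_of_int: "z \<noteq> 0 \<Longrightarrow> cpow z (of_int n) = z powi n"
  using cpow_mult_int[of z n 1] by (simp add: cpow_1)

lemma cpow_half_squared: "z \<noteq> 0 \<Longrightarrow> cpow z (1/2) ^ 2 = z"
  using cpow_mult_nat[of z 2 "1/2"] by (simp add: cpow_1)

lemma cpow_eq_powr: "Im z \<noteq> 0 \<Longrightarrow> cpow z s = z powr of_real s"
proof -
  assume "Im z \<noteq> 0"
  hence *: "Arg z \<noteq> pi" "z \<noteq> 0" by (auto simp: Arg_eq_pi)
  have "z powr of_real s = exp (of_real s * (of_real (ln (norm z)) + \<i> * of_real (Arg z)))"
    using * by (simp add: powr_def Ln_Arg)
  also have "\<dots> = of_real (norm z powr s) * cis (s * Arg z)"
    using * by (simp add: distrib_left exp_add powr_def cis_conv_exp mult_ac exp_of_real[symmetric])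
  finally show ?thesis using * by (simp add: cpow_def arg_left_def)
qed

lemma cpow_of_real_mult: "a > 0 \<Longrightarrow> cpow (of_real a * z) s = of_real (a powr s) * cpow z s"
proof -
  assume "a > 0"
  hence "Arg (of_real a * z) = Arg z" by (simp add: Arg_times_of_real)
  thus ?thesis using \<open>a > 0\<close> by (simp add: cpow_def arg_left_def norm_mult powr_mult)
qed

lemma qpow_add: "qpow (s + t) \<tau> = qpow s \<tau> * qpow t \<tau>"
  by (simp add: qpow_def exp_add ring_distribs)

lemma qpow_add_arg: "qpow s (\<tau> + z) = qpow s \<tau> * qpow s z"
  by (simp add: qpow_def exp_add ring_distribs)

lemma qpow_minus: "qpow (- s) \<tau> = inverse (qpow s \<tau>)"
  by (simp add: qpow_def exp_minus)

lemma qpow_nonzero [simp]: "qpow s \<tau> \<noteq> 0"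
  by (simp add: qpow_def)

lemma norm_qpow: "norm (qpow s \<tau>) = exp (- 2 * pi * s * Im \<tau>)"
  by (simp add: qpow_def)

lemma qpow_nat: "qpow (of_nat n) \<tau> = qpow 1 \<tau> ^ n"
  by (simp add: qpow_def exp_of_nat_mult[symmetric] mult_ac)

lemma qpow_of_int_of_int: "qpow (of_int a) (of_int b) = 1"
  unfolding qpow_def exp_eq_1 by (auto intro!: exI[of _ "a*b"])

lemma holomorphic_qpow [holomorphic_intros]: "f holomorphic_on A \<Longrightarrow> (\<lambda>t. qpow s (f t)) holomorphic_on A"
  unfolding qpow_def by (intro holomorphic_intros)

lemma continuous_on_qpow [continuous_intros]: "continuous_on A f \<Longrightarrow> continuous_on A (\<lambda>t. qpow s (f t))"
  unfolding qpow_def by (intro continuous_intros)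

section \<open>The modular group and its cosets at the cusp\<close>

abbreviation a11 :: "int^2^2 \<Rightarrow> int" where "a11 M \<equiv> M$1$1"
abbreviation a12 :: "int^2^2 \<Rightarrow> int" where "a12 M \<equiv> M$1$2"
abbreviation a21 :: "int^2^2 \<Rightarrow> int" where "a21 M \<equiv> M$2$1"
abbreviation a22 :: "int^2^2 \<Rightarrow> int" where "a22 M \<equiv> M$2$2"

lemma in_SL2Z_iff: "M \<in> carrier SL2Z \<longleftrightarrow> a11 M * a22 M - a12 M * a21 M = 1"
  by (simp add: SL2Z_def det_2)

lemma mult_SL2Z [simp]: "M \<otimes>\<^bsub>SL2Z\<^esub> N = M ** N" and one_SL2Z [simp]: "\<one>\<^bsub>SL2Z\<^esub> = mat 1"
  by (simp_all add: SL2Z_def)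

lemma matrix_mult_nth_2:
  "a11 (M ** N) = a11 M * a11 N + a12 M * a21 N"
  "a12 (M ** N) = a11 M * a12 N + a12 M * a22 N"
  "a21 (M ** N) = a21 M * a11 N + a22 M * a21 N"
  "a22 (M ** N) = a21 M * a12 N + a22 M * a22 N"
  by (simp_all add: matrix_matrix_mult_def sum_2)

lemma mat2_eq_iff:
  "M = N \<longleftrightarrow> a11 M = a11 N \<and> a12 M = a12 N \<and> a21 M = a21 N \<and> a22 M = a22 N"
  by (auto simp: vec_eq_iff forall_2)

lemma mat_1_nth_2: "a11 (mat 1) = 1" "a12 (mat 1) = 0" "a21 (mat 1) = 0" "a22 (mat 1) = 1"
  by (simp_all add: mat_def)

definition mat2 :: "int \<Rightarrow> int \<Rightarrow> int \<Rightarrow> int \<Rightarrow> int^2^2" where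
  "mat2 a b c d = vector [vector [a, b], vector [c, d]]"

lemma mat2_nth [simp]: "a11 (mat2 a b c d) = a" "a12 (mat2 a b c d) = b"
   "a21 (mat2 a b c d) = c" "a22 (mat2 a b c d) = d"
  by (simp_all add: mat2_def)

lemma group_SL2Z: "group SL2Z"
proof (rule groupI)
  fix M N assume "M \<in> carrier SL2Z" "N \<in> carrier SL2Z"
  thus "M \<otimes>\<^bsub>SL2Z\<^esub> N \<in> carrier SL2Z" by (simp add: SL2Z_def det_mul)
next
  fix M assume M: "M \<in> carrier SL2Z"
  let ?N = "mat2 (a22 M) (- a12 M) (- a21 M) (a11 M)"
  have "?N ** M = mat 1" using M
    by (auto simp: mat2_eq_iff matrix_mult_nth_2 in_SL2Z_iff mat_1_nth_2 algebra_simps)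
  moreover have "?N \<in> carrier SL2Z" using M by (simp add: in_SL2Z_iff algebra_simps)
  ultimately show "\<exists>N\<in>carrier SL2Z. N \<otimes>\<^bsub>SL2Z\<^esub> M = \<one>\<^bsub>SL2Z\<^esub>" by auto
qed (simp_all add: matrix_mul_assoc in_SL2Z_iff mat_1_nth_2)

interpretation SL2Z: group SL2Z by (rule group_SL2Z)

lemma inv_SL2Z:
  assumes M: "M \<in> carrier SL2Z"
  shows "inv\<^bsub>SL2Z\<^esub> M = mat2 (a22 M) (- a12 M) (- a21 M) (a11 M)"
proof (rule SL2Z.inv_equality)
  show "mat2 (a22 M) (- a12 M) (- a21 M) (a11 M) \<otimes>\<^bsub>SL2Z\<^esub> M = \<one>\<^bsub>SL2Z\<^esub>"
   using M by (auto simp: mat2_eq_iff matrix_mult_nth_2 in_SL2Z_iff mat_1_nth_2 algebra_simps)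
qed (use M in \<open>auto simp: in_SL2Z_iff algebra_simps\<close>)

lemma aut_factor_nonzero:
  assumes "M \<in> carrier SL2Z" "Im \<tau> > 0"
  shows "aut_factor M \<tau> \<noteq> 0"
proof
  assume *: "aut_factor M \<tau> = 0"
  have "Im (aut_factor M \<tau>) = of_int (a21 M) * Im \<tau>" by (simp add: aut_factor_def)
  with * assms have "a21 M = 0" by auto
  with * have "a22 M = 0" by (simp add: aut_factor_def)
  with \<open>a21 M = 0\<close> assms show False by (simp add: in_SL2Z_iff)
qed

lemma Im_moebius:
  assumes "M \<in> carrier SL2Z"
  shows "Im (moebius M \<tau>) = Im \<tau> / norm (aut_factor M \<tau>) ^ 2"
proof -
  define a b c d where "a = real_of_int (a11 M)" and "b = real_of_int (a12 M)"
    and "c = real_of_int (a21 M)" and "d = real_of_int (a22 M)"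
  have "real_of_int (a11 M * a22 M - a12 M * a21 M) = 1" using assms by (simp only: in_SL2Z_iff)
  hence det: "a * d - b * c = 1" by (simp add: a_def b_def c_def d_def)
  define N J where "N = of_real a * \<tau> + of_real b" and "J = of_real c * \<tau> + of_real d"
  have "Im N * Re J - Re N * Im J = Im \<tau> * (a * d - b * c)"
    unfolding N_def J_def by (simp add: algebra_simps)
  hence "Im (N / J) = Im \<tau> / norm J ^ 2"
    unfolding Im_divide cmod_power2 det by simp
  thus ?thesis by (simp add: moebius_def aut_factor_def N_def J_def a_def b_def c_def d_def)
qed

lemma Im_moebius_pos: "M \<in> carrier SL2Z \<Longrightarrow> Im \<tau> > 0 \<Longrightarrow> Im (moebius M \<tau>) > 0"
  by (simp add: Im_moebius aut_factor_nonzero)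

lemma moebius_num:
  assumes "N \<in> carrier SL2Z" "Im \<tau> > 0"
  shows "moebius N \<tau> * aut_factor N \<tau> = of_int (a11 N) * \<tau> + of_int (a12 N)"
  using aut_factor_nonzero[OF assms] by (simp add: moebius_def)

lemma aut_factor_mult:
  assumes "N \<in> carrier SL2Z" "Im \<tau> > 0"
  shows "aut_factor (M ** N) \<tau> = aut_factor M (moebius N \<tau>) * aut_factor N \<tau>"
proof -
  have "aut_factor M (moebius N \<tau>) * aut_factor N \<tau> =
        of_int (a21 M) * (moebius N \<tau> * aut_factor N \<tau>) + of_int (a22 M) * aut_factor N \<tau>"
    unfolding aut_factor_def[of M] by (simp only: distrib_right mult.assoc)
  also have "\<dots> = aut_factor (M ** N) \<tau>"
    unfolding moebius_num[OF assms] unfolding aut_factor_def matrix_mult_nth_2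
    by (simp add: algebra_simps)
  finally show ?thesis ..
qed

lemma moebius_mult:
  assumes "M \<in> carrier SL2Z" "N \<in> carrier SL2Z" "Im \<tau> > 0"
  shows "moebius (M ** N) \<tau> = moebius M (moebius N \<tau>)"
proof -
  have nz: "aut_factor N \<tau> \<noteq> 0" "aut_factor M (moebius N \<tau>) \<noteq> 0"
    using assms by (auto simp: aut_factor_nonzero Im_moebius_pos)
  have "(of_int (a11 M) * moebius N \<tau> + of_int (a12 M)) * aut_factor N \<tau> =
        of_int (a11 M) * (moebius N \<tau> * aut_factor N \<tau>) + of_int (a12 M) * aut_factor N \<tau>"
    by (simp only: distrib_right mult.assoc)
  also have "\<dots> = of_int (a11 (M ** N)) * \<tau> + of_int (a12 (M ** N))"
    unfolding moebius_num[OF assms(2,3)] unfolding aut_factor_def matrix_mult_nth_2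
    by (simp add: algebra_simps)
  finally have num: "of_int (a11 (M ** N)) * \<tau> + of_int (a12 (M ** N)) =
        (of_int (a11 M) * moebius N \<tau> + of_int (a12 M)) * aut_factor N \<tau>" ..
  show ?thesis
    unfolding moebius_def[of "M ** N"] num aut_factor_mult[OF assms(2,3)] moebius_def[of M]
    using nz by simp
qed

text \<open>The two generators and their inverses are upper triangular; conversely an upper triangular matrix
  has equal diagonal entries \<open>\<plusminus>1\<close> and is up to sign a power of the translation.\<close>

lemma Gamma_inf_iff: "M \<in> Gamma_inf \<longleftrightarrow> M \<in> carrier SL2Z \<and> a21 M = 0"
proof
  have T: "vector [vector [1, 1], vector [0, 1]] \<in> carrier SL2Z"
    by (simp add: in_SL2Z_iff)
  have I: "- mat 1 \<in> carrier SL2Z" by (simp add: in_SL2Z_iff mat_1_nth_2)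
  assume "M \<in> Gamma_inf"
  thus "M \<in> carrier SL2Z \<and> a21 M = 0"
    unfolding Gamma_inf_def
  proof (induction rule: generate.induct)
    case one
    show ?case by (simp add: in_SL2Z_iff mat_1_nth_2)
  next
    case (inv h) thus ?case using T I
      by (auto simp: inv_SL2Z mat_1_nth_2)
  next
    case (eng h1 h2)
    hence "h1 \<otimes>\<^bsub>SL2Z\<^esub> h2 \<in> carrier SL2Z" by (intro SL2Z.m_closed) auto
    thus ?case using eng by (simp add: matrix_mult_nth_2)
  qed (use T I in \<open>auto simp: mat_1_nth_2\<close>)
next
  assume M: "M \<in> carrier SL2Z \<and> a21 M = 0"
  have T: "mat2 1 1 0 1 \<in> Gamma_inf" and I: "- mat 1 \<in> Gamma_inf"
    by (auto simp: Gamma_inf_def mat2_def intro: generate.incl)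
  have T': "mat2 1 (-1) 0 1 \<in> Gamma_inf"
  proof -
    have "inv\<^bsub>SL2Z\<^esub> (mat2 1 1 0 1) \<in> Gamma_inf"
      by (auto simp: Gamma_inf_def mat2_def intro: generate.inv)
    thus ?thesis by (simp add: inv_SL2Z in_SL2Z_iff)
  qed
  have closed: "A ** B \<in> Gamma_inf" if "A \<in> Gamma_inf" "B \<in> Gamma_inf" for A B
    using generate.eng[of A SL2Z _ B] that by (simp add: Gamma_inf_def)
  have *: "mat2 1 b 0 1 \<in> Gamma_inf" for b
  proof (induction b rule: int_induct[where k = 0])
    case base
    have "mat2 1 0 0 1 = mat 1" by (simp add: mat2_eq_iff mat_1_nth_2)
    thus ?case using generate.one[of SL2Z] by (simp add: Gamma_inf_def)
  next
    case (step1 i)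
    have "mat2 1 (i + 1) 0 1 = mat2 1 i 0 1 ** mat2 1 1 0 1" by (simp add: mat2_eq_iff matrix_mult_nth_2)
    thus ?case using closed step1 T by simp
  next
    case (step2 i)
    have "mat2 1 (i - 1) 0 1 = mat2 1 i 0 1 ** mat2 1 (-1) 0 1" by (simp add: mat2_eq_iff matrix_mult_nth_2)
    thus ?case using closed step2 T' by simp
  qed
  from M have "a11 M * a22 M = 1" by (auto simp: in_SL2Z_iff)
  hence "a11 M = 1 \<and> a22 M = 1 \<or> a11 M = -1 \<and> a22 M = -1" by (simp add: zmult_eq_1_iff)
  thus "M \<in> Gamma_inf"
  proof
    assume "a11 M = 1 \<and> a22 M = 1"
    hence "M = mat2 1 (a12 M) 0 1" using M by (simp add: mat2_eq_iff)
    thus ?thesis using *[of "a12 M"] by simp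
  next
    assume "a11 M = -1 \<and> a22 M = -1"
    hence "M = - mat 1 ** mat2 1 (-(a12 M)) 0 1" using M by (simp add: mat2_eq_iff matrix_mult_nth_2 mat_1_nth_2)
    thus ?thesis using closed[OF I *[of "-(a12 M)"]] by simp
  qed
qed

lemma subgroup_Gamma_inf: "subgroup Gamma_inf SL2Z"
  unfolding Gamma_inf_def by (rule SL2Z.generate_is_subgroup) (auto simp: in_SL2Z_iff mat_1_nth_2)

interpretation Gamma_inf: subgroup Gamma_inf SL2Z by (rule subgroup_Gamma_inf)

text \<open>A coset is known from its lower row up to sign: two matrices with the same lower row differ
  by an upper triangular factor on the left.\<close>

lemma mem_Gamma_inf_coset_iff:
  assumes M: "M \<in> carrier SL2Z"
  shows "N \<in> Gamma_inf #>\<^bsub>SL2Z\<^esub> M \<longleftrightarrow> N \<in> carrier SL2Z \<and>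
           (a21 M = a21 N \<and> a22 M = a22 N \<or> a21 M = - a21 N \<and> a22 M = - a22 N)"
proof
  assume "N \<in> Gamma_inf #>\<^bsub>SL2Z\<^esub> M"
  then obtain A where A: "A \<in> Gamma_inf" "N = A ** M" by (auto simp: r_coset_def)
  from A have A': "a11 A * a22 A = 1" "a21 A = 0" by (auto simp: Gamma_inf_iff in_SL2Z_iff)
  have "a22 A = 1 \<or> a22 A = -1" using A' by (auto simp: zmult_eq_1_iff)
  moreover have "N \<in> carrier SL2Z" using A M by (metis Gamma_inf.mem_carrier SL2Z.m_closed mult_SL2Z)
  ultimately show "N \<in> carrier SL2Z \<and>
     (a21 M = a21 N \<and> a22 M = a22 N \<or> a21 M = - a21 N \<and> a22 M = - a22 N)"
    using A A' by (auto simp: matrix_mult_nth_2)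
next
  assume N: "N \<in> carrier SL2Z \<and> (a21 M = a21 N \<and> a22 M = a22 N \<or> a21 M = - a21 N \<and> a22 M = - a22 N)"
  define A where "A = N ** inv\<^bsub>SL2Z\<^esub> M"
  have Ac: "A \<in> carrier SL2Z" using N M unfolding A_def by (metis SL2Z.m_closed SL2Z.inv_closed mult_SL2Z)
  have "a21 A = 0" using N M by (auto simp: A_def matrix_mult_nth_2 inv_SL2Z)
  hence "A \<in> Gamma_inf" using Ac by (simp add: Gamma_inf_iff)
  moreover have "A ** M = N" using N M SL2Z.l_inv[OF M]
    by (simp add: A_def matrix_mul_assoc[symmetric])
  ultimately show "N \<in> Gamma_inf #>\<^bsub>SL2Z\<^esub> M" by (force simp: r_coset_def)
qed

text \<open>Matrix with a given lower row, taken the same way as in the definition of the Kloosterman sum.\<close>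

definition lower_row_matrix :: "int \<Rightarrow> int \<Rightarrow> int^2^2" where
  "lower_row_matrix c d = (SOME M. M \<in> carrier SL2Z \<and> a21 M = c \<and> a22 M = d)"

lemma lower_row_matrix:
  assumes "coprime c d"
  shows "lower_row_matrix c d \<in> carrier SL2Z" "a21 (lower_row_matrix c d) = c" "a22 (lower_row_matrix c d) = d"
proof -
  obtain x y where "x * c + y * d = 1" using assms by (metis bezout_int coprime_iff_gcd_eq_1)
  hence "mat2 y (-x) c d \<in> carrier SL2Z" by (simp add: in_SL2Z_iff algebra_simps)
  hence "\<exists>M. M \<in> carrier SL2Z \<and> a21 M = c \<and> a22 M = d" by (auto intro!: exI[of _ "mat2 y (-x) c d"])
  from someI_ex[OF this] show "lower_row_matrix c d \<in> carrier SL2Z" "a21 (lower_row_matrix c d) = c" "a22 (lower_row_matrix c d) = d"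
    unfolding lower_row_matrix_def by auto
qed

lemma coprime_lower_row:
  assumes "M \<in> carrier SL2Z" shows "coprime (a21 M) (a22 M)"
proof (rule coprimeI)
  fix e assume "e dvd a21 M" "e dvd a22 M"
  hence "e dvd a11 M * a22 M - a12 M * a21 M" by simp
  thus "is_unit e" using assms by (simp add: in_SL2Z_iff)
qed

text \<open>Together with \<open>(0, 1)\<close> these are representatives of the lower rows up to sign, hence of the cosets.\<close>

definition cusp_rows :: "(int \<times> int) set" where
  "cusp_rows = {(c, d). c > 0 \<and> coprime c d}"

definition Gamma_inf_invariant :: "(int^2^2 \<Rightarrow> 'a) \<Rightarrow> bool" where
  "Gamma_inf_invariant h \<longleftrightarrow> (\<forall>A\<in>Gamma_inf. \<forall>M\<in>carrier SL2Z. h (A ** M) = h M)"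

lemma Gamma_inf_invariant_coset_rep:
  assumes h: "Gamma_inf_invariant h" and M: "M \<in> carrier SL2Z"
  shows "h (SOME N. N \<in> Gamma_inf #>\<^bsub>SL2Z\<^esub> M) = h M"
proof -
  have "M \<in> Gamma_inf #>\<^bsub>SL2Z\<^esub> M" using M by (rule SL2Z.rcos_self) (rule subgroup_Gamma_inf)
  hence "(SOME N. N \<in> Gamma_inf #>\<^bsub>SL2Z\<^esub> M) \<in> Gamma_inf #>\<^bsub>SL2Z\<^esub> M" by (rule someI)
  thus ?thesis using h M by (auto simp: r_coset_def Gamma_inf_invariant_def)
qed

lemma bij_betw_cosets:
  "bij_betw (\<lambda>(c,d). Gamma_inf #>\<^bsub>SL2Z\<^esub> lower_row_matrix c d) (insert (0,1) cusp_rows) (rcosets\<^bsub>SL2Z\<^esub> Gamma_inf)"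
  unfolding bij_betw_def
proof (intro conjI)
  have cop: "coprime c d" if "(c,d) \<in> insert (0,1) cusp_rows" for c d
    using that by (auto simp: cusp_rows_def)
  show "inj_on (\<lambda>(c,d). Gamma_inf #>\<^bsub>SL2Z\<^esub> lower_row_matrix c d) (insert (0,1) cusp_rows)"
  proof (rule inj_onI, clarify)
    fix c d c' d' assume A: "(c,d) \<in> insert (0,1) cusp_rows" "(c',d') \<in> insert (0,1) cusp_rows"
      "Gamma_inf #>\<^bsub>SL2Z\<^esub> lower_row_matrix c d = Gamma_inf #>\<^bsub>SL2Z\<^esub> lower_row_matrix c' d'"
    have "lower_row_matrix c d \<in> Gamma_inf #>\<^bsub>SL2Z\<^esub> lower_row_matrix c d"
      by (rule SL2Z.rcos_self) (auto intro!: lower_row_matrix cop A subgroup_Gamma_inf)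
    hence "lower_row_matrix c d \<in> Gamma_inf #>\<^bsub>SL2Z\<^esub> lower_row_matrix c' d'" using A by simp
    hence "c' = c \<and> d' = d \<or> c' = - c \<and> d' = - d"
      using lower_row_matrix[OF cop[OF A(1)]] lower_row_matrix[OF cop[OF A(2)]] by (simp add: mem_Gamma_inf_coset_iff)
    thus "c = c' \<and> d = d'" using A by (auto simp: cusp_rows_def)
  qed
  show "(\<lambda>(c,d). Gamma_inf #>\<^bsub>SL2Z\<^esub> lower_row_matrix c d) ` (insert (0,1) cusp_rows) = rcosets\<^bsub>SL2Z\<^esub> Gamma_inf"
  proof (intro equalityI subsetI)
    fix C assume "C \<in> (\<lambda>(c,d). Gamma_inf #>\<^bsub>SL2Z\<^esub> lower_row_matrix c d) ` (insert (0,1) cusp_rows)"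
    thus "C \<in> rcosets\<^bsub>SL2Z\<^esub> Gamma_inf"
      using lower_row_matrix(1)[OF cop] Gamma_inf.subset by (auto intro!: SL2Z.rcosetsI)
  next
    fix C assume "C \<in> rcosets\<^bsub>SL2Z\<^esub> Gamma_inf"
    then obtain M where M: "M \<in> carrier SL2Z" "C = Gamma_inf #>\<^bsub>SL2Z\<^esub> M" by (auto simp: RCOSETS_def)
    define c d where "c = a21 M" and "d = a22 M"
    have cd: "coprime c d" unfolding c_def d_def by (rule coprime_lower_row) fact
    define e where "e = (if c > 0 \<or> c = 0 \<and> d = 1 then 1 else -1::int)"
    have in_set: "(e * c, e * d) \<in> insert (0,1) cusp_rows"
      using cd by (auto simp: cusp_rows_def e_def)
    have lrm: "lower_row_matrix (e*c) (e*d) \<in> carrier SL2Z" "a21 (lower_row_matrix (e*c) (e*d)) = e*c" "a22 (lower_row_matrix (e*c) (e*d)) = e*d"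
      using lower_row_matrix[OF cop[OF in_set]] by auto
    have "lower_row_matrix (e*c) (e*d) \<in> Gamma_inf #>\<^bsub>SL2Z\<^esub> M"
      unfolding mem_Gamma_inf_coset_iff[OF M(1)] using lrm by (auto simp: e_def c_def d_def)
    hence "C = Gamma_inf #>\<^bsub>SL2Z\<^esub> lower_row_matrix (e*c) (e*d)"
      unfolding M using SL2Z.repr_independence[OF _ M(1) subgroup_Gamma_inf] by simp
    thus "C \<in> (\<lambda>(c,d). Gamma_inf #>\<^bsub>SL2Z\<^esub> lower_row_matrix c d) ` (insert (0,1) cusp_rows)"
      using in_set by (intro image_eqI[of _ _ "(e*c, e*d)"]) auto
  qed
qed

text \<open>The coset of the identity, with lower row \<open>(0, 1)\<close>, is split off: it carries the leading
  term of the Poincare series.\<close>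

lemma has_sum_cosets_iff:
  fixes h :: "int^2^2 \<Rightarrow> complex"
  assumes "Gamma_inf_invariant h"
  shows "((\<lambda>C. h (SOME M. M \<in> C)) has_sum S) (rcosets\<^bsub>SL2Z\<^esub> Gamma_inf) \<longleftrightarrow>
         ((\<lambda>(c,d). h (lower_row_matrix c d)) has_sum (S - h (mat 1))) cusp_rows"
proof -
  have "((\<lambda>C. h (SOME M. M \<in> C)) has_sum S) (rcosets\<^bsub>SL2Z\<^esub> Gamma_inf) \<longleftrightarrow>
        ((\<lambda>(c,d). h (SOME M. M \<in> Gamma_inf #>\<^bsub>SL2Z\<^esub> lower_row_matrix c d)) has_sum S) (insert (0,1) cusp_rows)"
    by (subst has_sum_reindex_bij_betw[OF bij_betw_cosets, symmetric]) (simp add: case_prod_unfold)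
  also have "\<dots> \<longleftrightarrow> ((\<lambda>(c,d). h (lower_row_matrix c d)) has_sum S) (insert (0,1) cusp_rows)"
    by (rule has_sum_cong)
       (auto simp: cusp_rows_def intro!: Gamma_inf_invariant_coset_rep[OF assms] lower_row_matrix)
  also have "\<dots> \<longleftrightarrow> ((\<lambda>(c,d). h (lower_row_matrix c d)) has_sum (S - h (lower_row_matrix 0 1))) cusp_rows"
  proof
    assume *: "((\<lambda>(c,d). h (lower_row_matrix c d)) has_sum S) (insert (0,1) cusp_rows)"
    have "((\<lambda>(c,d). h (lower_row_matrix c d)) has_sum (S - (\<lambda>(c,d). h (lower_row_matrix c d)) (0,1))) (insert (0,1) cusp_rows - {(0,1)})"
      by (rule has_sum_Diff[OF * has_sum_finiteI]) auto
    moreover have "insert (0,1) cusp_rows - {(0,1)} = cusp_rows" by (auto simp: cusp_rows_def)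
    ultimately show "((\<lambda>(c,d). h (lower_row_matrix c d)) has_sum (S - h (lower_row_matrix 0 1))) cusp_rows" by simp
  next
    assume *: "((\<lambda>(c,d). h (lower_row_matrix c d)) has_sum (S - h (lower_row_matrix 0 1))) cusp_rows"
    show "((\<lambda>(c,d). h (lower_row_matrix c d)) has_sum S) (insert (0,1) cusp_rows)"
      using has_sum_insert[of "(0,1)" cusp_rows, OF _ *] by (simp add: cusp_rows_def)
  qed
  also have "h (lower_row_matrix 0 1) = h (mat 1)"
  proof -
    have "lower_row_matrix 0 1 \<in> Gamma_inf"
      using lower_row_matrix[of 0 1] by (simp add: Gamma_inf_iff)
    moreover have "mat 1 \<in> carrier SL2Z" by (simp add: in_SL2Z_iff mat_1_nth_2)
    ultimately have "h (lower_row_matrix 0 1 ** mat 1) = h (mat 1)" using assms unfolding Gamma_inf_invariant_def by blast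
    thus ?thesis by simp
  qed
  finally show ?thesis .
qed

text \<open>Right multiplication permutes the cosets. This makes a sum over the cosets a modular form.\<close>

lemma has_sum_cosets_translate:
  fixes h :: "int^2^2 \<Rightarrow> complex"
  assumes h: "Gamma_inf_invariant h" and N: "N \<in> carrier SL2Z"
  shows "((\<lambda>C. h (SOME M. M \<in> C)) has_sum S) (rcosets\<^bsub>SL2Z\<^esub> Gamma_inf) \<longleftrightarrow>
         ((\<lambda>C. h ((SOME M. M \<in> C) ** N)) has_sum S) (rcosets\<^bsub>SL2Z\<^esub> Gamma_inf)"
proof (rule has_sum_reindex_bij_witness[where i = "\<lambda>C. C #>\<^bsub>SL2Z\<^esub> N" and j = "\<lambda>C. C #>\<^bsub>SL2Z\<^esub> inv\<^bsub>SL2Z\<^esub> N"])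
  have sub: "C \<subseteq> carrier SL2Z" if "C \<in> rcosets\<^bsub>SL2Z\<^esub> Gamma_inf" for C
    using that SL2Z.rcosets_part_G[OF subgroup_Gamma_inf] by auto
  have clo: "C #>\<^bsub>SL2Z\<^esub> N \<in> rcosets\<^bsub>SL2Z\<^esub> Gamma_inf" if C: "C \<in> rcosets\<^bsub>SL2Z\<^esub> Gamma_inf" "N \<in> carrier SL2Z" for C N
  proof -
    obtain M where M: "M \<in> carrier SL2Z" "C = Gamma_inf #>\<^bsub>SL2Z\<^esub> M" using C by (auto simp: RCOSETS_def)
    have "C #>\<^bsub>SL2Z\<^esub> N = Gamma_inf #>\<^bsub>SL2Z\<^esub> (M \<otimes>\<^bsub>SL2Z\<^esub> N)"
      unfolding M using M that by (intro SL2Z.coset_mult_assoc Gamma_inf.subset) auto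
    thus ?thesis using M that by (simp only:) (intro SL2Z.rcosetsI Gamma_inf.subset SL2Z.m_closed)
  qed
  fix C assume C: "C \<in> rcosets\<^bsub>SL2Z\<^esub> Gamma_inf"
  have [simp]: "C #>\<^bsub>SL2Z\<^esub> mat 1 = C" using SL2Z.coset_mult_one[OF sub[OF C]] by simp
  show "C #>\<^bsub>SL2Z\<^esub> inv\<^bsub>SL2Z\<^esub> N #>\<^bsub>SL2Z\<^esub> N = C"
    using N SL2Z.l_inv[OF N] by (subst SL2Z.coset_mult_assoc[OF sub[OF C]]) (simp_all del: SL2Z.l_inv)
  show "C #>\<^bsub>SL2Z\<^esub> N #>\<^bsub>SL2Z\<^esub> inv\<^bsub>SL2Z\<^esub> N = C"
    using N SL2Z.r_inv[OF N] by (subst SL2Z.coset_mult_assoc[OF sub[OF C]]) (simp_all del: SL2Z.r_inv)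
  show "C #>\<^bsub>SL2Z\<^esub> N \<in> rcosets\<^bsub>SL2Z\<^esub> Gamma_inf" "C #>\<^bsub>SL2Z\<^esub> inv\<^bsub>SL2Z\<^esub> N \<in> rcosets\<^bsub>SL2Z\<^esub> Gamma_inf"
    by (rule clo; use C N in simp)+
  obtain M where M: "M \<in> carrier SL2Z" "C = Gamma_inf #>\<^bsub>SL2Z\<^esub> M" using C unfolding RCOSETS_def by (elim UN_E singletonE)
  have MN: "M ** inv\<^bsub>SL2Z\<^esub> N \<in> carrier SL2Z" using M N by (metis SL2Z.m_closed SL2Z.inv_closed mult_SL2Z)
  have *: "C #>\<^bsub>SL2Z\<^esub> inv\<^bsub>SL2Z\<^esub> N = Gamma_inf #>\<^bsub>SL2Z\<^esub> (M ** inv\<^bsub>SL2Z\<^esub> N)"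
    unfolding M using M N by (subst SL2Z.coset_mult_assoc[OF Gamma_inf.subset]) auto
  have hN: "Gamma_inf_invariant (\<lambda>M. h (M ** N))" unfolding Gamma_inf_invariant_def
  proof (intro ballI)
    fix A M assume "A \<in> Gamma_inf" "M \<in> carrier SL2Z"
    moreover from this have "M ** N \<in> carrier SL2Z" using N by (metis SL2Z.m_closed mult_SL2Z)
    ultimately show "h (A ** M ** N) = h (M ** N)" using h by (auto simp: Gamma_inf_invariant_def matrix_mul_assoc[symmetric])
  qed
  have "h ((SOME M. M \<in> C #>\<^bsub>SL2Z\<^esub> inv\<^bsub>SL2Z\<^esub> N) ** N) = h ((M ** inv\<^bsub>SL2Z\<^esub> N) ** N)"
    unfolding * by (rule Gamma_inf_invariant_coset_rep[OF hN MN])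
  also have "(M ** inv\<^bsub>SL2Z\<^esub> N) ** N = M" using M SL2Z.l_inv[OF N] by (simp add: matrix_mul_assoc[symmetric])
  also have "h M = h (SOME M. M \<in> C)" unfolding M by (rule Gamma_inf_invariant_coset_rep[OF h M(1), symmetric])
  finally show "h ((SOME M. M \<in> C #>\<^bsub>SL2Z\<^esub> inv\<^bsub>SL2Z\<^esub> N) ** N) = h (SOME M. M \<in> C)" .
qed simp

section \<open>Euler's product\<close>

definition euler_prod :: "complex \<Rightarrow> complex" where
  "euler_prod q = (\<Prod>n. 1 - q ^ Suc n)"

lemma summable_norm_power_Suc: "norm (q::complex) < 1 \<Longrightarrow> summable (\<lambda>n. norm (q ^ Suc n))"
  by (simp add: norm_mult norm_power summable_geometric summable_mult)

lemma one_minus_power_nonzero: "norm (q::complex) < 1 \<Longrightarrow> n > 0 \<Longrightarrow> 1 - q ^ n \<noteq> 0"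
proof
  assume q: "norm q < 1" "n > 0" "1 - q ^ n = 0"
  hence "norm (q ^ n) = 1" by (metis eq_iff_diff_eq_0 norm_one)
  moreover have "norm q ^ n < 1" using q by (intro power_Suc_less_one power_less_one_iff[THEN iffD2]) auto
  ultimately show False by (simp add: norm_power)
qed

lemma convergent_euler_prod: "norm (q::complex) < 1 \<Longrightarrow> convergent_prod (\<lambda>n. 1 - q ^ Suc n)"
proof (rule abs_convergent_prod_imp_convergent_prod)
  assume "norm q < 1"
  thus "abs_convergent_prod (\<lambda>n. 1 - q ^ Suc n)"
    using summable_norm_power_Suc[of q] by (intro summable_imp_abs_convergent_prod) simp
qed

lemma euler_prod_nonzero:
  assumes "norm q < 1" shows "euler_prod q \<noteq> 0"
  unfolding euler_prod_def
  by (rule prodinf_nonzero[OF convergent_euler_prod[OF assms]]) (rule one_minus_power_nonzero[OF assms], simp)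

lemma euler_prod_0 [simp]: "euler_prod 0 = 1"
  by (simp add: euler_prod_def)

lemma uniform_limit_euler_prod:
  assumes "\<rho> < 1"
  shows "uniform_limit (cball 0 \<rho>) (\<lambda>N q. \<Prod>n<N. 1 - q ^ Suc n) euler_prod sequentially"
proof (cases "\<rho> \<ge> 0")
  case True
  have "uniformly_convergent_on (cball 0 \<rho>) (\<lambda>N q::complex. \<Prod>n<N. 1 - q ^ Suc n)"
  proof (rule uniformly_convergent_on_prod')
    show "uniformly_convergent_on (cball 0 \<rho>) (\<lambda>N q::complex. \<Sum>n<N. norm (1 - q ^ Suc n - 1))"
    proof (rule Weierstrass_m_test'[where M = "\<lambda>n. \<rho> ^ Suc n"])
      show "norm (norm (1 - q ^ Suc n - 1)) \<le> \<rho> ^ Suc n" if "q \<in> cball 0 \<rho>" for n and q :: complex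
      proof -
        have "norm q ^ Suc n \<le> \<rho> ^ Suc n" using that by (intro power_mono) auto
        thus ?thesis by (simp add: norm_mult norm_power)
      qed
      show "summable (\<lambda>n. \<rho> ^ Suc n)" using True assms by (simp add: summable_mult)
    qed
  qed (auto intro!: continuous_intros)
  then obtain l where l: "uniform_limit (cball 0 \<rho>) (\<lambda>N q::complex. \<Prod>n<N. 1 - q ^ Suc n) l sequentially"
    unfolding uniformly_convergent_on_def by blast
  have "l q = euler_prod q" if "q \<in> cball 0 \<rho>" for q
  proof (rule LIMSEQ_unique)
    show "(\<lambda>N. \<Prod>n<N. 1 - q ^ Suc n) \<longlonglongrightarrow> l q" by (rule tendsto_uniform_limitI[OF l that])
    show "(\<lambda>N. \<Prod>n<N. 1 - q ^ Suc n) \<longlonglongrightarrow> euler_prod q"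
      unfolding euler_prod_def
      by (intro has_prod_imp_tendsto' convergent_prod_has_prod convergent_euler_prod) (use that assms in auto)
  qed
  thus ?thesis using uniform_limit_cong'[of "cball 0 \<rho>" _ _ l euler_prod sequentially] l by blast
qed auto

lemma holomorphic_euler_prod [holomorphic_intros]: "euler_prod holomorphic_on ball 0 1"
proof (rule holomorphic_uniform_sequence[where f = "\<lambda>N q. \<Prod>n<N. 1 - q ^ Suc n"])
  fix x :: complex assume x: "x \<in> ball 0 1"
  define d where "d = (1 - norm x) / 2"
  have d: "d > 0" "norm x + d < 1" using x by (auto simp: d_def field_simps)
  have sub: "cball x d \<subseteq> cball 0 (norm x + d)"
    by (auto simp: dist_norm) (smt (verit) norm_minus_commute norm_triangle_ineq2)
  show "\<exists>d>0. cball x d \<subseteq> ball 0 1 \<and> uniform_limit (cball x d) (\<lambda>N q. \<Prod>n<N. 1 - q ^ Suc n) euler_prod sequentially"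
    using d sub by (intro exI[of _ d] conjI uniform_limit_on_subset[OF uniform_limit_euler_prod sub]) auto
qed (auto intro!: holomorphic_intros)

lemma dedekind_eta_eq: "dedekind_eta \<tau> = qpow (1/24) \<tau> * euler_prod (qpow 1 \<tau>)"
  by (simp add: dedekind_eta_def euler_prod_def)

lemma norm_nome_less_1: "Im \<tau> > 0 \<Longrightarrow> norm (qpow 1 \<tau>) < 1"
  by (simp add: norm_qpow)

lemma dedekind_eta_nonzero: "Im \<tau> > 0 \<Longrightarrow> dedekind_eta \<tau> \<noteq> 0"
  by (simp add: dedekind_eta_eq euler_prod_nonzero norm_nome_less_1)

lemma holomorphic_dedekind_eta: "dedekind_eta holomorphic_on {\<tau>. Im \<tau> > 0}"
proof -
  have "(\<lambda>\<tau>. qpow (1/24) \<tau> * (euler_prod \<circ> qpow 1) \<tau>) holomorphic_on {\<tau>. Im \<tau> > 0}"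
    by (intro holomorphic_intros holomorphic_on_compose_gen[OF _ holomorphic_euler_prod])
       (auto simp: norm_nome_less_1)
  thus ?thesis by (simp add: dedekind_eta_eq[abs_def] o_def)
qed

section \<open>The generating function of coloured partitions\<close>

text \<open>The set \<open>A\<close> of admissible coloured parts is a parameter so that the generating function can be built
  up by adding one part after the other.\<close>

definition colored_multisets :: "(nat \<times> nat) set \<Rightarrow> nat \<Rightarrow> (nat \<times> nat) multiset set" where
  "colored_multisets A n = {P. set_mset P \<subseteq> A \<and> sum_mset (image_mset fst P) = n}"

lemma finite_colored_multisets:
  assumes "finite A" "A \<subseteq> {1..} \<times> UNIV"
  shows "finite (colored_multisets A n)"
proof -
  have "colored_multisets A n \<subseteq> mset ` {xs. set xs \<subseteq> A \<and> length xs \<le> n}"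
  proof
    fix P assume P: "P \<in> colored_multisets A n"
    obtain xs where xs: "P = mset xs" by (metis ex_mset)
    have "size P = sum_mset (image_mset (\<lambda>_. 1) P)" by simp
    also have "\<dots> \<le> sum_mset (image_mset fst P)"
      by (rule sum_mset_mono) (use P assms in \<open>auto simp: colored_multisets_def\<close>)
    also have "\<dots> = n" using P by (simp add: colored_multisets_def)
    finally show "P \<in> mset ` {xs. set xs \<subseteq> A \<and> length xs \<le> n}"
      using P xs by (auto simp: colored_multisets_def)
  qed
  thus ?thesis using finite_lists_length_le[OF assms(1), of n] by (auto intro: finite_subset)
qed

text \<open>A multiset either avoids the new part \<open>a\<close> or is obtained by adding one copy of \<open>a\<close>. This is the
  recurrence expressed by the factor \<open>1 / (1 - q ^ fst a)\<close>.\<close>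

lemma card_colored_multisets_insert:
  assumes A: "finite A" "insert a A \<subseteq> {1..} \<times> UNIV" "a \<notin> A"
  shows "card (colored_multisets (insert a A) n) =
           card (colored_multisets A n) + (if fst a \<le> n then card (colored_multisets (insert a A) (n - fst a)) else 0)"
proof -
  let ?M = "colored_multisets (insert a A)"
  have fin: "finite (?M n)" for n using A by (intro finite_colored_multisets) auto
  have "?M n = colored_multisets A n \<union> {P \<in> ?M n. a \<in># P}"
    using A by (auto simp: colored_multisets_def)
  moreover have "colored_multisets A n \<inter> {P \<in> ?M n. a \<in># P} = {}"
    using A by (auto simp: colored_multisets_def)
  ultimately have "card (?M n) = card (colored_multisets A n) + card {P \<in> ?M n. a \<in># P}"
    using fin[of n] by (metis card_Un_disjoint finite_Un)
  moreover have "card {P \<in> ?M n. a \<in># P} = (if fst a \<le> n then card (?M (n - fst a)) else 0)"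
  proof (cases "fst a \<le> n")
    case True
    have "bij_betw (add_mset a) (?M (n - fst a)) {P \<in> ?M n. a \<in># P}"
    proof (rule bij_betwI[where g = "\<lambda>P. P - {#a#}"])
      show "add_mset a \<in> ?M (n - fst a) \<rightarrow> {P \<in> ?M n. a \<in># P}"
        using True by (auto simp: colored_multisets_def)
      show "(\<lambda>P. P - {#a#}) \<in> {P \<in> ?M n. a \<in># P} \<rightarrow> ?M (n - fst a)"
      proof
        fix P assume P: "P \<in> {P \<in> ?M n. a \<in># P}"
        then obtain Q where "P = add_mset a Q" by (auto dest: multi_member_split)
        thus "P - {#a#} \<in> ?M (n - fst a)" using P by (auto simp: colored_multisets_def)
      qed
    qed auto
    thus ?thesis using True by (simp add: bij_betw_same_card)
  next
    case False
    have "{P \<in> ?M n. a \<in># P} = {}"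
      using False by (auto simp: colored_multisets_def dest!: multi_member_split)
    hence "card {P \<in> ?M n. a \<in># P} = 0" by (simp only: card.empty)
    thus ?thesis using False by simp
  qed
  ultimately show ?thesis by simp
qed

lemma has_fps_expansion_colored_multisets:
  assumes "finite A" "A \<subseteq> {1..} \<times> UNIV"
  shows "(\<lambda>q::complex. \<Prod>a\<in>A. inverse (1 - q ^ fst a)) has_fps_expansion Abs_fps (\<lambda>n. of_nat (card (colored_multisets A n)))"
  using assms
proof (induction A rule: finite_induct)
  case empty
  have "colored_multisets {} n = (if n = 0 then {{#}} else {})" for n by (auto simp: colored_multisets_def)
  hence "Abs_fps (\<lambda>n. of_nat (card (colored_multisets {} n))) = (1 :: complex fps)"
    by (auto simp: fps_eq_iff)
  thus ?case by simp
next
  case (insert a A)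
  let ?F = "\<lambda>A. Abs_fps (\<lambda>n. of_nat (card (colored_multisets A n))) :: complex fps"
  let ?D = "1 - fps_X ^ fst a :: complex fps"
  have w: "fst a \<ge> 1" using insert by auto
  have "fps_nth (?F (insert a A) * ?D) n = fps_nth (?F A) n" for n
    using card_colored_multisets_insert[of A a n] insert w
    by (auto simp: right_diff_distrib fps_X_power_mult_right_nth not_less)
  hence FD: "?F (insert a A) * ?D = ?F A" by (simp add: fps_eq_iff)
  have D: "fps_nth ?D 0 \<noteq> 0" using w by simp
  have "inverse ?D * ?F A = ?F (insert a A) * (inverse ?D * ?D)"
    unfolding FD[symmetric] by (simp only: mult_ac)
  hence eq: "?F (insert a A) = inverse ?D * ?F A"
    unfolding inverse_mult_eq_1[OF D] by simp
  have "(\<lambda>q::complex. inverse (1 - q ^ fst a) * (\<Prod>a\<in>A. inverse (1 - q ^ fst a))) has_fps_expansion inverse ?D * ?F A"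
    using D insert by (intro fps_expansion_intros insert.IH) auto
  thus ?case using insert eq by simp
qed

lemma num_color_partitions_eq:
  assumes "n \<le> N"
  shows "num_color_partitions r n = card (colored_multisets ({1..N} \<times> {..<r}) n)"
proof -
  have "fst x \<le> n" if "x \<in># P" "sum_mset (image_mset fst P) = n" for x and P :: "(nat \<times> nat) multiset"
    using that by (auto dest!: multi_member_split)
  hence "color_partitions r n = colored_multisets ({1..N} \<times> {..<r}) n"
    using assms unfolding color_partitions_def colored_multisets_def by fastforce
  thus ?thesis by (simp add: num_color_partitions_def)
qed

text \<open>For the truncated products the coefficients are counted above, and truncation beyond \<open>n\<close> does not
  change the \<open>n\<close>-th one. Uniform convergence near zero carries the derivatives to the limit.\<close>

lemma deriv_inverse_euler_prod_power:
  "(deriv ^^ n) (\<lambda>q. inverse (euler_prod q) ^ r) 0 = fact n * of_nat (num_color_partitions r n)"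
proof -
  define A where "A = ball (0::complex) (1/2)"
  have sub: "A \<subseteq> cball 0 (1/2)" by (auto simp: A_def)
  have hol: "euler_prod holomorphic_on cball 0 (1/2)"
    by (rule holomorphic_on_subset[OF holomorphic_euler_prod]) auto
  have nz: "euler_prod q \<noteq> 0" if "q \<in> cball 0 (1/2)" for q using that by (intro euler_prod_nonzero) auto
  have cont: "continuous_on (cball 0 (1/2)) (\<lambda>q. inverse (euler_prod q))"
    using nz by (intro continuous_intros holomorphic_on_imp_continuous_on[OF hol]) auto
  have bnd: "bounded ((\<lambda>q. inverse (euler_prod q) ^ r) ` cball 0 (1/2))" for r
    by (intro compact_imp_bounded compact_continuous_image continuous_intros cont) auto
  then obtain B where B: "\<And>q. q \<in> cball 0 (1/2) \<Longrightarrow> norm (inverse (euler_prod q)) \<le> B"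
  proof -
    obtain B where "\<forall>x\<in>(\<lambda>q. inverse (euler_prod q) ^ 1) ` cball 0 (1/2). norm x \<le> B"
      using bnd[of 1] unfolding bounded_iff by blast
    thus ?thesis by (intro that[of B]) auto
  qed
  have "B > 0" using B[of 0] by simp
  have "uniform_limit (cball 0 (1/2)) (\<lambda>N q. inverse (\<Prod>n<N. 1 - q ^ Suc n)) (inverse \<circ> euler_prod) sequentially"
  proof (rule uniform_lim_inverse[OF uniform_limit_euler_prod])
    show "1 / B \<le> norm (euler_prod q)" if "q \<in> cball 0 (1/2)" for q
      using B[OF that] \<open>B > 0\<close> nz[OF that] by (simp add: norm_inverse norm_divide field_simps)
  qed (use \<open>B > 0\<close> in auto)
  hence lim1: "uniform_limit (cball 0 (1/2)) (\<lambda>N q. inverse (\<Prod>n<N. 1 - q ^ Suc n)) (\<lambda>q. inverse (euler_prod q)) sequentially"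
    unfolding o_def .
  have bnd1: "bounded ((\<lambda>q. inverse (euler_prod q)) ` cball 0 (1/2))"
    using bnd[of 1] unfolding power_one_right .
  have limr: "uniform_limit (cball 0 (1/2)) (\<lambda>N q. inverse (\<Prod>n<N. 1 - q ^ Suc n) ^ r) (\<lambda>q. inverse (euler_prod q) ^ r) sequentially"
  proof (induction r)
    case 0
    show ?case unfolding power_0 by (rule uniform_limit_const)
  next
    case (Suc r)
    show ?case unfolding power_Suc[of _ r] by (rule uniform_lim_mult[OF lim1 Suc bnd1 bnd])
  qed
  have lim: "(\<lambda>N. (deriv ^^ n) (\<lambda>q::complex. inverse (\<Prod>n<N. 1 - q ^ Suc n) ^ r) 0) \<longlonglongrightarrow> (deriv ^^ n) (\<lambda>q. inverse (euler_prod q) ^ r) 0"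
  proof (rule higher_deriv_complex_uniform_limit[OF uniform_limit_on_subset[OF limr sub]])
    show "\<forall>\<^sub>F N in sequentially. (\<lambda>q. inverse (\<Prod>n<N. 1 - q ^ Suc n) ^ r) holomorphic_on A"
    proof (intro always_eventually allI holomorphic_intros)
      fix N q assume "q \<in> A"
      thus "(\<Prod>n<N. 1 - q ^ Suc n) \<noteq> 0"
        using one_minus_power_nonzero[of q "Suc _"] by (auto simp: A_def)
    qed
    show "sequentially \<noteq> bot" by (rule sequentially_bot)
    show "open A" "0 \<in> A" by (simp_all add: A_def)
  qed
  have "(deriv ^^ n) (\<lambda>q::complex. inverse (\<Prod>n<N. 1 - q ^ Suc n) ^ r) 0 = fact n * of_nat (num_color_partitions r n)" if "N \<ge> n" for N
  proof -
    have prod_eq: "(\<lambda>q::complex. inverse (\<Prod>n<N. 1 - q ^ Suc n) ^ r) = (\<lambda>q. \<Prod>a\<in>{1..N} \<times> {..<r}. inverse (1 - q ^ fst a))"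
    proof
      fix q :: complex
      have "(\<Prod>a\<in>{1..N} \<times> {..<r}. inverse (1 - q ^ fst a)) = (\<Prod>j\<in>{1..N}. \<Prod>i\<in>{..<r}. inverse (1 - q ^ j))"
        by (subst prod.cartesian_product) (simp add: case_prod_unfold)
      also have "\<dots> = (\<Prod>j\<in>{1..N}. inverse (1 - q ^ j)) ^ r" by (simp add: prod_power_distrib)
      also have "(\<Prod>j\<in>{1..N}. inverse (1 - q ^ j)) = (\<Prod>n<N. inverse (1 - q ^ Suc n))"
        by (rule prod.reindex_bij_witness[of _ Suc "\<lambda>n. n - 1"]) auto
      also have "\<dots> = inverse (\<Prod>n<N. 1 - q ^ Suc n)"
        using prod_inversef[of "\<lambda>n. 1 - q ^ Suc n" "{..<N}"] by (simp only: o_def)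
      finally show "inverse (\<Prod>n<N. 1 - q ^ Suc n) ^ r = (\<Prod>a\<in>{1..N} \<times> {..<r}. inverse (1 - q ^ fst a))" ..
    qed
    have "(\<lambda>q::complex. inverse (\<Prod>n<N. 1 - q ^ Suc n) ^ r) has_fps_expansion Abs_fps (\<lambda>n. of_nat (card (colored_multisets ({1..N} \<times> {..<r}) n)))"
      unfolding prod_eq by (rule has_fps_expansion_colored_multisets) auto
    from fps_nth_fps_expansion[OF this, of n] have
      "of_nat (card (colored_multisets ({1..N} \<times> {..<r}) n)) = (deriv ^^ n) (\<lambda>q::complex. inverse (\<Prod>n<N. 1 - q ^ Suc n) ^ r) 0 / fact n"
      unfolding fps_nth_Abs_fps .
    from this[unfolded nonzero_eq_divide_eq[OF fact_nonzero], symmetric]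
    show ?thesis unfolding num_color_partitions_eq[OF that, of r] by (rule trans[OF _ mult.commute])
  qed
  hence "(\<lambda>N. (deriv ^^ n) (\<lambda>q::complex. inverse (\<Prod>n<N. 1 - q ^ Suc n) ^ r) 0) \<longlonglongrightarrow> fact n * of_nat (num_color_partitions r n)"
    by (intro tendsto_eventually) (auto simp: eventually_at_top_linorder intro!: exI[of _ n])
  from LIMSEQ_unique[OF lim this] show ?thesis .
qed

text \<open>Cauchy's integral formula on the circle \<open>norm q = exp (- 2 \<pi> y)\<close>, read as an integral over
  one period of \<open>\<tau>\<close>.\<close>

lemma integral_period_power_series_coeff:
  assumes F: "F holomorphic_on ball 0 1" and y: "y > 0"
  shows "integral {0..1} (\<lambda>x. F (qpow 1 (Complex x y)) * qpow (- real n) (Complex x y)) = (deriv ^^ n) F 0 / fact n"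
proof -
  define \<rho> where "\<rho> = exp (- 2 * pi * y)"
  have \<rho>: "\<rho> > 0" "\<rho> < 1" using y by (auto simp: \<rho>_def)
  have q: "qpow 1 (Complex x y) = circlepath 0 \<rho> x" for x
    by (simp add: qpow_def circlepath Complex_eq \<rho>_def exp_of_real[symmetric] algebra_simps exp_diff exp_minus field_simps
         flip: exp_add)
  have vd: "vector_derivative (circlepath 0 \<rho>) (at x) = 2 * pi * \<i> * circlepath 0 \<rho> x" for x
    using vector_derivative_circlepath[of 0 \<rho> x] by (simp add: circlepath)
  have "((\<lambda>u. F u / (u - 0) ^ (Suc n)) has_contour_integral ((2 * pi * \<i>) / (fact n) * (deriv ^^ n) F 0)) (circlepath 0 \<rho>)"
    by (rule Cauchy_has_contour_integral_higher_derivative_circlepath)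
       (use \<rho> in \<open>auto intro!: holomorphic_on_imp_continuous_on holomorphic_on_subset[OF F]\<close>)
  hence "((\<lambda>x. F (circlepath 0 \<rho> x) / (circlepath 0 \<rho> x) ^ (Suc n) * (2 * pi * \<i> * circlepath 0 \<rho> x)) has_integral ((2 * pi * \<i>) / (fact n) * (deriv ^^ n) F 0)) {0..1}"
    by (simp add: has_contour_integral vd)
  hence "((\<lambda>x. F (circlepath 0 \<rho> x) / (circlepath 0 \<rho> x) ^ (Suc n) * (2 * pi * \<i> * circlepath 0 \<rho> x) * (1 / (2 * pi * \<i>))) has_integral ((2 * pi * \<i>) / (fact n) * (deriv ^^ n) F 0) * (1 / (2 * pi * \<i>))) {0..1}"
    by (rule has_integral_mult_left)
  moreover have "F (circlepath 0 \<rho> x) / (circlepath 0 \<rho> x) ^ (Suc n) * (2 * pi * \<i> * circlepath 0 \<rho> x) * (1 / (2 * pi * \<i>)) =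
        F (qpow 1 (Complex x y)) * qpow (- real n) (Complex x y)" for x
  proof -
    have "circlepath 0 \<rho> x \<noteq> 0" unfolding q[symmetric] by simp
    thus ?thesis by (simp add: qpow_minus qpow_nat q field_simps)
  qed
  ultimately show ?thesis by (auto intro!: integral_unique)
qed

section \<open>Lattice sums\<close>

lemma summable_on_int_powr:
  assumes "t > 1"
  shows "(\<lambda>c::int. (1 + real_of_int \<bar>c\<bar>) powr - t) summable_on UNIV"
proof -
  have "summable (\<lambda>n. real (n + 1) powr - t)"
    using assms by (subst summable_iff_shift[of "\<lambda>n. real n powr -t" 1]) (simp add: summable_real_powr_iff)
  hence "(\<lambda>n. (1 + real n) powr - t) summable_on UNIV"
    by (intro summable_nonneg_imp_summable_on) (auto simp: add_ac)
  hence nat: "(\<lambda>n. (1 + real_of_int \<bar>s * int n\<bar>) powr - t) summable_on UNIV" if "s \<in> {1,-1}" for s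
    using that by auto
  have "(\<lambda>c::int. (1 + real_of_int \<bar>c\<bar>) powr - t) summable_on range (\<lambda>n. s * int n)" if "s \<in> {1,-1}" for s
    using nat[OF that] that by (subst summable_on_reindex) (auto intro!: injI simp: o_def)
  from this[of 1] this[of "-1"]
  have "(\<lambda>c::int. (1 + real_of_int \<bar>c\<bar>) powr - t) summable_on (range (\<lambda>n. 1 * int n) \<union> range (\<lambda>n. -1 * int n))"
    by (intro summable_on_union) auto
  also have "range (\<lambda>n. 1 * int n) \<union> range (\<lambda>n. -1 * int n) = UNIV"
  proof (safe, goal_cases)
    case (3 x)
    thus ?case by (cases x rule: int_cases2) auto
  qed auto
  finally show ?thesis .
qed

text \<open>The exponent is split evenly between the two coordinates, which reduces the
  double series to one-dimensional ones.\<close>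

lemma summable_on_lattice_powr:
  assumes "s > 2"
  shows "(\<lambda>(c::int, d::int). (1 + real_of_int \<bar>c\<bar> + real_of_int \<bar>d\<bar>) powr - s) summable_on UNIV"
proof -
  have "(\<lambda>(c,d). (1 + real_of_int \<bar>c\<bar>) powr - (s/2) * (1 + real_of_int \<bar>d\<bar>) powr - (s/2)) summable_on UNIV \<times> UNIV"
  proof (rule summable_on_SigmaI)
    have S: "(\<lambda>c::int. (1 + real_of_int \<bar>c\<bar>) powr - (s/2)) summable_on UNIV"
      using assms by (intro summable_on_int_powr) auto
    fix c :: int
    show "((\<lambda>d. (\<lambda>(c,d). (1 + real_of_int \<bar>c\<bar>) powr - (s/2) * (1 + real_of_int \<bar>d\<bar>) powr - (s/2)) (c, d)) has_sum
            (1 + real_of_int \<bar>c\<bar>) powr - (s/2) * (\<Sum>\<^sub>\<infinity>d::int. (1 + real_of_int \<bar>d\<bar>) powr - (s/2))) UNIV"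
      unfolding prod.case by (intro has_sum_cmult_right has_sum_infsum S)
    show "(\<lambda>c::int. (1 + real_of_int \<bar>c\<bar>) powr - (s/2) * (\<Sum>\<^sub>\<infinity>d::int. (1 + real_of_int \<bar>d\<bar>) powr - (s/2))) summable_on UNIV"
      by (intro summable_on_cmult_left S)
  qed auto
  thus ?thesis
    unfolding UNIV_Times_UNIV
  proof (rule summable_on_comparison_test)
    fix p :: "int \<times> int"
    obtain c d where p: "p = (c, d)" by (cases p)
    define u v where "u = real_of_int \<bar>c\<bar>" and "v = real_of_int \<bar>d\<bar>"
    have uv: "u \<ge> 0" "v \<ge> 0" by (auto simp: u_def v_def)
    have "(1 + u) * (1 + v) \<le> (1 + u + v)^2" using uv by (simp add: power2_eq_square algebra_simps)
    hence "((1 + u + v)^2) powr - (s/2) \<le> ((1 + u) * (1 + v)) powr - (s/2)"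
      using uv assms by (intro powr_mono2') auto
    also have "((1 + u + v)^2) powr - (s/2) = (1 + u + v) powr - s"
      using uv powr_powr[of "1+u+v" 2 "-(s/2)"] by (simp add: powr_numeral)
    finally show "(case p of (c,d) \<Rightarrow> (1 + real_of_int \<bar>c\<bar> + real_of_int \<bar>d\<bar>) powr - s) \<le>
      (case p of (c,d) \<Rightarrow> (1 + real_of_int \<bar>c\<bar>) powr - (s/2) * (1 + real_of_int \<bar>d\<bar>) powr - (s/2))"
      using uv by (simp add: p u_def v_def powr_mult)
  qed (auto simp: case_prod_unfold)
qed

text \<open>The imaginary part bounds \<open>c\<close> and then the triangle inequality bounds \<open>d\<close>; the factor two absorbs the
  summand one, as \<open>\<bar>c\<bar> + \<bar>d\<bar> \<ge> 1\<close>.\<close>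

lemma norm_linear_form_ge:
  assumes \<tau>: "Im \<tau> \<ge> \<epsilon>" "norm \<tau> \<le> A" "\<epsilon> > 0" and cd: "(c, d) \<noteq> (0::int, 0::int)"
  shows "norm (of_int c * \<tau> + of_int d) \<ge> \<epsilon> / (2 * (1 + \<epsilon> + A)) * (1 + real_of_int \<bar>c\<bar> + real_of_int \<bar>d\<bar>)"
proof -
  define N u v where "N = norm (of_int c * \<tau> + of_int d)" and "u = real_of_int \<bar>c\<bar>" and "v = real_of_int \<bar>d\<bar>"
  have "A \<ge> 0" using \<tau> norm_ge_zero[of \<tau>] by linarith
  have uv: "u \<ge> 0" "v \<ge> 0" "N \<ge> 0" by (auto simp: u_def v_def N_def)
  have "u + v \<ge> 1" using cd unfolding u_def v_def by (auto simp flip: of_int_add)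
  have "u * \<epsilon> \<le> u * \<bar>Im \<tau>\<bar>" using \<tau> uv by (intro mult_left_mono) auto
  also have "\<dots> = \<bar>Im (of_int c * \<tau> + of_int d)\<bar>" by (simp add: u_def abs_mult)
  also have "\<dots> \<le> N" unfolding N_def by (rule abs_Im_le_cmod)
  finally have 1: "u * \<epsilon> \<le> N" .
  have "v = norm ((of_int c * \<tau> + of_int d) - of_int c * \<tau>)" by (simp add: v_def)
  also have "\<dots> \<le> N + norm (of_int c * \<tau>)" unfolding N_def by (rule norm_triangle_ineq4)
  also have "norm (of_int c * \<tau>) \<le> u * A" using \<tau> uv by (auto simp: norm_mult u_def intro!: mult_left_mono)
  finally have "v \<le> N + u * A" by simp
  hence "\<epsilon> * v \<le> \<epsilon> * (N + u * A)" using \<tau> by simp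
  also have "\<dots> = \<epsilon> * N + (u * \<epsilon>) * A" by (simp add: algebra_simps)
  also have "\<dots> \<le> \<epsilon> * N + N * A" using 1 \<open>A \<ge> 0\<close> by (intro add_left_mono mult_right_mono) auto
  finally have "\<epsilon> * (u + v) \<le> (1 + \<epsilon> + A) * N" using 1 by (simp add: algebra_simps)
  moreover have "\<epsilon> * (1 + u + v) \<le> 2 * (\<epsilon> * (u + v))" using mult_left_mono[OF \<open>u + v \<ge> 1\<close>, of \<epsilon>] \<tau> by (simp add: algebra_simps)
  ultimately have "\<epsilon> * (1 + u + v) \<le> 2 * (1 + \<epsilon> + A) * N" by linarith
  thus ?thesis using \<tau> \<open>A \<ge> 0\<close> unfolding N_def[symmetric] u_def[symmetric] v_def[symmetric]
    by (simp add: field_simps)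
qed

lemma norm_linear_form_powr_le:
  assumes \<tau>: "Im \<tau> \<ge> \<epsilon>" "norm \<tau> \<le> A" "\<epsilon> > 0" and cd: "(c, d) \<noteq> (0::int, 0::int)" and s: "s \<ge> 0"
  shows "norm (of_int c * \<tau> + of_int d) powr - s \<le>
    (\<epsilon> / (2 * (1 + \<epsilon> + A))) powr - s * (1 + real_of_int \<bar>c\<bar> + real_of_int \<bar>d\<bar>) powr - s"
proof -
  have "A \<ge> 0" using \<tau> norm_ge_zero[of \<tau>] by linarith
  have "norm (of_int c * \<tau> + of_int d) powr - s \<le> (\<epsilon> / (2 * (1 + \<epsilon> + A)) * (1 + real_of_int \<bar>c\<bar> + real_of_int \<bar>d\<bar>)) powr - s"
    by (rule powr_mono2'[OF _ _ norm_linear_form_ge[OF \<tau> cd]]) (use s \<tau> \<open>A \<ge> 0\<close> in auto)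
  also have "\<dots> = (\<epsilon> / (2 * (1 + \<epsilon> + A))) powr - s * (1 + real_of_int \<bar>c\<bar> + real_of_int \<bar>d\<bar>) powr - s"
    by (rule powr_mult)
  finally show ?thesis .
qed

lemma summable_on_norm_linear_form:
  assumes "Im \<tau> > 0" "s > 2" "A \<subseteq> - {(0,0)}"
  shows "(\<lambda>(c, d). norm (of_int c * \<tau> + of_int d) powr - s) summable_on A"
proof (rule summable_on_comparison_test)
  let ?C = "(Im \<tau> / (2 * (1 + Im \<tau> + norm \<tau>))) powr - s"
  show "(\<lambda>p. ?C * (\<lambda>(c, d). (1 + real_of_int \<bar>c\<bar> + real_of_int \<bar>d\<bar>) powr - s) p) summable_on A"
    by (intro summable_on_cmult_right summable_on_subset[OF summable_on_lattice_powr[OF assms(2)]]) auto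
  fix p assume "p \<in> A"
  with assms have "p \<noteq> (0, 0)" by auto
  thus "(case p of (c, d) \<Rightarrow> norm (of_int c * \<tau> + of_int d) powr - s) \<le> ?C * (\<lambda>(c, d). (1 + real_of_int \<bar>c\<bar> + real_of_int \<bar>d\<bar>) powr - s) p"
    using assms norm_linear_form_powr_le[of "Im \<tau>" \<tau> "norm \<tau>" "fst p" "snd p" s] by (auto simp: case_prod_unfold prod_eq_iff)
qed auto

section \<open>Integrals along vertical lines\<close>

lemma integrable_inverse_1_plus_square: "integrable lborel (\<lambda>x::real. 1 / (1 + x^2))"
proof -
  have pos: "integrable lborel (\<lambda>x::real. indicator {0..} x *\<^sub>R (1 / (1 + x^2)))"
  proof (rule integrableI_bounded)
    have "(\<integral>\<^sup>+ x. ennreal (1 / (1 + x^2)) * indicator {0..} x \<partial>lborel) = ennreal (pi/2 - arctan 0)"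
    proof (rule nn_integral_FTC_atLeast)
      show "(arctan \<longlongrightarrow> pi / 2) at_top" by (rule tendsto_arctan_at_top)
      show "DERIV arctan x :> 1 / (1 + x\<^sup>2)" for x
        using DERIV_arctan[of x] by (simp add: field_simps)
    qed auto
    also have "(\<integral>\<^sup>+ x. ennreal (1 / (1 + x^2)) * indicator {0..} x \<partial>lborel) =
               (\<integral>\<^sup>+ x. ennreal (norm (indicator {0..} x *\<^sub>R (1 / (1 + x^2)) :: real)) \<partial>lborel)"
      by (intro nn_integral_cong) (auto simp: indicator_def)
    finally show "(\<integral>\<^sup>+ x. ennreal (norm (indicator {0..} x *\<^sub>R (1 / (1 + x^2)) :: real)) \<partial>lborel) < \<infinity>" by simp
  qed auto
  from lborel_integrable_real_affine[OF this, of "-1" 0]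
  have neg: "integrable lborel (\<lambda>x::real. indicator {0..} (- x) *\<^sub>R (1 / (1 + x^2)))" by simp
  show ?thesis
    by (rule Bochner_Integration.integrable_bound[OF Bochner_Integration.integrable_add[OF pos neg]])
       (auto simp: indicator_def)
qed

lemma integrable_of_quadratic_decay:
  fixes g :: "real \<Rightarrow> complex"
  assumes "continuous_on UNIV g" "\<And>x. norm (g x) \<le> C / (1 + x^2)"
  shows "integrable lborel g"
proof (rule Bochner_Integration.integrable_bound)
  show "integrable lborel (\<lambda>x::real. C * (1 / (1 + x^2)))"
    by (intro integrable_mult_right integrable_inverse_1_plus_square)
  show "g \<in> borel_measurable lborel" using borel_measurable_continuous_onI[OF assms(1)] by simp
  show "AE x in lborel. norm (g x) \<le> norm (C * (1 / (1 + x^2)))"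
  proof (rule AE_I2)
    fix x
    have "norm (g x) \<le> C * (1 / (1 + x^2))" using assms(2)[of x] by simp
    also have "\<dots> \<le> norm (C * (1 / (1 + x^2)))" unfolding real_norm_def by (rule abs_ge_self)
    finally show "norm (g x) \<le> norm (C * (1 / (1 + x^2)))" .
  qed
qed

lemma tendsto_integral_symmetric_intervals:
  fixes g :: "real \<Rightarrow> complex"
  assumes g: "integrable lborel g"
  shows "(\<lambda>n. integral {- real n..real n} g) \<longlonglongrightarrow> (LINT x|lborel. g x)"
proof -
  have "(\<lambda>n. LINT x:{- real n..real n}|lborel. g x) \<longlonglongrightarrow> (LINT x:(\<Union>n. {- real n..real n})|lborel. g x)"
  proof (rule set_integral_cont_up)
    show "set_integrable lborel (\<Union>n. {- real n..real n}) g"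
      unfolding set_integrable_def using g by (intro integrable_mult_indicator) auto
  qed (auto simp: incseq_def)
  also have "(\<Union>n. {- real n..real n}) = UNIV"
  proof (intro equalityI subsetI)
    fix x :: real
    obtain n where "\<bar>x\<bar> \<le> real n" using real_arch_simple by blast
    thus "x \<in> (\<Union>n. {- real n..real n})" by (auto intro!: exI[of _ n])
  qed auto
  also have "(LINT x:UNIV|lborel. g x) = (LINT x|lborel. g x)" by (simp add: set_lebesgue_integral_def)
  also have "(\<lambda>n. LINT x:{- real n..real n}|lborel. g x) = (\<lambda>n. integral {- real n..real n} g)"
    by (intro ext set_borel_integral_eq_integral)
       (auto simp: set_integrable_def intro!: integrable_mult_indicator g)
  finally show ?thesis .
qed

text \<open>A primitive on a convex region turns Cauchy's theorem for long rectangles into an estimate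
  for the increment of the primitive along the two short sides.\<close>

lemma line_integral_shift:
  fixes g :: "complex \<Rightarrow> complex"
  assumes S: "convex S" "open S" "g holomorphic_on S"
    and strip: "\<And>z. Re z \<in> {a..b} \<Longrightarrow> z \<in> S" and ab: "a \<le> b"
    and bound: "\<And>z. Re z \<in> {a..b} \<Longrightarrow> norm (g z) \<le> C / (1 + (Im z)^2)"
  shows "(LINT x|lborel. g (Complex a x)) = (LINT x|lborel. g (Complex b x))"
proof -
  obtain F where F: "\<And>z. z \<in> S \<Longrightarrow> (F has_field_derivative g z) (at z within S)"
    using holomorphic_convex_primitive'[OF S] by blast
  hence F: "(F has_field_derivative g z) (at z)" if "z \<in> S" for z
    using that S at_within_open by metis
  have int: "integrable lborel (\<lambda>x. g (Complex c x))" if "c \<in> {a..b}" for c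
  proof (rule integrable_of_quadratic_decay)
    show "continuous_on UNIV (\<lambda>x. g (Complex c x))" using that
      by (intro continuous_on_compose2[OF holomorphic_on_imp_continuous_on[OF S(3)]] )
         (auto simp: Complex_eq intro!: continuous_intros strip)
    show "norm (g (Complex c x)) \<le> C / (1 + x^2)" for x using bound[of "Complex c x"] that by simp
  qed
  have prim: "integral {- real n..real n} (\<lambda>x. g (Complex c x)) = - \<i> * (F (Complex c (real n)) - F (Complex c (- real n)))"
    if "c \<in> {a..b}" for c n
  proof (rule integral_unique)
    have "((\<lambda>x. g (Complex c x)) has_integral (- \<i> * F (Complex c (real n)) - (- \<i> * F (Complex c (- real n))))) {- real n..real n}"
    proof (rule fundamental_theorem_of_calculus)
      fix x assume "x \<in> {- real n..real n}"
      have "((\<lambda>x. Complex c x) has_vector_derivative \<i>) (at x within {- real n..real n})"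
        unfolding Complex_eq by (auto intro!: derivative_eq_intros)
      moreover have "(F has_field_derivative g (Complex c x)) (at (Complex c x))"
        using that by (intro F strip) auto
      ultimately have "((F \<circ> (\<lambda>x. Complex c x)) has_vector_derivative \<i> * g (Complex c x)) (at x within {- real n..real n})"
        by (rule field_vector_diff_chain_within[OF _ has_field_derivative_at_within])
      hence "((\<lambda>x. - \<i> * F (Complex c x)) has_vector_derivative (- \<i> * (\<i> * g (Complex c x)))) (at x within {- real n..real n})"
        unfolding o_def by (rule has_vector_derivative_mult_right)
      thus "((\<lambda>x. - \<i> * F (Complex c x)) has_vector_derivative (g (Complex c x))) (at x within {- real n..real n})"
        by simp
    qed simp
    thus "((\<lambda>x. g (Complex c x)) has_integral - \<i> * (F (Complex c (real n)) - F (Complex c (- real n)))) {- real n..real n}"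
      by (simp add: algebra_simps)
  qed
  have side: "norm (F (Complex b t) - F (Complex a t)) \<le> C / (1 + t^2) * (b - a)" for t
  proof -
    have "norm (F (Complex b t) - F (Complex a t)) \<le> C / (1 + t^2) * norm (Complex b t - Complex a t)"
    proof (rule field_differentiable_bound[where S = "closed_segment (Complex a t) (Complex b t)"])
      fix z assume "z \<in> closed_segment (Complex a t) (Complex b t)"
      hence z: "Re z \<in> {a..b}" "Im z = t" using ab
        by (auto simp: closed_segment_same_Im closed_segment_eq_real_ivl)
      show "norm (g z) \<le> C / (1 + t^2)" using bound[OF z(1)] z by simp
      show "(F has_field_derivative g z) (at z within closed_segment (Complex a t) (Complex b t))"
        using F[OF strip[OF z(1)]] by (rule has_field_derivative_at_within)
    qed auto
    also have "Complex b t - Complex a t = of_real (b - a)" by (simp add: complex_eq_iff)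
    also have "norm (of_real (b - a) :: complex) = b - a" using ab by (subst norm_of_real) auto
    finally show ?thesis .
  qed
  have "(\<lambda>n. 1 / (1 + (real n)^2)) \<longlonglongrightarrow> 0" by real_asymp
  hence lim0: "(\<lambda>n. C / (1 + (real n)^2) * (b - a)) \<longlonglongrightarrow> 0"
    using tendsto_mult_right_zero[of _ sequentially "C * (b - a)"] by (force simp: mult_ac)
  have "(\<lambda>n. F (Complex b (real n)) - F (Complex a (real n))) \<longlonglongrightarrow> 0"
    by (rule Lim_null_comparison[OF _ lim0]) (intro always_eventually allI side)
  moreover have "(\<lambda>n. F (Complex b (- real n)) - F (Complex a (- real n))) \<longlonglongrightarrow> 0"
    by (rule Lim_null_comparison[OF _ lim0]) (intro always_eventually allI order_trans[OF side], simp)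
  ultimately have "(\<lambda>n. - \<i> * ((F (Complex b (real n)) - F (Complex a (real n))) - (F (Complex b (- real n)) - F (Complex a (- real n))))) \<longlonglongrightarrow> - \<i> * (0 - 0)"
    by (intro tendsto_intros)
  moreover have "(\<lambda>n. integral {- real n..real n} (\<lambda>x. g (Complex b x)) - integral {- real n..real n} (\<lambda>x. g (Complex a x)))
      \<longlonglongrightarrow> (LINT x|lborel. g (Complex b x)) - (LINT x|lborel. g (Complex a x))"
    using ab by (intro tendsto_diff tendsto_integral_symmetric_intervals int) auto
  ultimately have "(LINT x|lborel. g (Complex b x)) - (LINT x|lborel. g (Complex a x)) = - \<i> * (0 - 0)"
    using ab by (intro LIMSEQ_unique) (auto simp: prim algebra_simps)
  thus ?thesis by simp
qed

lemma norm_powr_of_real: "z \<noteq> 0 \<Longrightarrow> norm (z powr of_real t :: complex) = norm z powr t"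
  by (simp add: powr_def)

lemma of_real_mult_powr: "r > 0 \<Longrightarrow> z \<noteq> 0 \<Longrightarrow> (of_real r * z) powr t = of_real r powr t * (z powr t :: complex)"
  using Ln_times_of_real[of r z] by (simp add: powr_def exp_add ring_distribs Ln_of_real)

text \<open>Of the exponent \<open>s\<close>, two units give the quadratic decay and the remaining \<open>s - 2\<close> are bounded on the
  half-plane.\<close>

lemma norm_powr_quadratic_decay:
  assumes "Re w \<ge> a" "a > 0" "s \<ge> 2"
  shows "norm (w powr - of_real s) \<le> (a powr (2 - s) * (1 + 1 / a^2)) / (1 + (Im w)^2)"
proof -
  have wa: "norm w \<ge> a" using abs_Re_le_cmod[of w] assms by linarith
  have "w \<noteq> 0" using assms by auto
  have "1 + (Im w)^2 \<le> (1 + 1 / a^2) * norm w ^ 2"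
  proof -
    have "a^2 \<le> (Re w)^2" using assms by (intro power_mono) auto
    hence "1 + (Im w)^2 \<le> (1 + 1 / a^2) * (a^2 + (Im w)^2)"
      using assms by (simp add: field_simps)
    also have "\<dots> \<le> (1 + 1 / a^2) * norm w ^ 2"
      using \<open>a^2 \<le> (Re w)^2\<close> unfolding cmod_power2 by (intro mult_left_mono) auto
    finally show ?thesis .
  qed
  hence *: "1 / norm w ^ 2 \<le> (1 + 1 / a^2) / (1 + (Im w)^2)"
    using \<open>w \<noteq> 0\<close> by (simp add: divide_le_eq le_divide_eq add_pos_nonneg mult.commute)
  have wps: "norm w powr (2 - s) \<le> a powr (2 - s)" using assms wa by (intro powr_mono2') auto
  have "norm (w powr - of_real s) = norm w powr (2 - s) * norm w powr -2"
    using \<open>w \<noteq> 0\<close> norm_powr_of_real[of w "-s"] by (simp flip: powr_add)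
  also have "norm w powr -2 = 1 / norm w ^ 2" using \<open>w \<noteq> 0\<close> by (simp add: powr_minus_divide powr_numeral)
  also have "norm w powr (2 - s) * (1 / norm w ^ 2) \<le> a powr (2 - s) * ((1 + 1 / a^2) / (1 + (Im w)^2))"
    by (rule mult_mono[OF wps *]) auto
  finally show ?thesis by simp
qed

lemma continuous_on_vertical_line:
  assumes "a > 0"
  shows "continuous_on UNIV (\<lambda>x. Complex a x powr t)"
  using assms by (auto simp: Complex_eq complex_nonpos_Reals_iff complex_eq_iff intro!: continuous_intros)

lemma integrable_vertical_line_powr:
  assumes "a > 0" "s \<ge> 2"
  shows "integrable lborel (\<lambda>x. Complex a x powr - of_real s)"
proof (rule integrable_of_quadratic_decay)
  show "norm (Complex a x powr - of_real s) \<le> (a powr (2 - s) * (1 + 1 / a^2)) / (1 + x^2)" for x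
    using norm_powr_quadratic_decay[of a "Complex a x" s] assms by simp
qed (rule continuous_on_vertical_line[OF assms(1)])

lemma laplace_kernel_shift:
  assumes ab: "0 < a" "a \<le> b" and s: "s \<ge> 2" and v: "v > 0"
  shows "(LINT x|lborel. Complex a x powr - of_real s * exp (of_real v * Complex a x)) =
         (LINT x|lborel. Complex b x powr - of_real s * exp (of_real v * Complex b x))"
proof (rule line_integral_shift[where S = "{z. Re z > 0}" and g = "\<lambda>w. w powr - of_real s * exp (of_real v * w)"
          and C = "(a powr (2 - s) * (1 + 1 / a^2)) * exp (v * b)"])
  show "(\<lambda>w. w powr - of_real s * exp (of_real v * w)) holomorphic_on {z. Re z > 0}"
    by (intro holomorphic_intros) (auto simp: complex_nonpos_Reals_iff)
  fix z assume z: "Re z \<in> {a..b}"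
  have "norm (z powr - of_real s * exp (of_real v * z)) \<le> (a powr (2 - s) * (1 + 1 / a^2)) / (1 + (Im z)^2) * exp (v * b)"
    unfolding norm_mult using z ab v s
    by (intro mult_mono norm_powr_quadratic_decay) auto
  thus "norm (z powr - of_real s * exp (of_real v * z)) \<le> (a powr (2 - s) * (1 + 1 / a^2)) * exp (v * b) / (1 + (Im z)^2)"
    by simp
qed (use ab in \<open>auto simp: convex_halfspace_Re_gt open_halfspace_Re_gt\<close>)

text \<open>The substitution \<open>w \<mapsto> w / v\<close> moves the line of integration, and the shift moves it back.\<close>

lemma laplace_kernel_scaling:
  assumes "0 < a" "s \<ge> 2" "v > 0"
  shows "(LINT x|lborel. Complex a x powr - of_real s * exp (of_real v * Complex a x)) =
         of_real (v powr (s - 1)) * (LINT x|lborel. Complex 1 x powr - of_real s * exp (Complex 1 x))"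
proof -
  define h where "h = (\<lambda>v a. LINT x|lborel. Complex a x powr - of_real s * exp (of_real v * Complex a x))"
  have "h v a = h v (1/v)"
  proof (cases "a \<le> 1/v")
    case True
    thus ?thesis unfolding h_def using assms by (intro laplace_kernel_shift) auto
  next
    case False
    thus ?thesis unfolding h_def using assms by (intro laplace_kernel_shift[symmetric]) auto
  qed
  also have "h v (1/v) = \<bar>1/v\<bar> *\<^sub>R (LINT x|lborel. Complex (1/v) (0 + 1/v * x) powr - of_real s * exp (of_real v * Complex (1/v) (0 + 1/v * x)))"
    unfolding h_def using assms by (intro lborel_integral_real_affine) auto
  also have "(\<lambda>x. Complex (1/v) (0 + 1/v * x) powr - of_real s * exp (of_real v * Complex (1/v) (0 + 1/v * x))) =
             (\<lambda>x. of_real (v powr s) * (Complex 1 x powr - of_real s * exp (Complex 1 x)))"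
  proof
    fix x
    have 1: "Complex (1/v) (0 + 1/v * x) = of_real (1/v) * Complex 1 x"
      by (simp add: complex_eq_iff)
    have 2: "of_real v * (of_real (1/v) * Complex 1 x) = Complex 1 x" using assms by simp
    have "(of_real (1/v) * Complex 1 x) powr - of_real s = of_real (1/v) powr - of_real s * Complex 1 x powr - of_real s"
      using assms by (intro of_real_mult_powr) (auto simp: complex_eq_iff)
    also have "of_real (1/v) powr - of_real s = (of_real (v powr s) :: complex)"
      using assms powr_of_real[of "1/v" "-s"] by (simp add: powr_divide powr_minus field_simps)
    finally show "Complex (1/v) (0 + 1/v * x) powr - of_real s * exp (of_real v * Complex (1/v) (0 + 1/v * x)) =
         of_real (v powr s) * (Complex 1 x powr - of_real s * exp (Complex 1 x))"
      unfolding 1 2 by simp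
  qed
  also have "\<bar>1/v\<bar> *\<^sub>R (LINT x|lborel. of_real (v powr s) * (Complex 1 x powr - of_real s * exp (Complex 1 x))) =
     of_real (v powr (s - 1)) * (LINT x|lborel. Complex 1 x powr - of_real s * exp (Complex 1 x))"
    using assms by (simp add: scaleR_conv_of_real powr_diff field_simps)
  finally show ?thesis unfolding h_def .
qed

text \<open>Cauchy's formula at \<open>w = 1\<close> for rectangles that grow to the right; only the left side of the
  rectangle contributes in the limit.\<close>

lemma cauchy_vertical_line:
  assumes s: "s \<ge> 2"
  shows "(LINT x|lborel. Complex (1/2) x powr - of_real s / (1 - Complex (1/2) x)) = 2 * of_real pi"
proof -
  define g where "g = (\<lambda>w::complex. w powr - of_real s / (w - 1))"
  have cont: "continuous_on ({z. Re z > 0} - {1}) g"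
    unfolding g_def by (auto simp: complex_nonpos_Reals_iff intro!: continuous_intros)
  have int: "integrable lborel (\<lambda>x. g (Complex (1/2) x))"
  proof (rule integrable_of_quadratic_decay)
    show "continuous_on UNIV (\<lambda>x. g (Complex (1/2) x))"
      by (rule continuous_on_compose2[OF cont]) (auto simp: Complex_eq complex_eq_iff intro!: continuous_intros)
    fix x
    have "norm (Complex (1/2) x - 1) \<ge> 1/2" using abs_Re_le_cmod[of "Complex (1/2) x - 1"] by simp
    hence "norm (g (Complex (1/2) x)) \<le> ((1/2) powr (2 - s) * (1 + 1 / (1/2)^2)) / (1 + x^2) / (1/2)"
      unfolding g_def norm_divide using norm_powr_quadratic_decay[of "1/2" "Complex (1/2) x" s] s
      by (intro frac_le) auto
    thus "norm (g (Complex (1/2) x)) \<le> ((1/2) powr (2 - s) * (1 + 1 / (1/2)^2) * 2) / (1 + x^2)" by simp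
  qed
  have bound: "norm (\<i> * integral {- T..T} (\<lambda>x. g (Complex (1/2) x)) + 2 * pi * \<i>) \<le> T powr - (s + 1) * (6 * T)" if T: "T \<ge> 1" for T
  proof -
    define a1 a2 a3 a4 where "a1 = Complex (1/2) (-T)" and "a2 = Complex (1 + T) (-T)"
       and "a3 = Complex (1 + T) T" and "a4 = Complex (1/2) T"
    have rect: "rectpath a1 a3 = linepath a1 a2 +++ linepath a2 a3 +++ linepath a3 a4 +++ linepath a4 a1"
      by (simp add: rectpath_def Let_def a1_def a2_def a3_def a4_def)
    have box: "1 \<in> box a1 a3" using T by (auto simp: in_box_complex_iff a1_def a3_def)
    have "((\<lambda>w. w powr - of_real s / (w - 1)) has_contour_integral (2*pi * \<i> * winding_number (rectpath a1 a3) 1 * 1 powr - of_real s)) (rectpath a1 a3)"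
    proof (rule Cauchy_integral_formula_convex_simple[where S = "{z. Re z > 0}"])
      show "(\<lambda>w. w powr - of_real s) holomorphic_on {z. 0 < Re z}"
        by (intro holomorphic_intros) (auto simp: complex_nonpos_Reals_iff)
      show "1 \<in> interior {z. 0 < Re z}" by (subst interior_open) (auto simp: open_halfspace_Re_gt)
      have "path_image (rectpath a1 a3) \<subseteq> cbox a1 a3 - {1}"
        using path_image_rectpath_cbox_minus_box[of a1 a3] box T by (auto simp: a1_def a3_def)
      also have "\<dots> \<subseteq> {z. 0 < Re z} - {1}" by (auto simp: in_cbox_complex_iff a1_def a3_def)
      finally show "path_image (rectpath a1 a3) \<subseteq> {z. 0 < Re z} - {1}" .
    qed (auto simp: convex_halfspace_Re_gt)
    moreover have "winding_number (rectpath a1 a3) 1 = 1"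
      by (rule winding_number_rectpath) fact
    ultimately have "contour_integral (rectpath a1 a3) g = 2 * pi * \<i>"
      unfolding g_def by (intro contour_integral_unique) (simp add: mult_ac)
    moreover have seg: "g contour_integrable_on linepath a b" if "closed_segment a b \<subseteq> {z. Re z > 0} - {1}" for a b
      by (rule contour_integrable_continuous_linepath) (rule continuous_on_subset[OF cont that])
    have segs: "closed_segment a1 a2 = {z. Im z = -T \<and> Re z \<in> {1/2..1+T}}"
         "closed_segment a2 a3 = {z. Re z = 1+T \<and> Im z \<in> {-T..T}}"
         "closed_segment a3 a4 = {z. Im z = T \<and> Re z \<in> {1/2..1+T}}"
         "closed_segment a4 a1 = {z. Re z = 1/2 \<and> Im z \<in> {-T..T}}"
      using T by (auto simp: a1_def a2_def a3_def a4_def closed_segment_same_Im closed_segment_same_Re closed_segment_eq_real_ivl)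
    have int4: "g contour_integrable_on linepath a1 a2" "g contour_integrable_on linepath a2 a3"
         "g contour_integrable_on linepath a3 a4" "g contour_integrable_on linepath a4 a1"
      by (rule seg; use T in \<open>auto simp: segs\<close>)+
    ultimately have sum: "contour_integral (linepath a1 a2) g + (contour_integral (linepath a2 a3) g
       + (contour_integral (linepath a3 a4) g + contour_integral (linepath a4 a1) g)) = 2 * pi * \<i>"
      unfolding rect using int4 by (simp add: contour_integrable_join valid_path_join)
    \<comment> \<open>On the three far sides both \<open>w\<close> and \<open>w - 1\<close> have norm at least \<open>T\<close>.\<close>
    have far: "norm (g z) \<le> T powr - (s + 1)" if "norm z \<ge> T" "norm (z - 1) \<ge> T" for z
    proof -
      have "z \<noteq> 0" using T that by auto
      have "norm (g z) = norm z powr - s / norm (z - 1)"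
        using \<open>z \<noteq> 0\<close> norm_powr_of_real[of z "-s"] by (simp add: g_def norm_divide)
      also have "\<dots> \<le> T powr - s / T" using that T s by (intro frac_le powr_mono2') auto
      also have "\<dots> = T powr - (s + 1)" using T by (simp add: powr_diff)
      finally show ?thesis .
    qed
    have farIm: "norm (g z) \<le> T powr - (s + 1)" if "\<bar>Im z\<bar> \<ge> T" for z
      by (rule far) (use that abs_Im_le_cmod[of z] abs_Im_le_cmod[of "z - 1"] in auto)
    have farRe: "norm (g z) \<le> T powr - (s + 1)" if "Re z \<ge> 1 + T" for z
      by (rule far) (use that abs_Re_le_cmod[of z] abs_Re_le_cmod[of "z - 1"] in auto)
    have b12: "norm (contour_integral (linepath a1 a2) g) \<le> T powr - (s + 1) * norm (a2 - a1)"
    proof (rule contour_integral_bound_linepath[OF int4(1)])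
      fix x assume "x \<in> closed_segment a1 a2"
      thus "norm (g x) \<le> T powr - (s + 1)" using T by (intro farIm) (auto simp: segs)
    qed simp
    have b23: "norm (contour_integral (linepath a2 a3) g) \<le> T powr - (s + 1) * norm (a3 - a2)"
    proof (rule contour_integral_bound_linepath[OF int4(2)])
      fix x assume "x \<in> closed_segment a2 a3"
      thus "norm (g x) \<le> T powr - (s + 1)" using T by (intro farRe) (auto simp: segs)
    qed simp
    have b34: "norm (contour_integral (linepath a3 a4) g) \<le> T powr - (s + 1) * norm (a4 - a3)"
    proof (rule contour_integral_bound_linepath[OF int4(3)])
      fix x assume "x \<in> closed_segment a3 a4"
      thus "norm (g x) \<le> T powr - (s + 1)" using T by (intro farIm) (auto simp: segs)
    qed simp
    have "a2 - a1 = of_real (T + 1/2)" "a3 - a2 = \<i> * of_real (2 * T)" "a4 - a3 = - of_real (T + 1/2)"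
      by (simp_all add: complex_eq_iff a1_def a2_def a3_def a4_def)
    hence len: "norm (a2 - a1) = T + 1/2" "norm (a3 - a2) = 2 * T" "norm (a4 - a3) = T + 1/2"
      using T by (simp_all only: norm_of_real norm_mult norm_ii norm_minus_cancel)
    have "contour_integral (linepath a4 a1) g = - contour_integral (linepath a1 a4) g"
      using contour_integral_reversepath[of "linepath a1 a4" g] by simp
    also have "contour_integral (linepath a1 a4) g = \<i> * integral {-T..T} (\<lambda>x. g (Complex (1/2) x))"
      using T by (intro contour_integral_linepath_same_Re) (auto simp: a1_def a4_def)
    finally have "\<i> * integral {- T..T} (\<lambda>x. g (Complex (1/2) x)) + 2 * pi * \<i> =
       contour_integral (linepath a1 a2) g + contour_integral (linepath a2 a3) g + contour_integral (linepath a3 a4) g"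
      using sum by (simp add: algebra_simps)
    also have "norm \<dots> \<le> T powr - (s + 1) * (T + 1/2) + T powr - (s + 1) * (2 * T) + T powr - (s + 1) * (T + 1/2)"
      using b12 b23 b34 unfolding len by (intro norm_triangle_le add_mono) auto
    also have "\<dots> = T powr - (s + 1) * (4 * T + 1)" by (simp add: algebra_simps)
    also have "\<dots> \<le> T powr - (s + 1) * (6 * T)" using T by (intro mult_left_mono) auto
    finally show ?thesis .
  qed
  have lim0: "(\<lambda>n. real n powr - (s + 1) * (6 * real n)) \<longlonglongrightarrow> 0"
    using s by real_asymp
  have "(\<lambda>n. \<i> * integral {- real n..real n} (\<lambda>x. g (Complex (1/2) x)) + 2 * pi * \<i>) \<longlonglongrightarrow> 0"
    by (rule Lim_null_comparison[OF _ lim0]) (use bound in \<open>auto simp: eventually_at_top_linorder intro!: exI[of _ 1]\<close>)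
  moreover have "(\<lambda>n. \<i> * integral {- real n..real n} (\<lambda>x. g (Complex (1/2) x)) + 2 * pi * \<i>)
        \<longlonglongrightarrow> \<i> * (LINT x|lborel. g (Complex (1/2) x)) + 2 * pi * \<i>"
    by (intro tendsto_intros tendsto_integral_symmetric_intervals int)
  ultimately have "\<i> * (LINT x|lborel. g (Complex (1/2) x)) + 2 * pi * \<i> = 0"
    by (intro LIMSEQ_unique)
  hence "\<i> * ((LINT x|lborel. g (Complex (1/2) x)) + 2 * pi) = 0" by (simp add: algebra_simps)
  hence "(LINT x|lborel. g (Complex (1/2) x)) = - 2 * pi" by (simp add: add_eq_0_iff)
  moreover have "(\<lambda>x. Complex (1/2) x powr - of_real s / (1 - Complex (1/2) x)) = (\<lambda>x. - g (Complex (1/2) x))"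
    unfolding g_def by (intro ext) (metis minus_diff_eq minus_divide_right)
  ultimately show ?thesis by simp
qed

lemma has_bochner_integral_exp_decay:
  assumes "c > 0"
  shows "integrable lborel (\<lambda>v::real. indicator {0<..} v * exp (- (c * v)))"
proof (rule integrableI_bounded)
  have "(\<integral>\<^sup>+ v. ennreal (exp (- (c * v))) * indicator {0..} v \<partial>lborel) = ennreal (0 - (- exp (- (c * 0)) / c))"
  proof (rule nn_integral_FTC_atLeast)
    show "((\<lambda>v. - exp (- (c * v)) / c) \<longlongrightarrow> 0) at_top" using assms by real_asymp
    show "DERIV (\<lambda>v. - exp (- (c * v)) / c) x :> exp (- (c * x))" for x
      using assms by (auto intro!: derivative_eq_intros)
  qed auto
  also have "(\<integral>\<^sup>+ v. ennreal (exp (- (c * v))) * indicator {0..} v \<partial>lborel) \<ge>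
             (\<integral>\<^sup>+ v. ennreal (norm (indicator {0<..} v * exp (- (c * v)) :: real)) \<partial>lborel)"
    by (intro nn_integral_mono) (auto simp: indicator_def)
  ultimately show "(\<integral>\<^sup>+ v. ennreal (norm (indicator {0<..} v * exp (- (c * v)) :: real)) \<partial>lborel) < \<infinity>"
    by (auto intro: le_less_trans)
qed auto

lemma integral_exp_half_line:
  fixes z :: complex
  assumes "Re z < 0"
  shows "(LINT v|lborel. indicator {0<..} v *\<^sub>R exp (of_real v * z)) = - 1 / z"
proof -
  have "z \<noteq> 0" using assms by auto
  define g where "g = (\<lambda>v::real. indicator {0<..} v *\<^sub>R exp (of_real v * z))"
  have int: "integrable lborel g"
  proof (rule Bochner_Integration.integrable_bound[OF has_bochner_integral_exp_decay[of "- Re z"]])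
    have "(\<lambda>v::real. exp (of_real v * z)) \<in> borel_measurable borel"
      by (intro borel_measurable_continuous_onI continuous_intros)
    hence "g \<in> borel_measurable borel" unfolding g_def
      by (intro borel_measurable_scaleR) auto
    thus "g \<in> borel_measurable lborel" by simp
  qed (use assms in \<open>auto simp: g_def mult.commute\<close>)
  have "integral {- real n..real n} g = (exp (of_real (real n) * z) - 1) / z" for n
  proof (rule integral_unique)
    have "((\<lambda>v. exp (of_real v * z)) has_integral (exp (of_real (real n) * z) / z - exp (of_real 0 * z) / z)) {0..real n}"
      by (rule fundamental_theorem_of_calculus)
         (use \<open>z \<noteq> 0\<close> in \<open>auto intro!: derivative_eq_intros has_vector_derivative_real_field simp: field_simps\<close>)
    hence "((\<lambda>v. exp (of_real v * z)) has_integral ((exp (of_real (real n) * z) - 1) / z)) {0..real n}"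
      by (simp add: diff_divide_distrib)
    hence "((\<lambda>v. if v \<in> {0..real n} then exp (of_real v * z) else 0) has_integral ((exp (of_real (real n) * z) - 1) / z)) {- real n..real n}"
      by (subst has_integral_restrict) auto
    thus "(g has_integral ((exp (of_real (real n) * z) - 1) / z)) {- real n..real n}"
      by (rule has_integral_spike[of "{0}", rotated 2]) (auto simp: g_def indicator_def)
  qed
  hence "(\<lambda>n. (exp (of_real (real n) * z) - 1) / z) \<longlonglongrightarrow> (LINT v|lborel. g v)"
    using tendsto_integral_symmetric_intervals[OF int] by simp
  moreover have "(\<lambda>n. (exp (of_real (real n) * z) - 1) / z) \<longlonglongrightarrow> (0 - 1) / z"
  proof (intro tendsto_intros \<open>z \<noteq> 0\<close>)
    have "(\<lambda>n. exp (real n * Re z)) \<longlonglongrightarrow> 0" using assms by real_asymp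
    thus "(\<lambda>n. exp (of_real (real n) * z)) \<longlonglongrightarrow> 0"
      by (subst tendsto_norm_zero_iff[symmetric]) simp
  qed
  ultimately have "(LINT v|lborel. g v) = (0 - 1) / z" by (rule LIMSEQ_unique)
  thus ?thesis by (simp add: g_def)
qed

lemma lebesgue_integral_Gamma:
  fixes s :: real
  assumes "s > 0"
  shows "(LINT v|lborel. indicator {0<..} v * (v powr (s - 1) * exp (- v))) = Gamma s"
proof -
  define f where "f = (\<lambda>v::real. indicator {0<..} v * (v powr (s - 1) * exp (- v)))"
  have "((\<lambda>v. if v \<in> {0..} then v powr (s - 1) / exp v else 0) has_integral Gamma s) UNIV"
    using Gamma_integral_real[OF assms] by (subst has_integral_restrict_UNIV)
  also have "(\<lambda>v. if v \<in> {0..} then v powr (s - 1) / exp v else 0) = f"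
    by (auto simp: fun_eq_iff f_def indicator_def exp_minus field_simps)
  finally have "integral\<^sup>N lborel f = ennreal (Gamma s)"
    by (intro nn_integral_has_integral_lborel) (auto simp: f_def)
  hence "has_bochner_integral lborel f (Gamma s)"
    using assms by (intro has_bochner_integral_nn_integral) (auto simp: f_def Gamma_real_nonneg)
  thus ?thesis unfolding f_def by (rule has_bochner_integral_integral_eq)
qed

text \<open>Inversion of the Laplace transform of \<open>v powr (s - 1)\<close>. By shift and scaling the integral is a
  constant multiple of \<open>v powr (s - 1)\<close>; the constant comes out of taking the Laplace transform
  in \<open>v\<close> and interchanging the two integrations.\<close>

theorem bromwich_powr:
  assumes s: "s \<ge> 2" and a: "a > 0" and v: "v > 0"
  shows "(LINT x|lborel. Complex a x powr - of_real s * exp (of_real v * Complex a x)) =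
         of_real (2 * pi * v powr (s - 1) * rGamma s)"
proof -
  define H where "H = (LINT x|lborel. Complex 1 x powr - of_real s * exp (Complex 1 x))"
  define G where "G = (\<lambda>x. Complex (1/2) x powr - of_real s)"
  \<comment> \<open>The line \<open>Re w = 1/2\<close> lies to the left of one, which makes the kernel \<open>exp (v * (w - 1))\<close> of the
    Laplace transform at one integrable in \<open>v\<close>.\<close>
  define f where "f = (\<lambda>v x. indicator {0<..} v *\<^sub>R (exp (of_real v * (Complex (1/2) x - 1)) * G x))"
  have intG: "integrable lborel G" unfolding G_def using s by (intro integrable_vertical_line_powr) auto
  have contG: "continuous_on UNIV G" unfolding G_def by (rule continuous_on_vertical_line) simp
  have norm_f: "norm (f v x) = indicator {0<..} v * exp (- (1/2 * v)) * norm (G x)" for v x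
    by (auto simp: f_def indicator_def norm_mult)
  have slice: "(LINT x|lborel. f v x) = indicator {0<..} v *\<^sub>R (of_real (v powr (s - 1) * exp (- v)) * H)" for v
  proof (cases "v > 0")
    case True
    have "f v x = of_real (exp (- v)) * (Complex (1/2) x powr - of_real s * exp (of_real v * Complex (1/2) x))" for x
      using True by (simp add: f_def G_def exp_diff exp_minus right_diff_distrib exp_of_real field_simps)
    thus ?thesis using True s by (simp add: laplace_kernel_scaling H_def)
  qed (auto simp: f_def)
  have slice': "(LINT v|lborel. f v x) = G x / (1 - Complex (1/2) x)" for x
  proof -
    have "(LINT v|lborel. f v x) = (LINT v|lborel. (indicator {0<..} v *\<^sub>R exp (of_real v * (Complex (1/2) x - 1))) * G x)"
      by (simp add: f_def)
    also have "\<dots> = (- 1 / (Complex (1/2) x - 1)) * G x"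
      by (subst integral_mult_left_zero, subst integral_exp_half_line) auto
    also have "- 1 / (Complex (1/2) x - 1) = 1 / (1 - Complex (1/2) x)"
      by (metis minus_diff_eq minus_divide_divide minus_minus)
    finally show ?thesis by simp
  qed
  have meas: "case_prod f \<in> borel_measurable (lborel \<Otimes>\<^sub>M lborel)"
  proof -
    have "(\<lambda>p::real \<times> real. exp (of_real (fst p) * (Complex (1/2) (snd p) - 1)) * G (snd p)) \<in> borel_measurable borel"
      by (intro borel_measurable_continuous_onI continuous_intros continuous_on_compose2[OF contG])
         (auto simp: Complex_eq intro!: continuous_intros)
    moreover have "(\<lambda>p::real \<times> real. indicator {0<..} (fst p) :: real) \<in> borel_measurable borel"
      by (simp flip: borel_prod)
    ultimately have "(\<lambda>p::real \<times> real. indicator {0<..} (fst p) *\<^sub>R (exp (of_real (fst p) * (Complex (1/2) (snd p) - 1)) * G (snd p))) \<in> borel_measurable borel"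
      by (rule borel_measurable_scaleR[rotated])
    thus ?thesis by (simp add: f_def case_prod_unfold lborel_prod)
  qed
  have "integrable (lborel \<Otimes>\<^sub>M lborel) (case_prod f)"
  proof (rule lborel_pair.Fubini_integrable[OF meas])
    show "integrable lborel (\<lambda>v. LINT x|lborel. norm (case_prod f (v, x)))"
      using has_bochner_integral_exp_decay[of "1/2"] by (simp add: norm_f)
    show "AE v in lborel. integrable lborel (\<lambda>x. case_prod f (v, x))"
    proof (rule AE_I2)
      fix v
      have "integrable lborel (\<lambda>x. f v x)"
      proof (rule Bochner_Integration.integrable_bound[OF integrable_norm[OF intG]])
        have "(\<lambda>x. exp (of_real v * (Complex (1/2) x - 1)) * G x) \<in> borel_measurable borel"
          unfolding Complex_eq by (intro borel_measurable_continuous_onI continuous_intros contG)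
        hence "(\<lambda>x. f v x) \<in> borel_measurable borel" unfolding f_def
          by (intro borel_measurable_scaleR) auto
        thus "(\<lambda>x. f v x) \<in> borel_measurable lborel" by simp
        show "AE x in lborel. norm (f v x) \<le> norm (norm (G x))"
          by (auto simp: norm_f indicator_def intro!: AE_I2 mult_left_le_one_le)
      qed
      thus "integrable lborel (\<lambda>x. case_prod f (v, x))" by simp
    qed
  qed
  from lborel_pair.Fubini_integral[OF this]
  have "(LINT x|lborel. G x / (1 - Complex (1/2) x)) = (LINT v|lborel. indicator {0<..} v *\<^sub>R (of_real (v powr (s - 1) * exp (- v)) * H))"
    by (simp only: slice slice')
  also have "\<dots> = (LINT v|lborel. of_real (indicator {0<..} v * (v powr (s - 1) * exp (- v))) * H)"
    by (simp add: scaleR_conv_of_real mult_ac)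
  also have "\<dots> = of_real (LINT v|lborel. indicator {0<..} v * (v powr (s - 1) * exp (- v))) * H"
    by (simp only: integral_mult_left_zero integral_complex_of_real)
  also have "\<dots> = of_real (Gamma s) * H" using s by (subst lebesgue_integral_Gamma) auto
  finally have "of_real (Gamma s) * H = 2 * of_real pi"
    using cauchy_vertical_line[OF s] by (simp add: G_def)
  moreover have "Gamma s > 0" using s by (intro Gamma_real_pos) auto
  ultimately have "H = of_real (2 * pi * rGamma s)"
    by (simp add: rGamma_inverse_Gamma field_simps)
  thus ?thesis using laplace_kernel_scaling[OF a s v] by (simp add: H_def mult_ac)
qed

section \<open>Partial fractions and the weight two Eisenstein series\<close>

lemma has_sum_minus:
  fixes f g :: "'a \<Rightarrow> complex"
  assumes "(f has_sum a) A" "(g has_sum b) A"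
  shows "((\<lambda>x. f x - g x) has_sum (a - b)) A"
  using has_sum_add[OF assms(1) has_sum_uminusI[OF assms(2)]] by simp

lemma summable_on_minus:
  fixes f g :: "'a \<Rightarrow> complex"
  assumes "f summable_on A" "g summable_on A"
  shows "(\<lambda>x. f x - g x) summable_on A"
  using assms has_sum_minus unfolding summable_on_def by blast

lemma has_sum_int_imp_tendsto:
  fixes f :: "int \<Rightarrow> complex"
  assumes "(f has_sum S) UNIV"
  shows "(\<lambda>N. \<Sum>d\<in>{k - int N..<k + int N}. f d) \<longlonglongrightarrow> S"
proof -
  have "filterlim (\<lambda>N. {k - int N..<k + int N}) (finite_subsets_at_top UNIV) sequentially"
    unfolding filterlim_finite_subsets_at_top
  proof (intro allI impI)
    fix X :: "int set" assume X: "finite X \<and> X \<subseteq> UNIV"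
    hence "bdd_above ((\<lambda>x. nat \<bar>x - k\<bar>) ` X)" by auto
    then obtain M where M: "\<And>x. x \<in> X \<Longrightarrow> nat \<bar>x - k\<bar> \<le> M" by (auto simp: bdd_above_def)
    show "\<forall>\<^sub>F N in sequentially. finite {k - int N..<k + int N} \<and> X \<subseteq> {k - int N..<k + int N} \<and> {k - int N..<k + int N} \<subseteq> UNIV"
      unfolding eventually_at_top_linorder
    proof (intro exI[of _ "Suc M"] allI impI conjI subsetI)
      fix N x assume "Suc M \<le> N" "x \<in> X"
      thus "x \<in> {k - int N..<k + int N}" using M[of x] by auto
    qed auto
  qed
  with assms show ?thesis unfolding has_sum_def by (rule filterlim_compose)
qed

lemma has_sum_int_nonzeroI:
  fixes f :: "int \<Rightarrow> complex"
  assumes "f summable_on UNIV - {0}" "(\<lambda>n. f (int (Suc n))) sums P" "(\<lambda>n. f (- int (Suc n))) sums Q"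
  shows "(f has_sum (P + Q)) (UNIV - {0})"
proof -
  have 1: "(f has_sum P) {0<..}"
  proof -
    have "f summable_on {0<..}" by (rule summable_on_subset[OF assms(1)]) auto
    then obtain P' where P': "(f has_sum P') {0<..}" by (auto simp: summable_on_def)
    have "((\<lambda>n. f (int (Suc n))) has_sum P') UNIV"
      by (subst has_sum_reindex_bij_witness[where h = f and T = "{0<..}" and i = "\<lambda>d. nat (d - 1)" and j = "\<lambda>n. int (Suc n)"])
         (use P' in auto)
    hence "P' = P" by (rule sums_unique2[OF has_sum_imp_sums assms(2)])
    thus ?thesis using P' by simp
  qed
  have 2: "(f has_sum Q) {..<0}"
  proof -
    have "f summable_on {..<0}" by (rule summable_on_subset[OF assms(1)]) auto
    then obtain Q' where Q': "(f has_sum Q') {..<0}" by (auto simp: summable_on_def)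
    have "((\<lambda>n. f (- int (Suc n))) has_sum Q') UNIV"
      by (subst has_sum_reindex_bij_witness[where h = f and T = "{..<0}" and i = "\<lambda>d. nat (- d - 1)" and j = "\<lambda>n. - int (Suc n)"])
         (use Q' in auto)
    hence "Q' = Q" by (rule sums_unique2[OF has_sum_imp_sums assms(3)])
    thus ?thesis using Q' by simp
  qed
  have "(f has_sum (P + Q)) ({0<..} \<union> {..<0})" by (rule has_sum_Un_disjoint[OF 1 2]) auto
  also have "{0<..} \<union> {..<0} = UNIV - {0::int}" by auto
  finally show ?thesis .
qed

text \<open>The logarithmic derivative of the reflection formula of the Gamma function.\<close>

lemma Digamma_reflection:
  fixes z :: complex
  assumes "z \<notin> \<int>"
  shows "Digamma (1 - z) - Digamma z = of_real pi * cot (of_real pi * z)"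
proof -
  have nz: "z \<notin> \<int>\<^sub>\<le>\<^sub>0" using assms nonpos_Ints_Int by auto
  have "1 - z \<notin> \<int>" using assms by (metis Ints_1 Ints_diff diff_diff_eq2 add_diff_cancel_left' add.commute)
  hence nz': "1 - z \<notin> \<int>\<^sub>\<le>\<^sub>0" using nonpos_Ints_Int by auto
  have sin: "sin (of_real pi * z) \<noteq> 0"
  proof
    assume "sin (of_real pi * z) = 0"
    then obtain n where "of_real pi * z = of_int n * of_real pi"
      by (auto simp: sin_eq_0)
    hence "z = of_int n" by simp
    thus False using assms by simp
  qed
  let ?h = "\<lambda>z. Gamma z * Gamma (1 - z) * sin (of_real pi * z)"
  have "open (- \<int> :: complex set)" using closed_Ints by (simp add: open_Compl)
  have "eventually (\<lambda>w. ?h w = of_real pi) (nhds z)"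
  proof (rule eventually_nhds_in_open[OF \<open>open (- \<int>)\<close>, THEN eventually_mono])
    fix w :: complex assume "w \<in> - \<int>"
    hence "sin (of_real pi * w) \<noteq> 0"
      by (auto simp: sin_eq_0)
    thus "?h w = of_real pi" by (simp add: Gamma_reflection_complex)
  qed (use assms in auto)
  hence "(?h has_field_derivative 0) (at z)"
    by (subst DERIV_cong_ev[OF refl _ refl]) auto
  moreover have "(?h has_field_derivative
     (Gamma z * Gamma (1 - z) * (cos (of_real pi * z) * of_real pi) +
      (Gamma z * (Gamma (1 - z) * Digamma (1 - z) * (- 1)) + Gamma z * Digamma z * Gamma (1 - z)) * sin (of_real pi * z))) (at z)"
    using nz nz' by (auto intro!: derivative_eq_intros)
  ultimately have "(Gamma z * Gamma (1 - z) * (cos (of_real pi * z) * of_real pi) +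
      (Gamma z * (Gamma (1 - z) * Digamma (1 - z) * (- 1)) + Gamma z * Digamma z * Gamma (1 - z)) * sin (of_real pi * z)) = 0"
    by (rule DERIV_unique[symmetric])
  hence "(Gamma z * Gamma (1 - z)) * (cos (of_real pi * z) * of_real pi - (Digamma (1 - z) - Digamma z) * sin (of_real pi * z)) = 0"
    by (simp add: algebra_simps)
  hence "cos (of_real pi * z) * of_real pi = (Digamma (1 - z) - Digamma z) * sin (of_real pi * z)"
    using nz nz' by (simp add: Gamma_eq_zero_iff)
  thus ?thesis using sin by (simp add: cot_def field_simps)
qed

lemma cot_partial_fractions:
  fixes z :: complex
  assumes "z \<notin> \<int>"
  shows "(\<lambda>n. 1 / (z + of_nat (Suc n)) + 1 / (z - of_nat (Suc n))) sums (of_real pi * cot (of_real pi * z) - 1 / z)"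
proof -
  have "z \<noteq> 0" "1 - z \<noteq> 0" using assms by auto
  have "(\<lambda>m. (of_real (ln (real m)) - (\<Sum>n<m. inverse (1 - z + of_nat n))) - (of_real (ln (real m)) - (\<Sum>n<m. inverse (z + of_nat n))))
     \<longlonglongrightarrow> Digamma (1 - z) - Digamma z"
    by (intro tendsto_diff Digamma_LIMSEQ) fact+
  hence lim: "(\<lambda>m. (\<Sum>n<m. inverse (z + of_nat n)) - (\<Sum>n<m. inverse (1 - z + of_nat n))) \<longlonglongrightarrow> of_real pi * cot (of_real pi * z)"
    by (simp add: Digamma_reflection[OF assms])
  have part: "(\<Sum>n<m. 1 / (z + of_nat (Suc n)) + 1 / (z - of_nat (Suc n))) =
     ((\<Sum>n<m. inverse (z + of_nat n)) - (\<Sum>n<m. inverse (1 - z + of_nat n))) - 1 / z + inverse (z + of_nat m)" for m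
  proof -
    have "(\<Sum>n<m. 1 / (z + of_nat (Suc n))) = (\<Sum>n<m. inverse (z + of_nat n)) - 1 / z + inverse (z + of_nat m)"
      by (induction m) (simp_all add: divide_inverse)
    moreover have "1 / (z - of_nat (Suc n)) = - inverse (1 - z + of_nat n)" for n
    proof -
      have "z - of_nat (Suc n) = - (1 - z + of_nat n)" by simp
      thus ?thesis by (metis inverse_eq_divide inverse_minus_eq)
    qed
    ultimately show ?thesis by (simp add: sum.distrib sum_negf sum_subtractf)
  qed
  have inv: "(\<lambda>m. inverse (z + of_nat m)) \<longlonglongrightarrow> 0"
    by (rule filterlim_compose[OF tendsto_inverse_0 tendsto_add_filterlim_at_infinity[OF tendsto_const tendsto_of_nat]])
  show ?thesis
    unfolding sums_def part using tendsto_add[OF tendsto_diff[OF lim tendsto_const[of "1/z"]] inv] by simp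
qed

lemma summable_on_inverse_square_translates:
  assumes "Im z \<noteq> 0"
  shows "(\<lambda>d::int. 1 / (z + of_int d)^2) summable_on UNIV"
proof -
  have pos: "(\<lambda>d::int. 1 / (z + of_int d)^2) summable_on UNIV" if "Im z > 0" for z
  proof (rule abs_summable_summable)
    let ?C = "(Im z / (2 * (1 + Im z + norm z))) powr - 2"
    have "(\<lambda>d::int. ?C * ((1 + real_of_int \<bar>d\<bar>) powr - 2)) summable_on UNIV"
      by (intro summable_on_cmult_right summable_on_int_powr) auto
    thus "(\<lambda>d::int. norm (1 / (z + of_int d)^2)) summable_on UNIV"
    proof (rule summable_on_comparison_test)
      fix d :: int
      have "z + of_int d \<noteq> 0" using that by (auto simp: complex_eq_iff)
      hence "norm (1 / (z + of_int d)^2) = norm (of_int 1 * z + of_int d) powr - 2"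
        by (simp add: norm_divide norm_power powr_minus_divide powr_numeral)
      also have "\<dots> \<le> ?C * (1 + real_of_int \<bar>1\<bar> + real_of_int \<bar>d\<bar>) powr - 2"
        using that by (intro norm_linear_form_powr_le) auto
      also have "\<dots> \<le> ?C * (1 + real_of_int \<bar>d\<bar>) powr - 2"
        by (intro mult_left_mono powr_mono2') auto
      finally show "norm (1 / (z + of_int d)^2) \<le> ?C * (1 + real_of_int \<bar>d\<bar>) powr - 2" .
    qed auto
  qed
  show ?thesis
  proof (cases "Im z > 0")
    case False
    hence "(\<lambda>d::int. 1 / (- z + of_int d)^2) summable_on UNIV" using assms by (intro pos) auto
    also have "?this \<longleftrightarrow> (\<lambda>d::int. 1 / (z + of_int d)^2) summable_on UNIV"
      by (rule summable_on_reindex_bij_witness[of _ uminus uminus]) (auto simp: power2_eq_square algebra_simps)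
    finally show ?thesis .
  qed (rule pos)
qed

text \<open>This is the sum of \<open>1 / (z + d)\<^sup>2\<close> over all integers \<open>d\<close>.\<close>

definition inv_sin_sq :: "complex \<Rightarrow> complex" where
  "inv_sin_sq z = (of_real pi / sin (of_real pi * z))^2"

lemma has_sum_inverse_square_translates:
  assumes "Im z \<noteq> 0"
  shows "((\<lambda>d::int. 1 / (z + of_int d)^2) has_sum inv_sin_sq z) UNIV"
proof -
  have nI: "w \<notin> \<int>" if "Im w \<noteq> 0" for w using that by (auto elim!: Ints_cases)
  have nz: "w \<notin> \<int>\<^sub>\<le>\<^sub>0" if "Im w \<noteq> 0" for w using nI[OF that] nonpos_Ints_Int by auto
  have sin: "sin (of_real pi * w) \<noteq> 0" if "Im w \<noteq> 0" for w
    using nI[OF that] by (auto simp: sin_eq_0)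
  have "z \<noteq> 0" "1 - z \<noteq> 0" using assms by auto
  have poly: "Polygamma 1 z + Polygamma 1 (1 - z) = inv_sin_sq z"
  proof -
    have op: "open {w. Im w \<noteq> 0}"
      by (intro open_Collect_neq continuous_intros)
    have "eventually (\<lambda>w. Digamma (1 - w) - Digamma w = of_real pi * cot (of_real pi * w)) (nhds z)"
      by (rule eventually_nhds_in_open[OF op, THEN eventually_mono]) (use assms nI in \<open>auto intro!: Digamma_reflection\<close>)
    moreover have "((\<lambda>w. of_real pi * (cos (of_real pi * w) / sin (of_real pi * w))) has_field_derivative - inv_sin_sq z) (at z)"
    proof -
      have *: "sin (of_real pi * z) * sin (of_real pi * z) + cos (of_real pi * z) * cos (of_real pi * z) = 1"
        using sin_cos_squared_add[of "of_real pi * z"] by (simp add: power2_eq_square)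
      have alg: "(- s * p) * s - c * (c * p) = - p * (s * s + c * c)" for s c p :: complex
        by (simp add: algebra_simps)
      let ?s = "sin (of_real pi * z)" and ?c = "cos (of_real pi * z)"
      have "((\<lambda>w. cos (of_real pi * w) / sin (of_real pi * w)) has_field_derivative
              ((- ?s * of_real pi) * ?s - ?c * (?c * of_real pi)) / (?s * ?s)) (at z)"
        by (rule DERIV_divide) (auto intro!: derivative_eq_intros simp: sin[OF assms])
      also have "(- ?s * of_real pi) * ?s - ?c * (?c * of_real pi) = - of_real pi * (?s * ?s + ?c * ?c)"
        by (rule alg)
      finally have "((\<lambda>w. of_real pi * (cos (of_real pi * w) / sin (of_real pi * w))) has_field_derivative
              of_real pi * (- of_real pi * 1 / (?s * ?s))) (at z)"
        unfolding * by (rule DERIV_cmult)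
      also have "of_real pi * (- of_real pi * 1 / (?s * ?s)) = - inv_sin_sq z"
        by (simp add: inv_sin_sq_def power2_eq_square)
      finally show ?thesis .
    qed
    ultimately have "((\<lambda>w. Digamma (1 - w) - Digamma w) has_field_derivative - inv_sin_sq z) (at z)"
      by (subst DERIV_cong_ev[OF refl _ refl]) (simp_all add: cot_def)
    moreover have "((\<lambda>w. Digamma (1 - w) - Digamma w) has_field_derivative (Polygamma 1 (1 - z) * (- 1) - Polygamma 1 z)) (at z)"
      using assms by (auto intro!: derivative_eq_intros nz)
    ultimately have "- inv_sin_sq z = Polygamma 1 (1 - z) * (- 1) - Polygamma 1 z" by (rule DERIV_unique)
    thus ?thesis by (simp add: algebra_simps add_eq_0_iff)
  qed
  let ?f = "\<lambda>d::int. 1 / (z + of_int d)^2"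
  have "(\<lambda>n. ?f (int n)) sums Polygamma 1 z"
    using Polygamma_LIMSEQ[OF \<open>z \<noteq> 0\<close>, of 1] by (simp add: power2_eq_square divide_inverse)
  hence "(\<lambda>n. ?f (int (Suc n))) sums (Polygamma 1 z - ?f 0)"
    by (subst sums_Suc_iff) simp
  moreover have "(\<lambda>n. ?f (- int (Suc n))) sums Polygamma 1 (1 - z)"
  proof -
    have "(z + of_int (- int (Suc n)))^2 = (1 - z + of_nat n)^2" for n
      by (simp add: power2_eq_square algebra_simps)
    thus ?thesis using Polygamma_LIMSEQ[OF \<open>1 - z \<noteq> 0\<close>, of 1] by (simp add: power2_eq_square divide_inverse)
  qed
  ultimately have "(?f has_sum (Polygamma 1 z - ?f 0 + Polygamma 1 (1 - z))) (UNIV - {0})"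
    by (intro has_sum_int_nonzeroI summable_on_subset[OF summable_on_inverse_square_translates[OF assms]]) auto
  from has_sum_insert[OF _ this, of 0] show ?thesis by (simp add: poly[symmetric] insert_UNIV)
qed

lemma inv_sin_sq_minus [simp]: "inv_sin_sq (- z) = inv_sin_sq z"
  by (simp add: inv_sin_sq_def)

lemma inv_sin_sq_nome:
  assumes "Im z > 0"
  shows "inv_sin_sq z = - 4 * of_real pi ^ 2 * (qpow 1 z / (1 - qpow 1 z)^2)"
proof -
  define e where "e = exp (\<i> * of_real pi * z)"
  have e: "e \<noteq> 0" "qpow 1 z = e^2"
    unfolding e_def exp_double[symmetric] by (simp_all add: qpow_def mult_ac)
  have "sin (of_real pi * z) = (e - inverse e) / (2 * \<i>)"
    by (simp add: sin_exp_eq e_def exp_minus mult_ac)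
  hence "sin (of_real pi * z) = (e^2 - 1) / (2 * \<i> * e)"
    using e by (simp add: field_simps power2_eq_square)
  hence "inv_sin_sq z = (of_real pi * (2 * \<i> * e) / (e^2 - 1))^2" by (simp add: inv_sin_sq_def)
  also have "\<dots> = - 4 * of_real pi ^ 2 * (e^2 / (e^2 - 1)^2)" by (simp add: power_mult_distrib power_divide)
  also have "(e^2 - 1)^2 = (1 - e^2)^2" by (rule power2_commute)
  finally show ?thesis by (simp add: e)
qed

lemma sum_telescope_int:
  fixes g :: "int \<Rightarrow> complex"
  shows "(\<Sum>d\<in>{m..<m + int n}. g d - g (d + 1)) = g m - g (m + int n)"
proof (induction n)
  case (Suc n)
  have "{m..<m + int (Suc n)} = insert (m + int n) {m..<m + int n}" by auto
  thus ?case using Suc by (simp add: add_ac)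
qed simp

lemma tendsto_inverse_add_of_nat: "(\<lambda>m. 1 / (z + of_nat m) :: complex) \<longlonglongrightarrow> 0"
  unfolding inverse_eq_divide[symmetric]
  by (rule filterlim_compose[OF tendsto_inverse_0 tendsto_add_filterlim_at_infinity[OF tendsto_const tendsto_of_nat]])

text \<open>The series of \<open>1 / (c\<tau> + d)\<^sup>2\<close> does not converge absolutely. The subtracted terms telescope in \<open>d\<close> with
  sum zero and leave terms of cubic decay, whose order of summation is immaterial.\<close>

definition eis_term :: "complex \<Rightarrow> int \<Rightarrow> int \<Rightarrow> complex" where
  "eis_term \<tau> c d = 1 / (of_int c * \<tau> + of_int d)^2 - 1 / ((of_int c * \<tau> + of_int d - 1) * (of_int c * \<tau> + of_int d))"

text \<open>The sum of \<open>1 / (c\<tau> + d)\<^sup>2\<close> over \<open>c \<noteq> 0\<close> with the inner sum over \<open>d\<close>. The terms with \<open>c = 0\<close> would add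
  the constant \<open>\<pi>\<^sup>2 / 3\<close> and complete it to the Eisenstein series of weight two.\<close>

definition eis :: "complex \<Rightarrow> complex" where
  "eis \<tau> = (\<Sum>\<^sub>\<infinity>c\<in>UNIV - {0::int}. inv_sin_sq (of_int c * \<tau>))"

lemma linear_form_nonzero: "Im \<tau> > 0 \<Longrightarrow> c \<noteq> 0 \<or> d \<noteq> 0 \<Longrightarrow> of_int c * \<tau> + of_int d \<noteq> (0 :: complex)"
  by (auto simp: complex_eq_iff)

lemma summable_on_eis_term:
  assumes "Im \<tau> > 0"
  shows "(\<lambda>(c,d). eis_term \<tau> c d) summable_on ((UNIV - {0}) \<times> UNIV)"
proof (rule abs_summable_summable)
  let ?n3 = "\<lambda>(c::int,d::int). norm (of_int c * \<tau> + of_int d) powr - 3"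
  let ?A = "(UNIV - {0}) \<times> (UNIV :: int set)"
  have s1: "?n3 summable_on ?A"
    using assms by (intro summable_on_norm_linear_form) auto
  have s2: "(\<lambda>(c,d). ?n3 (c,d-1)) summable_on ?A"
    by (subst summable_on_reindex_bij_witness[where T = ?A and h = ?n3 and i = "\<lambda>(c,d). (c,d+1)" and j = "\<lambda>(c,d). (c,d-1)"])
       (use s1 in auto)
  show "(\<lambda>p. norm (case p of (c,d) \<Rightarrow> eis_term \<tau> c d)) summable_on ?A"
  proof (rule summable_on_comparison_test[OF summable_on_add[OF s1 s2]])
    fix p :: "int \<times> int" assume p: "p \<in> ?A"
    obtain c d where cd: "p = (c, d)" by (cases p)
    define x where "x = of_int c * \<tau> + of_int d"
    have "x - 1 = of_int c * \<tau> + of_int (d - 1)" by (simp add: x_def)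
    hence nz: "x \<noteq> 0" "x - 1 \<noteq> 0"
      using linear_form_nonzero[OF assms, of c d] linear_form_nonzero[OF assms, of c "d - 1"] p cd
      by (auto simp only: x_def mem_Sigma_iff Diff_iff insert_iff)
    have "eis_term \<tau> c d = - (1 / (x^2 * (x - 1)))"
      using nz unfolding eis_term_def x_def[symmetric] by (simp add: divide_simps power2_eq_square)
    hence "norm (eis_term \<tau> c d) = (1 / norm x)^2 * (1 / norm (x - 1))"
      by (simp add: norm_divide norm_mult norm_power power_divide)
    also have "\<dots> \<le> (1 / norm x)^3 + (1 / norm (x - 1))^3"
    proof -
      have key: "u^2 * v \<le> u^3 + v^3" if "u \<ge> 0" "v \<ge> 0" for u v :: real
      proof (cases "v \<le> u")
        case True
        hence "u^2 * v \<le> u^2 * u" by (intro mult_left_mono) auto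
        also have "\<dots> = u^3" by (simp add: power2_eq_square power3_eq_cube)
        also have "\<dots> \<le> u^3 + v^3" using that by simp
        finally show ?thesis .
      next
        case False
        hence "u^2 * v \<le> v^2 * v" using that by (intro mult_right_mono power_mono) auto
        also have "\<dots> = v^3" by (simp add: power2_eq_square power3_eq_cube)
        also have "\<dots> \<le> u^3 + v^3" using that by simp
        finally show ?thesis .
      qed
      show ?thesis by (rule key) auto
    qed
    also have "\<dots> = norm x powr - 3 + norm (x - 1) powr - 3"
      using nz by (simp add: powr_minus_divide powr_numeral power_divide)
    finally show "norm (case p of (c,d) \<Rightarrow> eis_term \<tau> c d) \<le> ?n3 p + (\<lambda>(c,d). ?n3 (c,d-1)) p"
      by (simp add: cd x_def algebra_simps)
  qed auto
qed

lemma has_sum_eis_term_row: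
  assumes "Im \<tau> > 0" "c \<noteq> 0"
  shows "((\<lambda>d. eis_term \<tau> c d) has_sum inv_sin_sq (of_int c * \<tau>)) UNIV"
proof -
  define z where "z = of_int c * \<tau>"
  have z: "Im z \<noteq> 0" using assms by (simp add: z_def)
  let ?b = "\<lambda>d::int. 1 / ((z + of_int d - 1) * (z + of_int d))"
  have a: "((\<lambda>d::int. 1 / (z + of_int d)^2) has_sum inv_sin_sq z) UNIV"
    by (rule has_sum_inverse_square_translates[OF z])
  have "(\<lambda>d. eis_term \<tau> c d) summable_on UNIV"
    using summable_on_SigmaD1[OF summable_on_eis_term[OF assms(1)], of c] assms by simp
  hence "(\<lambda>d. 1 / (z + of_int d)^2 - eis_term \<tau> c d) summable_on UNIV"
    using a by (intro summable_on_minus) (auto simp: summable_on_def)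
  hence "?b summable_on UNIV" by (simp add: eis_term_def z_def)
  then obtain S where S: "(?b has_sum S) UNIV" by (auto simp: summable_on_def)
  have "(\<lambda>N. \<Sum>d\<in>{0 - int N..<0 + int N}. ?b d) \<longlonglongrightarrow> S" by (rule has_sum_int_imp_tendsto[OF S])
  also have "(\<lambda>N. \<Sum>d\<in>{0 - int N..<0 + int N}. ?b d) = (\<lambda>N. 1 / (z - of_nat N - 1) - 1 / (z + of_nat N - 1))"
  proof
    fix N
    let ?g = "\<lambda>d::int. 1 / (z + of_int d - 1)"
    have "?b d = ?g d - ?g (d + 1)" for d
    proof -
      have "z + of_int d \<noteq> 0" "z + of_int d - 1 \<noteq> 0" using z by (auto simp: complex_eq_iff)
      thus ?thesis by (simp add: divide_simps)
    qed
    hence "(\<Sum>d\<in>{- int N..<- int N + int (2 * N)}. ?b d) = (\<Sum>d\<in>{- int N..<- int N + int (2 * N)}. ?g d - ?g (d + 1))"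
      by (simp only:)
    also have "\<dots> = ?g (- int N) - ?g (- int N + int (2 * N))" by (rule sum_telescope_int)
    finally have "(\<Sum>d\<in>{- int N..<- int N + int (2 * N)}. ?b d) = ?g (- int N) - ?g (- int N + int (2 * N))" .
    thus "(\<Sum>d\<in>{0 - int N..<0 + int N}. ?b d) = 1 / (z - of_nat N - 1) - 1 / (z + of_nat N - 1)" by simp
  qed
  finally have "(\<lambda>N. 1 / (z - of_nat N - 1) - 1 / (z + of_nat N - 1)) \<longlonglongrightarrow> S" .
  moreover have "(\<lambda>N. 1 / (z - of_nat N - 1) - 1 / (z + of_nat N - 1)) \<longlonglongrightarrow> - 0 - 0"
  proof (intro tendsto_diff)
    have "1 / (z - of_nat N - 1) = - (1 / ((1 - z) + of_nat N))" for N
    proof -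
      have "z - of_nat N - 1 = - ((1 - z) + of_nat N)" by simp
      thus ?thesis by (simp only: divide_minus_right)
    qed
    thus "(\<lambda>N. 1 / (z - of_nat N - 1)) \<longlonglongrightarrow> - 0"
      using tendsto_minus[OF tendsto_inverse_add_of_nat[of "1 - z"]] by simp
    show "(\<lambda>N. 1 / (z + of_nat N - 1)) \<longlonglongrightarrow> 0"
      using tendsto_inverse_add_of_nat[of "z - 1"] by (simp add: algebra_simps)
  qed
  ultimately have "S = 0" using LIMSEQ_unique by fastforce
  have "((\<lambda>d. 1 / (z + of_int d)^2 - ?b d) has_sum (inv_sin_sq z - S)) UNIV" by (rule has_sum_minus[OF a S])
  thus ?thesis using \<open>S = 0\<close> by (simp add: eis_term_def z_def)
qed

lemma has_sum_eis_term:
  assumes "Im \<tau> > 0"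
  shows "((\<lambda>(c,d). eis_term \<tau> c d) has_sum eis \<tau>) ((UNIV - {0}) \<times> UNIV)"
    and "((\<lambda>c. inv_sin_sq (of_int c * \<tau>)) has_sum eis \<tau>) (UNIV - {0::int})"
proof -
  obtain S where S: "((\<lambda>(c,d). eis_term \<tau> c d) has_sum S) ((UNIV - {0}) \<times> UNIV)"
    using summable_on_eis_term[OF assms] by (auto simp: summable_on_def)
  have "((\<lambda>c. inv_sin_sq (of_int c * \<tau>)) has_sum S) (UNIV - {0::int})"
    by (rule has_sum_SigmaD[OF S]) (use has_sum_eis_term_row[OF assms] in auto)
  moreover from this have "eis \<tau> = S" unfolding eis_def by (rule infsumI)
  ultimately show "((\<lambda>(c,d). eis_term \<tau> c d) has_sum eis \<tau>) ((UNIV - {0}) \<times> UNIV)"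
    "((\<lambda>c. inv_sin_sq (of_int c * \<tau>)) has_sum eis \<tau>) (UNIV - {0::int})" using S by auto
qed

lemma has_sum_inverse_squares_int: "((\<lambda>d::int. 1 / (of_int d)^2 :: complex) has_sum of_real (pi^2 / 3)) (UNIV - {0})"
proof -
  have "(\<lambda>d::int. 1 / (of_int d)^2 :: complex) summable_on (UNIV - {0})"
  proof (rule abs_summable_summable, rule summable_on_comparison_test)
    show "(\<lambda>d::int. 4 * (1 + real_of_int \<bar>d\<bar>) powr - 2) summable_on (UNIV - {0})"
      by (intro summable_on_cmult_right summable_on_subset[OF summable_on_int_powr]) auto
    fix d :: int assume "d \<in> UNIV - {0}"
    hence "1 \<le> \<bar>d\<bar>" by simp
    hence d: "real_of_int \<bar>d\<bar> \<ge> 1" by (metis of_int_1 of_int_le_iff)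
    hence "(1 + real_of_int \<bar>d\<bar>)^2 \<le> (2 * real_of_int \<bar>d\<bar>)^2" by (intro power_mono) auto
    hence "(1 + real_of_int \<bar>d\<bar>)^2 \<le> 4 * real_of_int \<bar>d\<bar>^2" by (simp add: power_mult_distrib)
    hence "1 / real_of_int \<bar>d\<bar>^2 \<le> 4 / (1 + real_of_int \<bar>d\<bar>)^2" using d by (simp add: divide_simps)
    thus "norm (1 / (of_int d)^2 :: complex) \<le> 4 * (1 + real_of_int \<bar>d\<bar>) powr - 2"
      using d by (simp add: norm_divide norm_power powr_minus_divide powr_numeral)
  qed auto
  moreover have "(\<lambda>n. complex_of_real (1 / (real n + 1)^2)) sums of_real (pi^2 / 6)"
    using sums_of_real[OF inverse_squares_sums, where 'a = complex] by (simp add: add_ac)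
  hence s: "(\<lambda>n. 1 / (of_nat n + 1)^2 :: complex) sums of_real (pi^2 / 6)" by (simp add: add_ac)
  have e: "(of_int (int (Suc n)))^2 = (of_nat n + 1 :: complex)^2" "(of_int (- int (Suc n)))^2 = (of_nat n + 1 :: complex)^2" for n
    by (simp_all add: power2_eq_square algebra_simps)
  ultimately have "((\<lambda>d::int. 1 / (of_int d)^2 :: complex) has_sum (of_real (pi^2 / 6) + of_real (pi^2 / 6))) (UNIV - {0})"
    by (intro has_sum_int_nonzeroI) (simp_all only: e s)
  also have "of_real (pi^2 / 6) + of_real (pi^2 / 6) = (of_real (pi^2 / 3) :: complex)"
    by (simp flip: of_real_add)
  finally show ?thesis .
qed

text \<open>The sum of \<open>1 / (c\<tau> + d)\<^sup>2\<close> over \<open>c \<noteq> 0\<close>; division of the terms by \<open>\<tau>\<^sup>2\<close> turns it into a row for \<open>-1/\<tau>\<close>.\<close>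

definition eis_col :: "complex \<Rightarrow> int \<Rightarrow> complex" where
  "eis_col \<tau> d = (if d = 0 then of_real (pi^2 / 3) / \<tau>^2 else inv_sin_sq (of_int d * (- 1 / \<tau>)) / \<tau>^2 - 1 / of_int d^2)"

lemma has_sum_eis_col:
  assumes "Im \<tau> > 0"
  shows "((\<lambda>c. 1 / (of_int c * \<tau> + of_int d)^2) has_sum eis_col \<tau> d) (UNIV - {0::int})"
proof (cases "d = 0")
  case True
  have "((\<lambda>c. 1 / (of_int c)^2 * (1 / \<tau>^2)) has_sum of_real (pi^2 / 3) * (1 / \<tau>^2)) (UNIV - {0::int})"
    by (intro has_sum_cmult_left has_sum_inverse_squares_int)
  thus ?thesis using True by (simp add: eis_col_def power_mult_distrib)
next
  case False
  have \<tau>: "\<tau> \<noteq> 0" using assms by auto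
  have Im: "Im (of_int d * (- 1 / \<tau>)) \<noteq> 0" using assms False \<tau> by (auto simp: Im_divide sum_power2_eq_zero_iff complex_eq_iff)
  have "((\<lambda>c::int. 1 / (- (of_int d * (- 1 / \<tau>)) + of_int c)^2) has_sum inv_sin_sq (- (of_int d * (- 1 / \<tau>)))) UNIV"
    using Im by (intro has_sum_inverse_square_translates) simp
  hence "((\<lambda>c::int. 1 / (- (of_int d * (- 1 / \<tau>)) + of_int c)^2 * (1 / \<tau>^2)) has_sum inv_sin_sq (of_int d * (- 1 / \<tau>)) * (1 / \<tau>^2)) UNIV"
    unfolding inv_sin_sq_minus by (rule has_sum_cmult_left)
  also have "(\<lambda>c::int. 1 / (- (of_int d * (- 1 / \<tau>)) + of_int c)^2 * (1 / \<tau>^2)) = (\<lambda>c. 1 / (of_int c * \<tau> + of_int d)^2)"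
  proof
    fix c :: int
    have "of_int c * \<tau> + of_int d = (- (of_int d * (- 1 / \<tau>)) + of_int c) * \<tau>" using \<tau> by (simp add: field_simps)
    thus "1 / (- (of_int d * (- 1 / \<tau>)) + of_int c)^2 * (1 / \<tau>^2) = 1 / (of_int c * \<tau> + of_int d)^2"
      by (simp only: power_mult_distrib) simp
  qed
  finally have "((\<lambda>c. 1 / (of_int c * \<tau> + of_int d)^2) has_sum (inv_sin_sq (of_int d * (- 1 / \<tau>)) / \<tau>^2)) (UNIV::int set)" by simp
  from has_sum_Diff[OF this has_sum_finiteI[of "{0}"]]
  show ?thesis using False by (simp add: eis_col_def)
qed

lemma has_sum_eis_cols:
  assumes "Im \<tau> > 0"
  shows "(eis_col \<tau> has_sum (of_real (pi^2 / 3) / \<tau>^2 + (eis (- 1 / \<tau>) / \<tau>^2 - of_real (pi^2 / 3)))) UNIV"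
proof -
  have "Im (- 1 / \<tau>) > 0" using assms by (auto simp: Im_divide intro!: divide_pos_pos add_nonneg_pos)
  from has_sum_eis_term(2)[OF this]
  have "((\<lambda>d. inv_sin_sq (of_int d * (- 1 / \<tau>)) * (1 / \<tau>^2)) has_sum (eis (- 1 / \<tau>) * (1 / \<tau>^2))) (UNIV - {0::int})"
    by (rule has_sum_cmult_left)
  from has_sum_minus[OF this has_sum_inverse_squares_int]
  have *: "((\<lambda>d. inv_sin_sq (of_int d * (- 1 / \<tau>)) * (1 / \<tau>^2) - 1 / (of_int d)^2) has_sum (eis (- 1 / \<tau>) * (1 / \<tau>^2) - of_real (pi^2 / 3))) (UNIV - {0::int})" .
  have "(eis_col \<tau> has_sum (eis (- 1 / \<tau>) * (1 / \<tau>^2) - of_real (pi^2 / 3))) (UNIV - {0}) \<longleftrightarrow>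
        ((\<lambda>d. inv_sin_sq (of_int d * (- 1 / \<tau>)) * (1 / \<tau>^2) - 1 / (of_int d)^2) has_sum (eis (- 1 / \<tau>) * (1 / \<tau>^2) - of_real (pi^2 / 3))) (UNIV - {0::int})"
    by (rule has_sum_cong) (auto simp: eis_col_def)
  hence "(eis_col \<tau> has_sum (eis (- 1 / \<tau>) / \<tau>^2 - of_real (pi^2 / 3))) (UNIV - {0})"
    using * by simp
  from has_sum_insert[OF _ this, of 0] show ?thesis by (simp add: eis_col_def insert_UNIV)
qed

lemma tendsto_cot_lower_half_plane:
  assumes "Im w < 0"
  shows "(\<lambda>N. cot (of_real pi * (of_nat N * w))) \<longlonglongrightarrow> \<i>"
proof -
  define e where "e = exp (- 2 * \<i> * of_real pi * w)"
  have "norm e < 1" using assms by (simp add: e_def mult_pos_neg)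
  hence "(\<lambda>N. e ^ N) \<longlonglongrightarrow> 0" by (rule LIMSEQ_power_zero)
  hence "(\<lambda>N. \<i> * ((1 + e ^ N) / (1 - e ^ N))) \<longlonglongrightarrow> \<i> * ((1 + 0) / (1 - 0))"
    by (intro tendsto_intros) (use \<open>norm e < 1\<close> in auto)
  moreover have "cot (of_real pi * (of_nat N * w)) = \<i> * ((1 + e ^ N) / (1 - e ^ N))" if "N > 0" for N
  proof -
    define u where "u = exp (\<i> * (of_real pi * (of_nat N * w)))"
    have u: "u \<noteq> 0" "e ^ N = inverse u ^ 2"
      by (auto simp: u_def e_def exp_minus[symmetric] power2_eq_square simp flip: exp_of_nat_mult exp_add) (simp add: algebra_simps)
    have "norm (e ^ N) < 1" using \<open>norm e < 1\<close> that by (simp add: norm_power power_less_one_iff)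
    hence "e ^ N \<noteq> 1" by auto
    hence "u^2 \<noteq> 1" using u by (auto simp: field_simps)
    have s: "sin (of_real pi * (of_nat N * w)) = (u - inverse u) / (2 * \<i>)" and c: "cos (of_real pi * (of_nat N * w)) = (u + inverse u) / 2"
      by (simp_all add: sin_exp_eq cos_exp_eq u_def exp_minus)
    show ?thesis unfolding cot_def s c u(2) using u(1) \<open>u^2 \<noteq> 1\<close>
      by (simp add: divide_simps power2_eq_square)
  qed
  hence "eventually (\<lambda>N. \<i> * ((1 + e ^ N) / (1 - e ^ N)) = cot (of_real pi * (of_nat N * w))) sequentially"
    by (auto simp: eventually_at_top_linorder intro!: exI[of _ 1])
  ultimately show ?thesis using Lim_transform_eventually by fastforce
qed

text \<open>Summing by rows and by columns gives the same value because of the absolutely convergent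
  correction; the correction contributes nothing by rows and a cotangent by columns.\<close>

theorem eis_transform:
  assumes \<tau>: "Im \<tau> > 0"
  shows "eis \<tau> = (of_real (pi^2 / 3) + eis (- 1 / \<tau>)) / \<tau>^2 - of_real (pi^2 / 3) + 2 * of_real pi * \<i> / \<tau>"
proof -
  have "\<tau> \<noteq> 0" using \<tau> by auto
  define Y where "Y = of_real (pi^2 / 3) / \<tau>^2 + (eis (- 1 / \<tau>) / \<tau>^2 - of_real (pi^2 / 3))"
  \<comment> \<open>the correction and its column sums\<close>
  define b where "b = (\<lambda>c d::int. 1 / ((of_int c * \<tau> + of_int d - 1) * (of_int c * \<tau> + of_int d)))"
  define B where "B = (\<lambda>d. \<Sum>\<^sub>\<infinity>c\<in>UNIV - {0}. b c d)"
  have sw: "((\<lambda>(d,c). eis_term \<tau> c d) has_sum eis \<tau>) (UNIV \<times> (UNIV - {0}))"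
    using has_sum_eis_term(1)[OF \<tau>] has_sum_swap[of "\<lambda>(c,d). eis_term \<tau> c d" "UNIV - {0}" UNIV "eis \<tau>"] by simp
  have b: "((\<lambda>c. b c d) has_sum B d) (UNIV - {0})" for d
  proof -
    have "(\<lambda>c. eis_term \<tau> c d) summable_on (UNIV - {0})"
      by (rule summable_on_SigmaD1[where A = UNIV]) (use sw in \<open>auto simp: summable_on_def\<close>)
    hence "(\<lambda>c. 1 / (of_int c * \<tau> + of_int d)^2 - eis_term \<tau> c d) summable_on (UNIV - {0})"
      using has_sum_eis_col[OF \<tau>, of d] by (intro summable_on_minus) (auto simp: summable_on_def)
    hence "(\<lambda>c. b c d) summable_on (UNIV - {0})" by (simp add: eis_term_def b_def)
    thus ?thesis unfolding B_def by (rule has_sum_infsum)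
  qed
  have "((\<lambda>d. eis_col \<tau> d - B d) has_sum eis \<tau>) UNIV"
  proof (rule has_sum_SigmaD[OF sw])
    fix d :: int
    show "((\<lambda>c. case (d, c) of (d, c) \<Rightarrow> eis_term \<tau> c d) has_sum (eis_col \<tau> d - B d)) (UNIV - {0})"
      using has_sum_minus[OF has_sum_eis_col[OF \<tau>, of d] b] by (simp add: eis_term_def b_def)
  qed
  from has_sum_minus[OF has_sum_eis_cols[OF \<tau>, folded Y_def] this]
  have "(B has_sum (Y - eis \<tau>)) UNIV" by simp
  hence lim1: "(\<lambda>N. \<Sum>d\<in>{1 - int N..<1 + int N}. B d) \<longlonglongrightarrow> Y - eis \<tau>" by (rule has_sum_int_imp_tendsto)
  \<comment> \<open>Over a symmetric window of \<open>d\<close> the correction telescopes for each \<open>c\<close>, and what is left is a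
    cotangent series in \<open>c\<close>.\<close>
  have E: "(\<Sum>d\<in>{1 - int N..<1 + int N}. B d) = 2 * (- (1 / \<tau>) * (of_real pi * cot (of_real pi * (of_nat N * (1 / \<tau>))) - \<tau> * (1 / of_nat N)))" if N: "N > 0" for N
  proof -
    define f where "f = (\<lambda>c::int. 1 / (of_int c * \<tau> - of_nat N) - 1 / (of_int c * \<tau> + of_nat N))"
    have fin: "((\<lambda>c. \<Sum>d\<in>X. b c d) has_sum (\<Sum>d\<in>X. B d)) (UNIV - {0})" if "finite X" for X
      using that by induction (auto intro!: has_sum_add b)
    have bf: "(\<Sum>d\<in>{1 - int N..<1 + int N}. b c d) = f c" if c: "c \<noteq> 0" for c
    proof -
      let ?g = "\<lambda>d::int. 1 / (of_int c * \<tau> + of_int d - 1)"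
      have "b c d = ?g d - ?g (d + 1)" for d
      proof -
        have e: "of_int c * \<tau> + of_int d - 1 = of_int c * \<tau> + of_int (d - 1)" by simp
        have "of_int c * \<tau> + of_int d \<noteq> 0" "of_int c * \<tau> + of_int d - 1 \<noteq> 0"
          unfolding e by (rule linear_form_nonzero[OF \<tau>], simp add: c)+
        thus ?thesis by (simp add: b_def divide_simps)
      qed
      hence "(\<Sum>d\<in>{1 - int N..<1 - int N + int (2 * N)}. b c d) = (\<Sum>d\<in>{1 - int N..<1 - int N + int (2 * N)}. ?g d - ?g (d + 1))"
        by (simp only:)
      also have "\<dots> = ?g (1 - int N) - ?g (1 - int N + int (2 * N))" by (rule sum_telescope_int)
      finally have "(\<Sum>d\<in>{1 - int N..<1 - int N + int (2 * N)}. b c d) = ?g (1 - int N) - ?g (1 - int N + int (2 * N))" .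
      thus ?thesis by (simp add: f_def add.commute)
    qed
    have f1: "(f has_sum (\<Sum>d\<in>{1 - int N..<1 + int N}. B d)) (UNIV - {0})"
      using fin[of "{1 - int N..<1 + int N}"] by (rule has_sum_cong[THEN iffD1, rotated]) (use bf in auto)
    define w where "w = of_nat N * (1 / \<tau>)"
    have "Im w < 0" using \<tau> N by (auto simp: w_def Im_divide divide_neg_pos add_nonneg_pos)
    hence "w \<notin> \<int>" by (auto elim!: Ints_cases)
    from sums_mult[OF cot_partial_fractions[OF this], of "- (1 / \<tau>)"]
    have S: "(\<lambda>n. - (1 / \<tau>) * (1 / (w + of_nat (Suc n)) + 1 / (w - of_nat (Suc n)))) sums (- (1 / \<tau>) * (of_real pi * cot (of_real pi * w) - 1 / w))" .
    have fS: "f (int (Suc n)) = - (1 / \<tau>) * (1 / (w + of_nat (Suc n)) + 1 / (w - of_nat (Suc n)))" for n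
    proof -
      have nz: "of_nat N + of_nat (Suc n) * \<tau> \<noteq> 0" "of_nat N - of_nat (Suc n) * \<tau> \<noteq> 0"
        using \<tau> by (auto simp: complex_eq_iff simp del: of_nat_Suc)
      have "w + of_nat (Suc n) = (of_nat N + of_nat (Suc n) * \<tau>) / \<tau>" "w - of_nat (Suc n) = (of_nat N - of_nat (Suc n) * \<tau>) / \<tau>"
        using \<open>\<tau> \<noteq> 0\<close> by (simp_all add: w_def add_divide_distrib diff_divide_distrib)
      hence "- (1 / \<tau>) * (1 / (w + of_nat (Suc n)) + 1 / (w - of_nat (Suc n))) =
             - (1 / (of_nat N + of_nat (Suc n) * \<tau>)) - 1 / (of_nat N - of_nat (Suc n) * \<tau>)"
        using \<open>\<tau> \<noteq> 0\<close> by (simp add: algebra_simps)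
      also have "- (1 / (of_nat N + of_nat (Suc n) * \<tau>)) - 1 / (of_nat N - of_nat (Suc n) * \<tau>) =
                 1 / (of_nat (Suc n) * \<tau> - of_nat N) - 1 / (of_nat (Suc n) * \<tau> + of_nat N)"
      proof -
        have e: "of_nat (Suc n) * \<tau> - of_nat N = - (of_nat N - of_nat (Suc n) * \<tau>)" by simp
        have sw: "- a - b = - b - a" for a b :: complex by simp
        show ?thesis unfolding e divide_minus_right add.commute[of "of_nat (Suc n) * \<tau>" "of_nat N"] by (rule sw)
      qed
      finally show ?thesis by (simp add: f_def)
    qed
    have f_even: "f (- c) = f c" for c
    proof -
      have "of_int (- c) * \<tau> - of_nat N = - (of_int c * \<tau> + of_nat N)" "of_int (- c) * \<tau> + of_nat N = - (of_int c * \<tau> - of_nat N)"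
        by simp_all
      thus ?thesis unfolding f_def by (simp only: divide_minus_right) simp
    qed
    have "(f has_sum ((- (1 / \<tau>) * (of_real pi * cot (of_real pi * w) - 1 / w)) + (- (1 / \<tau>) * (of_real pi * cot (of_real pi * w) - 1 / w)))) (UNIV - {0})"
      by (rule has_sum_int_nonzeroI) (use f1 S in \<open>auto simp only: f_even fS summable_on_def\<close>)
    with f1 have "(\<Sum>d\<in>{1 - int N..<1 + int N}. B d) = (- (1 / \<tau>) * (of_real pi * cot (of_real pi * w) - 1 / w)) + (- (1 / \<tau>) * (of_real pi * cot (of_real pi * w) - 1 / w))"
      by (rule has_sum_unique)
    moreover have "1 / w = \<tau> * (1 / of_nat N)" by (simp add: w_def)
    ultimately show ?thesis unfolding w_def[symmetric] mult_2 by (simp only:)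
  qed
  have "Im (1 / \<tau>) < 0" using \<tau> by (auto simp: Im_divide divide_neg_pos add_nonneg_pos)
  note c = tendsto_cot_lower_half_plane[OF this]
  have i: "(\<lambda>N. 1 / of_nat N :: complex) \<longlonglongrightarrow> 0" using tendsto_inverse_add_of_nat[of 0] by simp
  have "(\<lambda>N. 2 * (- (1 / \<tau>) * (of_real pi * cot (of_real pi * (of_nat N * (1 / \<tau>))) - \<tau> * (1 / of_nat N))))
     \<longlonglongrightarrow> 2 * (- (1 / \<tau>) * (of_real pi * \<i> - \<tau> * 0))"
    by (intro tendsto_mult tendsto_diff tendsto_const c i)
  hence "(\<lambda>N. \<Sum>d\<in>{1 - int N..<1 + int N}. B d) \<longlonglongrightarrow> 2 * (- (1 / \<tau>) * (of_real pi * \<i> - \<tau> * 0))"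
    by (rule Lim_transform_eventually) (rule eventually_mono[OF eventually_gt_at_top[of 0] E[symmetric]])
  from LIMSEQ_unique[OF lim1 this] have "eis \<tau> = Y + 2 * of_real pi * \<i> / \<tau>" by (simp add: field_simps)
  thus ?thesis by (simp add: Y_def add_divide_distrib)
qed

section \<open>Transformation of the Dedekind eta function\<close>

lemma deriv_geometric_sums:
  fixes x :: "'a::{real_normed_field,banach}"
  assumes "norm x < 1"
  shows "(\<lambda>n. of_nat (Suc n) * x ^ Suc n) sums (x / (1 - x)^2)"
  using sums_mult[OF geometric_deriv_sums[OF assms], of x] by (simp add: mult_ac)

text \<open>Both series are the double series of \<open>n * q ^ (n * c)\<close>, summed in the two possible orders.\<close>

lemma lambert_double_series:
  fixes q :: complex
  assumes q: "norm q < 1"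
  obtains L where "(\<lambda>n. of_nat (Suc n) * (q ^ Suc n / (1 - q ^ Suc n))) sums L"
                  "(\<lambda>c. q ^ Suc c / (1 - q ^ Suc c)^2) sums L"
proof -
  define \<rho> where "\<rho> = norm q"
  have \<rho>: "0 \<le> \<rho>" "\<rho> < 1" using q by (auto simp: \<rho>_def)
  have p1: "\<rho> ^ Suc c < 1" for c using \<rho> by (intro power_less_one_iff[THEN iffD2]) auto
  have n1: "norm (q ^ Suc c) < 1" for c using p1[of c] by (simp only: norm_power \<rho>_def)
  define f where "f = (\<lambda>(c,n). of_nat (Suc n) * (q ^ Suc c) ^ Suc n)"
  have "(\<lambda>p. norm (f p)) summable_on (UNIV \<times> UNIV)"
  proof (rule summable_on_SigmaI)
    fix c :: nat
    have "((\<lambda>n. real (Suc n) * (\<rho> ^ Suc c) ^ Suc n) has_sum (\<rho> ^ Suc c / (1 - \<rho> ^ Suc c)^2)) UNIV"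
      using deriv_geometric_sums[of "\<rho> ^ Suc c"] \<rho> p1[of c] by (intro sums_nonneg_imp_has_sum) auto
    thus "((\<lambda>n. norm (f (c, n))) has_sum (\<rho> ^ Suc c / (1 - \<rho> ^ Suc c)^2)) UNIV"
      unfolding f_def prod.case norm_mult norm_power norm_of_nat \<rho>_def .
  next
    have "summable (\<lambda>c. \<rho> ^ Suc c / (1 - \<rho>)^2)"
      using \<rho> by (intro summable_divide summable_mult) (auto simp: summable_mult)
    hence "(\<lambda>c. \<rho> ^ Suc c / (1 - \<rho>)^2) summable_on UNIV"
      using \<rho> by (intro summable_nonneg_imp_summable_on) auto
    thus "(\<lambda>c. \<rho> ^ Suc c / (1 - \<rho> ^ Suc c)^2) summable_on UNIV"
    proof (rule summable_on_comparison_test)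
      fix c :: nat
      have "\<rho> ^ Suc c \<le> \<rho> ^ 1" using \<rho> by (intro power_decreasing) auto
      thus "\<rho> ^ Suc c / (1 - \<rho> ^ Suc c)^2 \<le> \<rho> ^ Suc c / (1 - \<rho>)^2"
        using \<rho> by (intro divide_left_mono power_mono mult_pos_pos zero_less_power) (use p1[of c] in auto)
    qed (use \<rho> in auto)
  qed auto
  hence "f summable_on (UNIV \<times> UNIV)" by (rule abs_summable_summable)
  then obtain L where L: "(f has_sum L) (UNIV \<times> UNIV)" by (auto simp: summable_on_def)
  have "((\<lambda>c. q ^ Suc c / (1 - q ^ Suc c)^2) has_sum L) UNIV"
  proof (rule has_sum_SigmaD[OF L])
    fix c :: nat
    have "summable (\<lambda>n. norm (of_nat (Suc n) * (q ^ Suc c) ^ Suc n))"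
      using sums_summable[OF deriv_geometric_sums[of "\<rho> ^ Suc c"]] p1[of c] \<rho>
      unfolding norm_mult norm_power norm_of_nat \<rho>_def by simp
    thus "((\<lambda>n. f (c, n)) has_sum (q ^ Suc c / (1 - q ^ Suc c)^2)) UNIV"
      unfolding f_def prod.case by (rule norm_summable_imp_has_sum) (rule deriv_geometric_sums[OF n1])
  qed
  hence 1: "(\<lambda>c. q ^ Suc c / (1 - q ^ Suc c)^2) sums L" by (rule has_sum_imp_sums)
  have L': "((\<lambda>(n,c). f (c,n)) has_sum L) (UNIV \<times> UNIV)"
    using L has_sum_swap[of f UNIV UNIV L] by simp
  have "((\<lambda>n. of_nat (Suc n) * (q ^ Suc n / (1 - q ^ Suc n))) has_sum L) UNIV"
  proof (rule has_sum_SigmaD[OF L'])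
    fix n :: nat
    have "((\<lambda>c. (q ^ Suc n) ^ Suc c) has_sum (q ^ Suc n / (1 - q ^ Suc n))) UNIV"
    proof (rule norm_summable_imp_has_sum)
      show "summable (\<lambda>c. norm ((q ^ Suc n) ^ Suc c))" using n1[of n] by (rule summable_norm_power_Suc)
      show "(\<lambda>c. (q ^ Suc n) ^ Suc c) sums (q ^ Suc n / (1 - q ^ Suc n))"
        using sums_mult[OF geometric_sums[OF n1[of n]], of "q ^ Suc n"] by simp
    qed
    hence "((\<lambda>c. of_nat (Suc n) * (q ^ Suc n) ^ Suc c) has_sum (of_nat (Suc n) * (q ^ Suc n / (1 - q ^ Suc n)))) UNIV"
      by (rule has_sum_cmult_right)
    also have "(\<lambda>c. of_nat (Suc n) * (q ^ Suc n) ^ Suc c) = (\<lambda>c. f (c, n))"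
      unfolding f_def prod.case by (simp only: power_mult[symmetric] mult.commute)
    finally show "((\<lambda>c. case (n, c) of (n, c) \<Rightarrow> f (c, n)) has_sum (of_nat (Suc n) * (q ^ Suc n / (1 - q ^ Suc n)))) UNIV"
      by simp
  qed
  hence 2: "(\<lambda>n. of_nat (Suc n) * (q ^ Suc n / (1 - q ^ Suc n))) sums L" by (rule has_sum_imp_sums)
  from 2 1 show ?thesis by (rule that)
qed

lemma eis_eq_logderiv:
  assumes \<tau>: "Im \<tau> > 0"
  shows "eis \<tau> = 8 * of_real pi^2 * (qpow 1 \<tau> * deriv euler_prod (qpow 1 \<tau>) / euler_prod (qpow 1 \<tau>))"
proof -
  define q where "q = qpow 1 \<tau>"
  have q: "norm q < 1" using norm_nome_less_1[OF \<tau>] by (simp add: q_def)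
  obtain L where L: "(\<lambda>n. of_nat (Suc n) * (q ^ Suc n / (1 - q ^ Suc n))) sums L"
                    "(\<lambda>c. q ^ Suc c / (1 - q ^ Suc c)^2) sums L"
    using lambert_double_series[OF q] by blast
  have rows: "inv_sin_sq (of_int (int (Suc c)) * \<tau>) = - 4 * of_real pi^2 * (q ^ Suc c / (1 - q ^ Suc c)^2)" for c
  proof -
    have "qpow 1 (of_int (int (Suc c)) * \<tau>) = q ^ Suc c"
      unfolding q_def qpow_nat[symmetric] by (simp add: qpow_def algebra_simps)
    thus ?thesis using \<tau> by (subst inv_sin_sq_nome) (auto intro: mult_pos_pos add_pos_nonneg)
  qed
  have s: "(\<lambda>c. - 4 * of_real pi^2 * (q ^ Suc c / (1 - q ^ Suc c)^2)) sums (- 4 * of_real pi^2 * L)"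
    by (rule sums_mult[OF L(2)])
  have rows': "inv_sin_sq (of_int (- int (Suc c)) * \<tau>) = - 4 * of_real pi^2 * (q ^ Suc c / (1 - q ^ Suc c)^2)" for c
  proof -
    have "of_int (- int (Suc c)) * \<tau> = - (of_int (int (Suc c)) * \<tau>)" by (simp only: of_int_minus mult_minus_left)
    thus ?thesis by (simp only: inv_sin_sq_minus rows)
  qed
  have "((\<lambda>c. inv_sin_sq (of_int c * \<tau>)) has_sum (- 4 * of_real pi^2 * L + - 4 * of_real pi^2 * L)) (UNIV - {0::int})"
  proof (rule has_sum_int_nonzeroI)
    show "(\<lambda>c. inv_sin_sq (of_int c * \<tau>)) summable_on (UNIV - {0::int})"
      using has_sum_eis_term(2)[OF \<tau>] by (auto simp: summable_on_def)
  qed (unfold rows rows', rule s, rule s)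
  hence eis: "eis \<tau> = - 4 * of_real pi^2 * L + - 4 * of_real pi^2 * L"
    unfolding eis_def by (rule infsumI)
  define \<rho> where "\<rho> = (norm q + 1) / 2"
  have \<rho>: "norm q < \<rho>" "\<rho> < 1" using q by (auto simp: \<rho>_def)
  have "(\<lambda>k. deriv (\<lambda>q. 1 - q ^ Suc k) q / (1 - q ^ Suc k)) sums (deriv euler_prod q / euler_prod q)"
  proof (rule logderiv_prodinf_complex_uniform_limit[where A = "ball 0 \<rho>" and f = "\<lambda>k q. 1 - q ^ Suc k"])
    show "uniform_limit (ball 0 \<rho>) (\<lambda>n x. \<Prod>k<n. 1 - x ^ Suc k) euler_prod sequentially"
      by (rule uniform_limit_on_subset[OF uniform_limit_euler_prod[OF \<rho>(2)]]) auto
    show "euler_prod q \<noteq> 0" by (rule euler_prod_nonzero[OF q])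
  qed (use \<rho> in \<open>auto intro!: holomorphic_intros\<close>)
  moreover have "deriv (\<lambda>q. 1 - q ^ Suc k) q = - (of_nat (Suc k) * q ^ k)" for k
    by (rule DERIV_imp_deriv) (auto intro!: derivative_eq_intros simp del: power_Suc of_nat_Suc)
  ultimately have "(\<lambda>k. - q * (- (of_nat (Suc k) * q ^ k) / (1 - q ^ Suc k))) sums (- q * (deriv euler_prod q / euler_prod q))"
    by (intro sums_mult) simp
  also have "(\<lambda>k. - q * (- (of_nat (Suc k) * q ^ k) / (1 - q ^ Suc k))) = (\<lambda>n. of_nat (Suc n) * (q ^ Suc n / (1 - q ^ Suc n)))"
    by (simp add: mult_ac)
  finally have "L = - q * (deriv euler_prod q / euler_prod q)" using L(1) sums_unique2 by blast
  thus ?thesis unfolding eis q_def[symmetric] by (simp add: algebra_simps)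
qed

lemma has_field_derivative_qpow:
  "(qpow s has_field_derivative (2 * of_real pi * \<i> * of_real s * qpow s \<tau>)) (at \<tau>)"
  unfolding qpow_def[abs_def] by (auto intro!: derivative_eq_intros)

lemma has_field_derivative_dedekind_eta:
  assumes \<tau>: "Im \<tau> > 0"
  shows "(dedekind_eta has_field_derivative dedekind_eta \<tau> * (\<i> / (4 * of_real pi) * (of_real (pi^2 / 3) + eis \<tau>))) (at \<tau>)"
proof -
  define q where "q = qpow 1 \<tau>"
  have q: "norm q < 1" using norm_nome_less_1[OF \<tau>] by (simp add: q_def)
  have E: "(euler_prod has_field_derivative deriv euler_prod q) (at (qpow 1 \<tau>))"
    using holomorphic_derivI[OF holomorphic_euler_prod, of q] q by (simp add: q_def)
  have "((\<lambda>\<tau>. qpow (1/24) \<tau> * euler_prod (qpow 1 \<tau>)) has_field_derivative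
     (qpow (1/24) \<tau> * (deriv euler_prod q * (2 * of_real pi * \<i> * of_real 1 * q)) + (2 * of_real pi * \<i> * of_real (1/24) * qpow (1/24) \<tau>) * euler_prod q)) (at \<tau>)"
    using DERIV_mult[OF has_field_derivative_qpow[of "1/24" \<tau>] DERIV_chain2[OF E has_field_derivative_qpow[of 1 \<tau>]]]
    by (simp add: q_def mult_ac add_ac)
  also have "(\<lambda>\<tau>. qpow (1/24) \<tau> * euler_prod (qpow 1 \<tau>)) = dedekind_eta"
    by (simp add: fun_eq_iff dedekind_eta_eq)
  also have "(qpow (1/24) \<tau> * (deriv euler_prod q * (2 * of_real pi * \<i> * of_real 1 * q)) + (2 * of_real pi * \<i> * of_real (1/24) * qpow (1/24) \<tau>) * euler_prod q) =
     dedekind_eta \<tau> * (\<i> / (4 * of_real pi) * (of_real (pi^2 / 3) + eis \<tau>))"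
    unfolding eis_eq_logderiv[OF \<tau>] dedekind_eta_eq q_def[symmetric] using euler_prod_nonzero[OF q]
    by (simp add: field_simps power2_eq_square)
  finally show ?thesis .
qed

text \<open>By the transformation law of the Eisenstein series the two sides have the same logarithmic
  derivative, and they agree at the fixed point \<open>\<i>\<close> of the inversion.\<close>

theorem dedekind_eta_S_24:
  assumes \<tau>: "Im \<tau> > 0"
  shows "dedekind_eta (- 1 / \<tau>) ^ 24 = \<tau> ^ 12 * dedekind_eta \<tau> ^ 24"
proof -
  define H where "H = {\<tau>. Im \<tau> > 0}"
  \<comment> \<open>the logarithmic derivative of \<open>\<eta>\<close>\<close>
  define l where "l = (\<lambda>\<tau>. \<i> / (4 * of_real pi) * (of_real (pi^2 / 3) + eis \<tau>))"
  have S: "Im (- 1 / t) > 0" if "Im t > 0" for t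
    using that by (auto simp: Im_divide intro!: divide_pos_pos add_nonneg_pos)
  have l: "l (- 1 / t) / t^2 = l t + 1 / (2 * t)" if "Im t > 0" for t
  proof -
    have t: "t \<noteq> 0" using that by auto
    have "(of_real (pi^2 / 3) + eis (- 1 / t)) / t^2 = (of_real (pi^2 / 3) + eis t) - 2 * of_real pi * \<i> / t"
      by (subst eis_transform[OF that]) simp
    hence "l (- 1 / t) / t^2 = \<i> / (4 * of_real pi) * ((of_real (pi^2 / 3) + eis t) - 2 * of_real pi * \<i> / t)"
      unfolding l_def by (metis times_divide_eq_right)
    also have "\<dots> = l t + 1 / (2 * t)" using t by (simp add: l_def right_diff_distrib)
    finally show ?thesis .
  qed
  have "\<exists>c. \<forall>t\<in>H. dedekind_eta (- 1 / t) ^ 24 / (t ^ 12 * dedekind_eta t ^ 24) = c"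
  proof (rule has_field_derivative_zero_constant)
    show "convex H" unfolding H_def by (rule convex_halfspace_Im_gt)
    fix t assume "t \<in> H"
    hence t: "Im t > 0" "t \<noteq> 0" by (auto simp: H_def)
    define A B where "A = dedekind_eta (- 1 / t)" and "B = dedekind_eta t"
    have AB: "A \<noteq> 0" "B \<noteq> 0" using t S by (auto simp: A_def B_def dedekind_eta_nonzero)
    have "((\<lambda>t. - 1 / t) has_field_derivative 1 / t^2) (at t)"
      using t by (auto intro!: derivative_eq_intros simp: power2_eq_square)
    from DERIV_chain2[OF has_field_derivative_dedekind_eta[OF S[OF t(1)]] this]
    have dA: "((\<lambda>t. dedekind_eta (- 1 / t)) has_field_derivative A * (l (- 1 / t) / t^2)) (at t)"
      by (simp add: A_def l_def)
    have dN: "((\<lambda>t. dedekind_eta (- 1 / t) ^ 24) has_field_derivative A ^ 24 * (24 * (l (- 1 / t) / t^2))) (at t)"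
      by (rule DERIV_cong[OF DERIV_power[OF dA]]) (simp add: A_def power_eq_if)
    have dB: "(dedekind_eta has_field_derivative B * l t) (at t)"
      using has_field_derivative_dedekind_eta[OF t(1)] by (simp add: B_def l_def)
    have dB24: "((\<lambda>t. dedekind_eta t ^ 24) has_field_derivative B ^ 24 * (24 * l t)) (at t)"
      by (rule DERIV_cong[OF DERIV_power[OF dB]]) (simp add: B_def power_eq_if)
    have dt: "((\<lambda>t. t ^ 12) has_field_derivative t ^ 12 * (12 / t)) (at t)"
      by (rule DERIV_cong[OF DERIV_power[OF DERIV_ident]]) (use t in \<open>simp add: power_eq_if\<close>)
    have dD: "((\<lambda>t. t ^ 12 * dedekind_eta t ^ 24) has_field_derivative (t ^ 12 * B ^ 24) * (24 * (l (- 1 / t) / t^2))) (at t)"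
    proof (rule DERIV_cong[OF DERIV_mult[OF dt dB24]])
      have "24 * (l t + 1 / (2 * t)) = 24 * l t + 12 / t" by (simp add: ring_distribs)
      thus "t ^ 12 * (12 / t) * dedekind_eta t ^ 24 + B ^ 24 * (24 * l t) * t ^ 12 = (t ^ 12 * B ^ 24) * (24 * (l (- 1 / t) / t^2))"
        unfolding l[OF t(1)] B_def by (simp add: ring_distribs mult_ac)
    qed
    have "((\<lambda>t. dedekind_eta (- 1 / t) ^ 24 / (t ^ 12 * dedekind_eta t ^ 24)) has_field_derivative 0) (at t)"
      by (rule DERIV_cong[OF DERIV_divide[OF dN dD]]) (use AB t in \<open>auto simp: A_def B_def algebra_simps\<close>)
    thus "((\<lambda>t. dedekind_eta (- 1 / t) ^ 24 / (t ^ 12 * dedekind_eta t ^ 24)) has_field_derivative 0) (at t within H)"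
      by (rule has_field_derivative_at_within)
  qed
  then obtain c where c: "\<And>t. t \<in> H \<Longrightarrow> dedekind_eta (- 1 / t) ^ 24 / (t ^ 12 * dedekind_eta t ^ 24) = c" by blast
  have "c = 1"
  proof -
    have "dedekind_eta \<i> \<noteq> 0" by (rule dedekind_eta_nonzero) simp
    moreover have "- 1 / \<i> = \<i>" by (simp add: complex_eq_iff Re_divide Im_divide)
    moreover have "\<i> ^ 12 = 1" by (simp add: power_eq_if)
    ultimately show ?thesis using c[of \<i>] by (simp add: H_def)
  qed
  thus ?thesis using c[of \<tau>] \<tau> dedekind_eta_nonzero[OF \<tau>] by (auto simp: H_def field_simps)
qed

lemma dedekind_eta_T_24: "dedekind_eta (\<tau> + of_int b) ^ 24 = dedekind_eta \<tau> ^ 24"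
proof -
  have "qpow (1/24) t ^ 24 = qpow 1 t" for t
    by (simp add: qpow_def mult_ac flip: exp_of_nat_mult)
  moreover have "qpow 1 (\<tau> + of_int b) = qpow 1 \<tau>"
    using qpow_of_int_of_int[of 1 b] by (simp add: qpow_add_arg)
  ultimately show ?thesis by (simp add: dedekind_eta_eq power_mult_distrib)
qed

text \<open>Euclid's algorithm on the lower row reduces the claim to translations and the inversion.\<close>

theorem dedekind_eta_24_modular:
  assumes "M \<in> carrier SL2Z" "Im \<tau> > 0"
  shows "dedekind_eta (moebius M \<tau>) ^ 24 = aut_factor M \<tau> ^ 12 * dedekind_eta \<tau> ^ 24"
proof -
  define Q where "Q = (\<lambda>M. M \<in> carrier SL2Z \<and> (\<forall>\<tau>. Im \<tau> > 0 \<longrightarrow> dedekind_eta (moebius M \<tau>) ^ 24 = aut_factor M \<tau> ^ 12 * dedekind_eta \<tau> ^ 24))"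
  have Q_mult: "Q (M ** N)" if "Q M" "Q N" for M N
    using that SL2Z.m_closed[of M N]
    by (auto simp: Q_def moebius_mult aut_factor_mult Im_moebius_pos power_mult_distrib mult_ac)
  have Q_T: "Q (mat2 e b 0 e)" if "e * e = 1" for e b
  proof -
    have e: "e = 1 \<or> e = -1" using that by (metis zmult_eq_1_iff)
    have "moebius (mat2 e b 0 e) \<tau> = \<tau> + of_int (e * b)" for \<tau>
      using e by (auto simp: moebius_def aut_factor_def)
    thus ?thesis using e by (auto simp: Q_def in_SL2Z_iff dedekind_eta_T_24 dedekind_eta_T_24[of _ "- b", simplified] aut_factor_def)
  qed
  have Q_S: "Q (mat2 0 (- 1) 1 0)"
    by (auto simp: Q_def in_SL2Z_iff moebius_def aut_factor_def dedekind_eta_S_24[simplified])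
  have "Q M" if "M \<in> carrier SL2Z" for M
    using that
  proof (induction "nat \<bar>a21 M\<bar>" arbitrary: M rule: less_induct)
    case (less M)
    show ?case
    proof (cases "a21 M = 0")
      case True
      hence "a11 M * a22 M = 1" using less.prems by (simp add: in_SL2Z_iff)
      hence "a11 M = 1 \<and> a22 M = 1 \<or> a11 M = -1 \<and> a22 M = -1" by (simp add: zmult_eq_1_iff)
      hence "M = mat2 (a11 M) (a12 M) 0 (a11 M)" "a11 M * a11 M = 1" using True by (auto simp: mat2_eq_iff)
      thus ?thesis using Q_T by metis
    next
      case False
      define j where "j = a22 M div a21 M"
      define N where "N = M ** mat2 1 (- j) 0 1 ** mat2 0 (- 1) 1 0"
      have a21: "a21 N = a22 M mod a21 M"
        by (simp add: N_def matrix_mult_nth_2 j_def minus_div_mult_eq_mod[symmetric] algebra_simps)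
      have "N \<in> carrier SL2Z" unfolding N_def
        using less.prems SL2Z.m_closed[of "M ** mat2 1 (- j) 0 1" "mat2 0 (- 1) 1 0"] SL2Z.m_closed[of M "mat2 1 (- j) 0 1"]
        by (simp add: in_SL2Z_iff[of "mat2 _ _ _ _"])
      moreover have "\<bar>a21 N\<bar> < \<bar>a21 M\<bar>" unfolding a21 using False by (rule abs_mod_less)
      ultimately have "Q N" using less.hyps[of N] by simp
      have "M = N ** (mat2 (- 1) 0 0 (- 1) ** mat2 0 (- 1) 1 0) ** mat2 1 j 0 1"
        by (simp add: mat2_eq_iff N_def matrix_mult_nth_2 algebra_simps)
      moreover have "Q (N ** (mat2 (- 1) 0 0 (- 1) ** mat2 0 (- 1) 1 0) ** mat2 1 j 0 1)"
        by (intro Q_mult Q_T Q_S \<open>Q N\<close>) auto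
      ultimately show ?thesis by metis
    qed
  qed
  thus ?thesis using assms by (auto simp: Q_def)
qed

text \<open>The quotient defining \<open>v\<^sub>\<eta>(M)\<close> is a continuous function with values in the 24th roots of unity on
  a connected set.\<close>

lemma
  assumes M: "M \<in> carrier SL2Z"
  shows dedekind_eta_moebius: "Im \<tau> > 0 \<Longrightarrow> dedekind_eta (moebius M \<tau>) = eta_mult M * cpow (aut_factor M \<tau>) (1/2) * dedekind_eta \<tau>"
    and eta_mult_power_24: "eta_mult M ^ 24 = 1"
proof -
  define H where "H = {\<tau>. Im \<tau> > 0}"
  define u where "u = (\<lambda>\<tau>. dedekind_eta (moebius M \<tau>) / (cpow (aut_factor M \<tau>) (1/2) * dedekind_eta \<tau>))"
  have nz: "cpow (aut_factor M \<tau>) (1/2) \<noteq> 0" "dedekind_eta \<tau> \<noteq> 0" "aut_factor M \<tau> \<noteq> 0" if "\<tau> \<in> H" for \<tau>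
    using that M by (auto simp: H_def dedekind_eta_nonzero aut_factor_nonzero)
  have u24: "u \<tau> ^ 24 = 1" if "\<tau> \<in> H" for \<tau>
  proof -
    have "cpow (aut_factor M \<tau>) (1/2) ^ 24 = (cpow (aut_factor M \<tau>) (1/2) ^ 2) ^ 12" by (simp flip: power_mult)
    also have "\<dots> = aut_factor M \<tau> ^ 12" using cpow_half_squared[OF nz(3)[OF that]] by simp
    finally show ?thesis using dedekind_eta_24_modular[OF M, of \<tau>] nz[OF that] that
      by (simp add: u_def power_divide power_mult_distrib H_def)
  qed
  have cont_cpow: "continuous_on H (\<lambda>\<tau>. cpow (aut_factor M \<tau>) (1/2))"
  proof (cases "a21 M = 0")
    case True
    thus ?thesis by (simp add: aut_factor_def)
  next
    case False
    have im: "Im (aut_factor M \<tau>) \<noteq> 0" if "\<tau> \<in> H" for \<tau>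
      using that False by (auto simp: H_def aut_factor_def)
    have "continuous_on H (\<lambda>\<tau>. aut_factor M \<tau> powr of_real (1/2))"
      using im by (intro continuous_intros) (auto simp: aut_factor_def complex_nonpos_Reals_iff intro!: continuous_intros)
    thus ?thesis by (rule continuous_on_cong[THEN iffD1, rotated 2]) (auto simp: cpow_eq_powr im)
  qed
  have cont: "continuous_on H u"
  proof -
    have "continuous_on H (moebius M)" unfolding moebius_def[abs_def]
      using nz by (intro continuous_intros) (auto simp: aut_factor_def[abs_def] intro!: continuous_intros)
    hence "continuous_on H (\<lambda>\<tau>. dedekind_eta (moebius M \<tau>))"
      by (rule continuous_on_compose2[OF holomorphic_on_imp_continuous_on[OF holomorphic_dedekind_eta]])
         (use M Im_moebius_pos in \<open>auto simp: H_def\<close>)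
    thus ?thesis unfolding u_def using nz cont_cpow holomorphic_on_imp_continuous_on[OF holomorphic_dedekind_eta]
      by (intro continuous_intros) (auto simp: H_def)
  qed
  have "u constant_on H"
  proof (rule continuous_finite_range_constant[OF _ cont])
    show "connected H" unfolding H_def by (intro convex_connected convex_halfspace_Im_gt)
    show "finite (u ` H)"
      by (rule finite_subset[OF _ finite_roots_unity[of 24]]) (auto simp: u24)
  qed
  then obtain v where v: "\<And>\<tau>. \<tau> \<in> H \<Longrightarrow> u \<tau> = v" unfolding constant_on_def by blast
  have "\<i> \<in> H" by (simp add: H_def)
  have v_eq: "dedekind_eta (moebius M \<tau>) = v * cpow (aut_factor M \<tau>) (1/2) * dedekind_eta \<tau>" if "Im \<tau> > 0" for \<tau>
    using v[of \<tau>] nz[of \<tau>] that by (auto simp: u_def H_def field_simps)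
  have "eta_mult M = v"
    unfolding eta_mult_def
  proof (rule the_equality)
    show "\<forall>\<tau>. Im \<tau> > 0 \<longrightarrow> dedekind_eta (moebius M \<tau>) = v * cpow (aut_factor M \<tau>) (1/2) * dedekind_eta \<tau>" using v_eq by blast
    fix w assume "\<forall>\<tau>. Im \<tau> > 0 \<longrightarrow> dedekind_eta (moebius M \<tau>) = w * cpow (aut_factor M \<tau>) (1/2) * dedekind_eta \<tau>"
    hence "w * cpow (aut_factor M \<i>) (1/2) * dedekind_eta \<i> = v * cpow (aut_factor M \<i>) (1/2) * dedekind_eta \<i>"
      using v_eq[of \<i>] by simp
    thus "w = v" using nz[OF \<open>\<i> \<in> H\<close>] by simp
  qed
  thus "Im \<tau> > 0 \<Longrightarrow> dedekind_eta (moebius M \<tau>) = eta_mult M * cpow (aut_factor M \<tau>) (1/2) * dedekind_eta \<tau>"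
    and "eta_mult M ^ 24 = 1" using v_eq u24[OF \<open>\<i> \<in> H\<close>] v[OF \<open>\<i> \<in> H\<close>] by auto
qed

section \<open>Forms of weight two have no constant term\<close>

text \<open>The increment of a primitive over a period is constant, so the integral over a horizontal period
  does not depend on its height.\<close>

lemma period_integral_primitive:
  assumes hol: "f holomorphic_on {\<tau>. Im \<tau> > 0}" and per: "\<And>\<tau>. Im \<tau> > 0 \<Longrightarrow> f (\<tau> + 1) = f \<tau>"
  obtains F C where "\<And>\<tau>. Im \<tau> > 0 \<Longrightarrow> (F has_field_derivative f \<tau>) (at \<tau>)" "\<And>\<tau>. Im \<tau> > 0 \<Longrightarrow> F (\<tau> + 1) = F \<tau> + C"
    "\<And>y. y > 0 \<Longrightarrow> ((\<lambda>x. f (Complex x y)) has_integral C) {0..1}"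
proof -
  let ?H = "{\<tau>. Im \<tau> > 0}"
  have H: "convex ?H" "open ?H" by (rule convex_halfspace_Im_gt, rule open_halfspace_Im_gt)
  obtain F where F0: "\<And>\<tau>. \<tau> \<in> ?H \<Longrightarrow> (F has_field_derivative f \<tau>) (at \<tau> within ?H)"
    using holomorphic_convex_primitive'[OF H hol] by blast
  have F: "(F has_field_derivative f \<tau>) (at \<tau>)" if "Im \<tau> > 0" for \<tau>
    using F0[of \<tau>] that at_within_open[OF _ H(2), of \<tau>] by simp
  have "\<exists>C. \<forall>\<tau>\<in>?H. F (\<tau> + 1) - F \<tau> = C"
  proof (rule has_field_derivative_zero_constant[OF H(1)])
    fix \<tau> assume "\<tau> \<in> ?H"
    hence \<tau>: "Im \<tau> > 0" "Im (\<tau> + 1) > 0" by auto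
    have "((\<lambda>\<tau>. F (\<tau> + 1)) has_field_derivative f (\<tau> + 1)) (at \<tau>)"
      using F[OF \<tau>(2)] by (simp add: DERIV_shift)
    from DERIV_diff[OF this F[OF \<tau>(1)]] have "((\<lambda>\<tau>. F (\<tau> + 1) - F \<tau>) has_field_derivative 0) (at \<tau>)"
      using per[OF \<tau>(1)] by simp
    thus "((\<lambda>\<tau>. F (\<tau> + 1) - F \<tau>) has_field_derivative 0) (at \<tau> within ?H)"
      by (rule has_field_derivative_at_within)
  qed
  then obtain C where C: "\<And>\<tau>. Im \<tau> > 0 \<Longrightarrow> F (\<tau> + 1) - F \<tau> = C" by blast
  have "((\<lambda>x. f (Complex x y)) has_integral C) {0..1}" if y: "y > 0" for y
  proof -
    have "((\<lambda>x. f (Complex x y)) has_integral (F (Complex 1 y) - F (Complex 0 y))) {0..1}"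
    proof (rule fundamental_theorem_of_calculus)
      fix x :: real
      have "((\<lambda>x. Complex x y) has_vector_derivative 1) (at x within {0..1})"
        unfolding Complex_eq by (auto intro!: derivative_eq_intros)
      moreover have "(F has_field_derivative f (Complex x y)) (at (Complex x y))" using y by (intro F) simp
      ultimately have "((F \<circ> (\<lambda>x. Complex x y)) has_vector_derivative 1 * f (Complex x y)) (at x within {0..1})"
        by (rule field_vector_diff_chain_within[OF _ has_field_derivative_at_within])
      thus "((\<lambda>x. F (Complex x y)) has_vector_derivative f (Complex x y)) (at x within {0..1})"
        by (simp add: o_def)
    qed simp
    moreover have "Complex 1 y = Complex 0 y + 1" by (simp add: complex_eq_iff)
    hence "F (Complex 1 y) - F (Complex 0 y) = C" using C[of "Complex 0 y"] y by simp
    ultimately show ?thesis by simp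
  qed
  moreover have "F (\<tau> + 1) = F \<tau> + C" if "Im \<tau> > 0" for \<tau> using C[OF that] by (simp add: algebra_simps)
  ultimately show ?thesis using F that[of F C] by blast
qed

text \<open>A primitive of a weight two form is invariant under the inversion, because the constant of
  integration vanishes at the fixed point \<open>\<i>\<close>. The elliptic point \<open>\<rho>\<close> of order three is moved in the same
  way by the inversion and by the translation, so the period of the primitive vanishes too.\<close>

theorem weight_2_constant_term:
  assumes hol: "f holomorphic_on {\<tau>. Im \<tau> > 0}"
    and T: "\<And>\<tau>. Im \<tau> > 0 \<Longrightarrow> f (\<tau> + 1) = f \<tau>" and S: "\<And>\<tau>. Im \<tau> > 0 \<Longrightarrow> f (- 1 / \<tau>) = \<tau>^2 * f \<tau>"
    and y: "y > 0"
  shows "((\<lambda>x. f (Complex x y)) has_integral 0) {0..1}"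
proof -
  let ?H = "{\<tau>. Im \<tau> > 0}"
  obtain F C where F: "\<And>\<tau>. Im \<tau> > 0 \<Longrightarrow> (F has_field_derivative f \<tau>) (at \<tau>)" "\<And>\<tau>. Im \<tau> > 0 \<Longrightarrow> F (\<tau> + 1) = F \<tau> + C"
    "\<And>y. y > 0 \<Longrightarrow> ((\<lambda>x. f (Complex x y)) has_integral C) {0..1}"
    using period_integral_primitive[OF hol T] by blast
  have ImS: "Im (- 1 / \<tau>) > 0" if "Im \<tau> > 0" for \<tau>
    using that by (auto simp: Im_divide intro!: divide_pos_pos add_nonneg_pos)
  have "\<exists>c. \<forall>\<tau>\<in>?H. F (- 1 / \<tau>) - F \<tau> = c"
  proof (rule has_field_derivative_zero_constant)
    show "convex ?H" by (rule convex_halfspace_Im_gt)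
    fix \<tau> assume "\<tau> \<in> ?H"
    hence \<tau>: "Im \<tau> > 0" "\<tau> \<noteq> 0" by auto
    have "((\<lambda>t. - 1 / t) has_field_derivative 1 / \<tau>^2) (at \<tau>)"
      using \<tau> by (auto intro!: derivative_eq_intros simp: power2_eq_square)
    from DERIV_diff[OF DERIV_chain2[OF F(1)[OF ImS[OF \<tau>(1)]] this] F(1)[OF \<tau>(1)]]
    have "((\<lambda>\<tau>. F (- 1 / \<tau>) - F \<tau>) has_field_derivative 0) (at \<tau>)"
      using S[OF \<tau>(1)] \<tau> by simp
    thus "((\<lambda>\<tau>. F (- 1 / \<tau>) - F \<tau>) has_field_derivative 0) (at \<tau> within ?H)"
      by (rule has_field_derivative_at_within)
  qed
  then obtain c where c: "\<And>\<tau>. Im \<tau> > 0 \<Longrightarrow> F (- 1 / \<tau>) - F \<tau> = c" by blast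
  have "- 1 / \<i> = \<i>" by (simp add: complex_eq_iff Re_divide Im_divide)
  hence "c = 0" using c[of \<i>] by simp
  define \<rho> where "\<rho> = Complex (- 1 / 2) (sqrt 3 / 2)"
  have \<rho>: "Im \<rho> > 0" by (simp add: \<rho>_def)
  have "\<rho> * (\<rho> + 1) = - 1" by (simp add: \<rho>_def complex_eq_iff)
  moreover have "\<rho> * (\<rho> + 1) / \<rho> = \<rho> + 1" using \<rho> by (intro nonzero_mult_div_cancel_left) auto
  ultimately have "- 1 / \<rho> = \<rho> + 1" by (simp only:)
  hence "F (\<rho> + 1) = F \<rho>" using c[OF \<rho>] \<open>c = 0\<close> by simp
  hence "C = 0" using F(2)[OF \<rho>] by simp
  thus ?thesis using F(3)[OF y] by simp
qed

section \<open>The Poincare series as an eta power times a weight two form\<close>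

text \<open>The generating function of the \<open>r\<close>-coloured partitions.\<close>

definition part_gf :: "nat \<Rightarrow> complex \<Rightarrow> complex" where
  "part_gf r q = inverse (euler_prod q) ^ r"

text \<open>This is \<open>q^m / \<eta>^r\<close>, the seed of the form of weight two. It is periodic because its exponents are
  integers.\<close>

definition pole_fun :: "nat \<Rightarrow> nat \<Rightarrow> complex \<Rightarrow> complex" where
  "pole_fun r n \<tau> = qpow (- real n) \<tau> * part_gf r (qpow 1 \<tau>)"

definition poincare_term :: "real \<Rightarrow> real \<Rightarrow> int^2^2 \<Rightarrow> complex \<Rightarrow> complex" where
  "poincare_term k m M \<tau> = cpow (eta_mult M) (- 24 * m) * cpow (aut_factor M \<tau>) (- k) * qpow m (moebius M \<tau>)"

lemma qpow_periodic: "qpow (of_int a) (\<tau> + of_int b) = qpow (of_int a) \<tau>"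
  using qpow_of_int_of_int[of a b] by (simp add: qpow_add_arg)

lemma nome_periodic: "qpow 1 (\<tau> + of_int b) = qpow 1 \<tau>"
  using qpow_periodic[of 1 \<tau> b] by simp

lemma pole_fun_periodic: "pole_fun r n (\<tau> + of_int b) = pole_fun r n \<tau>"
  using qpow_periodic[of "- int n" \<tau> b] by (simp add: pole_fun_def nome_periodic)

lemma holomorphic_part_gf: "part_gf r holomorphic_on ball 0 1"
  unfolding part_gf_def[abs_def] using euler_prod_nonzero by (intro holomorphic_intros) auto

lemma holomorphic_part_gf_nome: "(\<lambda>\<tau>. part_gf r (qpow 1 \<tau>)) holomorphic_on {\<tau>. Im \<tau> > 0}"
proof -
  have "(\<lambda>\<tau>. qpow 1 \<tau>) holomorphic_on {\<tau>. Im \<tau> > 0}" by (intro holomorphic_intros)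
  moreover have "qpow 1 ` {\<tau>. Im \<tau> > 0} \<subseteq> ball 0 1" by (auto simp: norm_nome_less_1)
  ultimately have "(part_gf r \<circ> qpow 1) holomorphic_on {\<tau>. Im \<tau> > 0}"
    by (rule holomorphic_on_compose_gen[OF _ holomorphic_part_gf])
  thus ?thesis by (simp only: o_def)
qed

lemma holomorphic_pole_fun: "pole_fun r n holomorphic_on {\<tau>. Im \<tau> > 0}"
  unfolding pole_fun_def[abs_def] by (intro holomorphic_intros holomorphic_part_gf_nome)

lemma dedekind_eta_power: "dedekind_eta \<tau> ^ r = qpow (real r / 24) \<tau> * euler_prod (qpow 1 \<tau>) ^ r"
proof -
  have "qpow (1/24) \<tau> ^ r = qpow (real r / 24) \<tau>"
    by (simp add: qpow_def mult_ac flip: exp_of_nat_mult)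
  thus ?thesis by (simp add: dedekind_eta_eq power_mult_distrib)
qed

lemma qpow_eq_pole_fun:
  assumes "Im \<tau> > 0"
  shows "qpow (real r / 24 - real n) \<tau> = pole_fun r n \<tau> * dedekind_eta \<tau> ^ r"
proof -
  have "qpow (real r / 24 - real n) \<tau> = qpow (- real n) \<tau> * qpow (real r / 24) \<tau>"
    by (simp flip: qpow_add)
  thus ?thesis using euler_prod_nonzero[OF norm_nome_less_1[OF assms]]
    by (simp add: dedekind_eta_power pole_fun_def part_gf_def power_inverse)
qed

text \<open>The transformation law gives \<open>\<eta>(M\<tau>)^r = v^r s^r \<eta>(\<tau>)^r\<close> with \<open>s\<^sup>2 = c\<tau> + d\<close>. As \<open>v^24 = 1\<close>, the factor \<open>v^(-24m)\<close> is \<open>v^(-r)\<close>, and of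
  \<open>(c\<tau> + d)^(-k) = s^(-4-r)\<close> only \<open>(c\<tau> + d)^(-2)\<close> remains.\<close>

lemma poincare_term_eq:
  assumes M: "M \<in> carrier SL2Z" and \<tau>: "Im \<tau> > 0"
  shows "poincare_term (2 + real r / 2) (real r / 24 - real n) M \<tau> =
           dedekind_eta \<tau> ^ r * (pole_fun r n (moebius M \<tau>) / aut_factor M \<tau> ^ 2)"
proof -
  define v s J h where "v = eta_mult M" and "s = cpow (aut_factor M \<tau>) (1/2)" and "J = aut_factor M \<tau>" and "h = dedekind_eta \<tau>"
  have v24: "v ^ 24 = 1" unfolding v_def by (rule eta_mult_power_24[OF M])
  have nz: "v \<noteq> 0" "J \<noteq> 0" "s \<noteq> 0" "h \<noteq> 0"
    using v24 aut_factor_nonzero[OF M \<tau>] dedekind_eta_nonzero[OF \<tau>] by (auto simp: J_def s_def h_def)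
  have "- 24 * (real r / 24 - real n) = of_int (24 * int n - int r)" by simp
  hence "cpow v (- 24 * (real r / 24 - real n)) = v powi (24 * int n - int r)"
    using cpow_of_int[OF nz(1)] by metis
  also have "\<dots> = v powi int (24 * n) / v powi int r"
    using nz by (simp add: power_int_diff)
  also have "v powi int (24 * n) = 1" by (simp only: power_int_of_nat power_mult v24 power_one)
  finally have c1: "cpow v (- 24 * (real r / 24 - real n)) = 1 / v ^ r" by simp
  have s2: "s ^ 2 = J" unfolding s_def J_def[symmetric] by (rule cpow_half_squared[OF nz(2)])
  have "- (2 + real r / 2) = of_int (- int (4 + r)) * (1/2)" by simp
  hence "cpow J (- (2 + real r / 2)) = s powi (- int (4 + r))"
    using cpow_mult_int[OF nz(2), of "- int (4 + r)" "1/2"] unfolding s_def J_def by metis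
  also have "\<dots> = inverse (s ^ (4 + r))" by (simp only: power_int_minus power_int_of_nat)
  also have "s ^ (4 + r) = J^2 * s ^ r" by (simp add: power_add s2[symmetric] flip: power_mult)
  finally have c2: "cpow J (- (2 + real r / 2)) = inverse (J^2 * s ^ r)" .
  have c3: "qpow (real r / 24 - real n) (moebius M \<tau>) = pole_fun r n (moebius M \<tau>) * (v * s * h) ^ r"
    using qpow_eq_pole_fun[OF Im_moebius_pos[OF M \<tau>]] dedekind_eta_moebius[OF M \<tau>] by (simp add: v_def s_def h_def)
  show ?thesis
    unfolding poincare_term_def c3 v_def[symmetric] J_def[symmetric] c1 c2 h_def[symmetric]
    using nz by (simp add: power_mult_distrib field_simps)
qed

lemma norm_eta_mult:
  assumes "M \<in> carrier SL2Z" shows "norm (eta_mult M) = 1"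
proof -
  have "norm (eta_mult M) ^ 24 = 1 ^ 24" using eta_mult_power_24[OF assms] by (simp flip: norm_power)
  thus ?thesis by (rule power_eq_imp_eq_base) auto
qed

lemma norm_poincare_term:
  assumes "M \<in> carrier SL2Z"
  shows "norm (poincare_term k m M \<tau>) = norm (aut_factor M \<tau>) powr - k * exp (- 2 * pi * m * Im (moebius M \<tau>))"
  using norm_eta_mult[OF assms] by (simp add: poincare_term_def norm_mult norm_cpow norm_qpow)

locale partition_data =
  fixes r n :: nat
  assumes r: "1 \<le> r" "r \<le> 24" and n: "n > 0"
begin

abbreviation wt :: real where "wt \<equiv> 2 + real r / 2"
abbreviation ord :: real where "ord \<equiv> real r / 24 - real n"

lemma ord_nonpos: "ord \<le> 0" and wt_ge: "wt \<ge> 5/2"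
  using r n by auto

text \<open>The part of the Poincare series that comes from the cosets other than the one of the identity.\<close>

definition tail :: "complex \<Rightarrow> complex" where
  "tail \<tau> = (\<Sum>\<^sub>\<infinity>p\<in>cusp_rows. poincare_term wt ord (lower_row_matrix (fst p) (snd p)) \<tau>)"

lemma cusp_rowsD:
  assumes "p \<in> cusp_rows"
  shows "fst p > 0" "lower_row_matrix (fst p) (snd p) \<in> carrier SL2Z"
    "aut_factor (lower_row_matrix (fst p) (snd p)) \<tau> = of_int (fst p) * \<tau> + of_int (snd p)" "p \<noteq> (0,0)"
  using assms lower_row_matrix[of "fst p" "snd p"] by (auto simp: cusp_rows_def aut_factor_def)

text \<open>For \<open>c \<ge> 1\<close> the imaginary part of \<open>M\<tau>\<close> is at most \<open>1 / Im \<tau>\<close>; hence the exponential, although it grows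
  at the cusp, is bounded.\<close>

lemma norm_poincare_term_le_linear_form:
  assumes p: "p \<in> cusp_rows" and \<tau>: "Im \<tau> > 0"
  shows "norm (poincare_term wt ord (lower_row_matrix (fst p) (snd p)) \<tau>) \<le>
          exp (2 * pi * \<bar>ord\<bar> / Im \<tau>) * norm (of_int (fst p) * \<tau> + of_int (snd p)) powr - wt"
proof -
  define M where "M = lower_row_matrix (fst p) (snd p)"
  have M: "M \<in> carrier SL2Z" using cusp_rowsD[OF p] by (simp add: M_def)
  define J where "J = of_int (fst p) * \<tau> + of_int (snd p)"
  have J: "aut_factor M \<tau> = J" using cusp_rowsD(3)[OF p] by (simp add: M_def J_def)
  have "1 * Im \<tau> \<le> of_int (fst p) * Im \<tau>" using cusp_rowsD(1)[OF p] \<tau> by (intro mult_right_mono) auto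
  also have "\<dots> = Im J" by (simp add: J_def)
  also have "\<dots> \<le> norm J" using abs_Im_le_cmod[of J] by linarith
  finally have "(Im \<tau>)^2 \<le> norm J ^ 2" using \<tau> by (intro power_mono) auto
  hence "Im (moebius M \<tau>) \<le> Im \<tau> / (Im \<tau>)^2"
    unfolding Im_moebius[OF M] J using \<tau> by (intro divide_left_mono mult_pos_pos) (auto intro: less_le_trans[of 0 "(Im \<tau>)^2"])
  hence "Im (moebius M \<tau>) \<le> 1 / Im \<tau>" using \<tau> by (simp add: power2_eq_square)
  hence "\<bar>ord\<bar> * Im (moebius M \<tau>) \<le> \<bar>ord\<bar> * (1 / Im \<tau>)" by (intro mult_left_mono) auto
  hence "2 * pi * (\<bar>ord\<bar> * Im (moebius M \<tau>)) \<le> 2 * pi * (\<bar>ord\<bar> * (1 / Im \<tau>))" by (rule mult_left_mono) simp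
  moreover have "\<bar>ord\<bar> = - ord" using ord_nonpos by (rule abs_of_nonpos)
  hence "- 2 * pi * ord * Im (moebius M \<tau>) = 2 * pi * (\<bar>ord\<bar> * Im (moebius M \<tau>))" by (simp only: mult_minus_left mult_minus_right mult.assoc)
  moreover have "2 * pi * (\<bar>ord\<bar> * (1 / Im \<tau>)) = 2 * pi * \<bar>ord\<bar> / Im \<tau>" by simp
  ultimately have "- 2 * pi * ord * Im (moebius M \<tau>) \<le> 2 * pi * \<bar>ord\<bar> / Im \<tau>" by (simp only:)
  hence "exp (- 2 * pi * ord * Im (moebius M \<tau>)) \<le> exp (2 * pi * \<bar>ord\<bar> / Im \<tau>)" by simp
  hence "norm J powr - wt * exp (- 2 * pi * ord * Im (moebius M \<tau>)) \<le> norm J powr - wt * exp (2 * pi * \<bar>ord\<bar> / Im \<tau>)"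
    by (intro mult_left_mono) auto
  thus ?thesis unfolding M_def[symmetric] norm_poincare_term[OF M] J J_def[symmetric] by (simp only: mult.commute)
qed

lemma norm_poincare_term_le:
  assumes p: "p \<in> cusp_rows" and \<tau>: "Im \<tau> \<ge> \<epsilon>" "norm \<tau> \<le> A" "\<epsilon> > 0"
  shows "norm (poincare_term wt ord (lower_row_matrix (fst p) (snd p)) \<tau>) \<le>
    exp (2 * pi * \<bar>ord\<bar> / \<epsilon>) * (\<epsilon> / (2 * (1 + \<epsilon> + A))) powr - wt * (1 + real_of_int \<bar>fst p\<bar> + real_of_int \<bar>snd p\<bar>) powr - wt"
proof -
  have "norm (poincare_term wt ord (lower_row_matrix (fst p) (snd p)) \<tau>) \<le>
          exp (2 * pi * \<bar>ord\<bar> / Im \<tau>) * norm (of_int (fst p) * \<tau> + of_int (snd p)) powr - wt"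
    using \<tau> by (intro norm_poincare_term_le_linear_form p) auto
  also have "\<dots> \<le> exp (2 * pi * \<bar>ord\<bar> / \<epsilon>) * ((\<epsilon> / (2 * (1 + \<epsilon> + A))) powr - wt * (1 + real_of_int \<bar>fst p\<bar> + real_of_int \<bar>snd p\<bar>) powr - wt)"
    using \<tau> cusp_rowsD(4)[OF p]
    by (intro mult_mono norm_linear_form_powr_le) (auto intro!: divide_left_mono mult_pos_pos simp: prod_eq_iff)
  finally show ?thesis by (simp only: mult.assoc)
qed

lemma summable_on_majorant: "(\<lambda>p. C * (1 + real_of_int \<bar>fst p\<bar> + real_of_int \<bar>snd p\<bar>) powr - wt) summable_on cusp_rows"
  using summable_on_subset[OF summable_on_lattice_powr[of wt], of cusp_rows] wt_ge
  by (intro summable_on_cmult_right) (simp add: case_prod_unfold)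

lemma uniform_limit_tail:
  assumes "\<epsilon> > 0" "\<And>\<tau>. \<tau> \<in> K \<Longrightarrow> Im \<tau> \<ge> \<epsilon> \<and> norm \<tau> \<le> A"
  shows "uniform_limit K (\<lambda>X \<tau>. \<Sum>p\<in>X. poincare_term wt ord (lower_row_matrix (fst p) (snd p)) \<tau>) tail (finite_subsets_at_top cusp_rows)"
  unfolding tail_def[abs_def]
  by (rule Weierstrass_m_test_general[OF norm_poincare_term_le summable_on_majorant]) (use assms in auto)

lemma has_sum_tail:
  assumes "Im \<tau> > 0"
  shows "((\<lambda>p. poincare_term wt ord (lower_row_matrix (fst p) (snd p)) \<tau>) has_sum tail \<tau>) cusp_rows"
  unfolding tail_def
proof (rule has_sum_infsum, rule abs_summable_summable, rule summable_on_comparison_test[OF summable_on_majorant])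
  fix p assume "p \<in> cusp_rows"
  from norm_poincare_term_le[OF this, of "Im \<tau>" \<tau> "norm \<tau>"] assms
  show "norm (poincare_term wt ord (lower_row_matrix (fst p) (snd p)) \<tau>) \<le>
    (exp (2 * pi * \<bar>ord\<bar> / Im \<tau>) * (Im \<tau> / (2 * (1 + Im \<tau> + norm \<tau>))) powr - wt) * (1 + real_of_int \<bar>fst p\<bar> + real_of_int \<bar>snd p\<bar>) powr - wt"
    by simp
qed auto

lemma holomorphic_poincare_term:
  assumes M: "M \<in> carrier SL2Z"
  shows "poincare_term wt ord M holomorphic_on {\<tau>. Im \<tau> > 0}"
proof -
  have aut: "aut_factor M holomorphic_on {\<tau>. Im \<tau> > 0}"
    unfolding aut_factor_def[abs_def] by (intro holomorphic_intros)
  have "moebius M holomorphic_on {\<tau>. Im \<tau> > 0}"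
    unfolding moebius_def[abs_def] using aut_factor_nonzero[OF M] by (intro holomorphic_intros aut) auto
  hence comp: "(pole_fun r n \<circ> moebius M) holomorphic_on {\<tau>. Im \<tau> > 0}"
    using Im_moebius_pos[OF M] by (intro holomorphic_on_compose_gen[OF _ holomorphic_pole_fun]) auto
  have "(\<lambda>\<tau>. dedekind_eta \<tau> ^ r * (pole_fun r n (moebius M \<tau>) / aut_factor M \<tau> ^ 2)) holomorphic_on {\<tau>. Im \<tau> > 0}"
    using aut_factor_nonzero[OF M] comp[unfolded o_def] by (intro holomorphic_intros aut holomorphic_dedekind_eta) auto
  thus ?thesis by (rule holomorphic_transform) (simp add: poincare_term_eq[OF M])
qed

lemma holomorphic_tail: "tail holomorphic_on {\<tau>. Im \<tau> > 0}"
  unfolding holomorphic_on_def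
proof
  fix z assume "z \<in> {\<tau>. Im \<tau> > 0}"
  hence z: "Im z > 0" by simp
  define d where "d = Im z / 2"
  have d: "d > 0" using z by (simp add: d_def)
  have K: "Im \<tau> \<ge> d \<and> norm \<tau> \<le> norm z + d" if "\<tau> \<in> cball z d" for \<tau>
  proof -
    have "norm (z - \<tau>) \<le> d" using that by (simp add: dist_norm)
    thus ?thesis using abs_Im_le_cmod[of "z - \<tau>"] norm_triangle_ineq2[of \<tau> z] by (auto simp: d_def norm_minus_commute)
  qed
  have sub: "cball z d \<subseteq> {\<tau>. Im \<tau> > 0}" using K d by force
  have "tail holomorphic_on ball z d"
  proof (rule holomorphic_uniform_limit[OF _ uniform_limit_tail[OF d K]])
    show "\<forall>\<^sub>F X in finite_subsets_at_top cusp_rows.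
       continuous_on (cball z d) (\<lambda>\<tau>. \<Sum>p\<in>X. poincare_term wt ord (lower_row_matrix (fst p) (snd p)) \<tau>) \<and>
       (\<lambda>\<tau>. \<Sum>p\<in>X. poincare_term wt ord (lower_row_matrix (fst p) (snd p)) \<tau>) holomorphic_on ball z d"
    proof (rule eventually_finite_subsets_at_top_weakI)
      fix X assume X: "finite X" "X \<subseteq> cusp_rows"
      have "(\<lambda>\<tau>. \<Sum>p\<in>X. poincare_term wt ord (lower_row_matrix (fst p) (snd p)) \<tau>) holomorphic_on {\<tau>. Im \<tau> > 0}"
        using X by (intro holomorphic_on_sum holomorphic_poincare_term cusp_rowsD) auto
      hence "(\<lambda>\<tau>. \<Sum>p\<in>X. poincare_term wt ord (lower_row_matrix (fst p) (snd p)) \<tau>) holomorphic_on cball z d"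
        using sub holomorphic_on_subset by blast
      thus "continuous_on (cball z d) (\<lambda>\<tau>. \<Sum>p\<in>X. poincare_term wt ord (lower_row_matrix (fst p) (snd p)) \<tau>) \<and>
       (\<lambda>\<tau>. \<Sum>p\<in>X. poincare_term wt ord (lower_row_matrix (fst p) (snd p)) \<tau>) holomorphic_on ball z d"
        using holomorphic_on_imp_continuous_on holomorphic_on_subset[OF _ ball_subset_cball] by blast
    qed
  qed auto
  hence "tail field_differentiable at z" using d by (intro holomorphic_on_imp_differentiable_at[OF _ open_ball]) auto
  thus "tail field_differentiable at z within {\<tau>. Im \<tau> > 0}" by (rule field_differentiable_at_within)
qed

definition weight2_term :: "complex \<Rightarrow> int^2^2 \<Rightarrow> complex" where
  "weight2_term \<tau> M = pole_fun r n (moebius M \<tau>) / aut_factor M \<tau> ^ 2"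

lemma poincare_term_weight2:
  "M \<in> carrier SL2Z \<Longrightarrow> Im \<tau> > 0 \<Longrightarrow> poincare_term wt ord M \<tau> = dedekind_eta \<tau> ^ r * weight2_term \<tau> M"
  by (simp add: poincare_term_eq weight2_term_def)

text \<open>An upper triangular factor on the left shifts \<open>M\<tau>\<close> by an integer and changes the lower row by a
  sign, which the square does not see.\<close>

lemma Gamma_inf_invariant_weight2_term:
  assumes \<tau>: "Im \<tau> > 0"
  shows "Gamma_inf_invariant (weight2_term \<tau>)"
  unfolding Gamma_inf_invariant_def
proof (intro ballI)
  fix A M assume A: "A \<in> Gamma_inf" and M: "M \<in> carrier SL2Z"
  have A': "A \<in> carrier SL2Z" "a11 A * a22 A = 1" "a21 A = 0" using A by (auto simp: Gamma_inf_iff in_SL2Z_iff)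
  have "a11 A = 1 \<and> a22 A = 1 \<or> a11 A = -1 \<and> a22 A = -1" using A' by (simp add: zmult_eq_1_iff)
  hence "moebius A z = z + of_int (a11 A * a12 A)" "aut_factor A z ^ 2 = 1" for z
    using A' by (auto simp: moebius_def aut_factor_def)
  thus "weight2_term \<tau> (A ** M) = weight2_term \<tau> M"
    by (simp only: weight2_term_def moebius_mult[OF A'(1) M \<tau>] aut_factor_mult[OF M \<tau>] pole_fun_periodic power_mult_distrib mult_1)
qed

lemma weight2_term_cong:
  assumes "M \<in> carrier SL2Z" "N \<in> carrier SL2Z" "a21 M = a21 N" "a22 M = a22 N" "Im \<tau> > 0"
  shows "weight2_term \<tau> M = weight2_term \<tau> N"
proof -
  have "N \<in> Gamma_inf #>\<^bsub>SL2Z\<^esub> M" using assms by (simp add: mem_Gamma_inf_coset_iff)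
  then obtain A where "A \<in> Gamma_inf" "N = A ** M" by (auto simp: r_coset_def)
  thus ?thesis using Gamma_inf_invariant_weight2_term[OF assms(5)] assms(1) by (simp add: Gamma_inf_invariant_def)
qed

text \<open>The sum of \<open>weight2_term\<close> over all cosets, where the coset of the identity contributes \<open>pole_fun\<close>.\<close>

definition weight2_form :: "complex \<Rightarrow> complex" where
  "weight2_form \<tau> = pole_fun r n \<tau> + tail \<tau> / dedekind_eta \<tau> ^ r"

lemma has_sum_weight2_form:
  assumes \<tau>: "Im \<tau> > 0"
  shows "((\<lambda>C. weight2_term \<tau> (SOME M. M \<in> C)) has_sum weight2_form \<tau>) (rcosets\<^bsub>SL2Z\<^esub> Gamma_inf)"
proof -
  have nz: "dedekind_eta \<tau> ^ r \<noteq> 0" using dedekind_eta_nonzero[OF \<tau>] by simp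
  have "((\<lambda>p. 1 / dedekind_eta \<tau> ^ r * poincare_term wt ord (lower_row_matrix (fst p) (snd p)) \<tau>) has_sum (1 / dedekind_eta \<tau> ^ r * tail \<tau>)) cusp_rows"
    by (rule has_sum_cmult_right[OF has_sum_tail[OF \<tau>]])
  also have "?this \<longleftrightarrow> ((\<lambda>(c,d). weight2_term \<tau> (lower_row_matrix c d)) has_sum (tail \<tau> / dedekind_eta \<tau> ^ r)) cusp_rows"
  proof (rule has_sum_cong[THEN trans])
    fix p assume "p \<in> cusp_rows"
    thus "1 / dedekind_eta \<tau> ^ r * poincare_term wt ord (lower_row_matrix (fst p) (snd p)) \<tau> = (case p of (c,d) \<Rightarrow> weight2_term \<tau> (lower_row_matrix c d))"
      using nz by (simp add: poincare_term_weight2[OF cusp_rowsD(2) \<tau>] case_prod_unfold)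
  qed simp
  finally show ?thesis
    by (subst has_sum_cosets_iff[OF Gamma_inf_invariant_weight2_term[OF \<tau>]])
       (simp add: weight2_form_def weight2_term_def moebius_def aut_factor_def mat_1_nth_2)
qed

lemma coset_rep_in_SL2Z:
  assumes "C \<in> rcosets\<^bsub>SL2Z\<^esub> Gamma_inf"
  shows "(SOME M. M \<in> C) \<in> carrier SL2Z"
proof -
  obtain M where M: "M \<in> carrier SL2Z" "C = Gamma_inf #>\<^bsub>SL2Z\<^esub> M" using assms by (auto simp: RCOSETS_def)
  hence "M \<in> C" using SL2Z.rcos_self[OF _ subgroup_Gamma_inf] by simp
  hence "(SOME M. M \<in> C) \<in> C" by (rule someI)
  thus ?thesis using M mem_Gamma_inf_coset_iff by blast
qed

lemma poincare_series_eq: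
  assumes \<tau>: "Im \<tau> > 0"
  shows "poincare_series wt ord \<tau> = dedekind_eta \<tau> ^ r * weight2_form \<tau>"
    and "poincare_series wt ord \<tau> = qpow ord \<tau> + tail \<tau>"
proof -
  have "((\<lambda>C. dedekind_eta \<tau> ^ r * weight2_term \<tau> (SOME M. M \<in> C)) has_sum (dedekind_eta \<tau> ^ r * weight2_form \<tau>)) (rcosets\<^bsub>SL2Z\<^esub> Gamma_inf)"
    by (rule has_sum_cmult_right[OF has_sum_weight2_form[OF \<tau>]])
  also have "?this \<longleftrightarrow> ((\<lambda>C. poincare_term wt ord (SOME M. M \<in> C) \<tau>) has_sum (dedekind_eta \<tau> ^ r * weight2_form \<tau>)) (rcosets\<^bsub>SL2Z\<^esub> Gamma_inf)"
    by (rule has_sum_cong) (simp add: poincare_term_weight2[OF coset_rep_in_SL2Z \<tau>])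
  finally show eq: "poincare_series wt ord \<tau> = dedekind_eta \<tau> ^ r * weight2_form \<tau>"
    unfolding poincare_series_def Let_def poincare_term_def by (rule infsumI)
  show "poincare_series wt ord \<tau> = qpow ord \<tau> + tail \<tau>"
    unfolding eq weight2_form_def qpow_eq_pole_fun[OF \<tau>] using dedekind_eta_nonzero[OF \<tau>] by (simp add: algebra_simps)
qed

lemma weight2_form_modular:
  assumes N: "N \<in> carrier SL2Z" and \<tau>: "Im \<tau> > 0"
  shows "weight2_form (moebius N \<tau>) = aut_factor N \<tau> ^ 2 * weight2_form \<tau>"
proof -
  have \<tau>': "Im (moebius N \<tau>) > 0" by (rule Im_moebius_pos[OF N \<tau>])
  have "((\<lambda>C. weight2_term \<tau> ((SOME M. M \<in> C) ** N)) has_sum weight2_form \<tau>) (rcosets\<^bsub>SL2Z\<^esub> Gamma_inf)"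
    using has_sum_weight2_form[OF \<tau>] has_sum_cosets_translate[OF Gamma_inf_invariant_weight2_term[OF \<tau>] N] by blast
  hence "((\<lambda>C. aut_factor N \<tau> ^ 2 * weight2_term \<tau> ((SOME M. M \<in> C) ** N)) has_sum (aut_factor N \<tau> ^ 2 * weight2_form \<tau>)) (rcosets\<^bsub>SL2Z\<^esub> Gamma_inf)"
    by (rule has_sum_cmult_right)
  also have "?this \<longleftrightarrow> ((\<lambda>C. weight2_term (moebius N \<tau>) (SOME M. M \<in> C)) has_sum (aut_factor N \<tau> ^ 2 * weight2_form \<tau>)) (rcosets\<^bsub>SL2Z\<^esub> Gamma_inf)"
    using aut_factor_nonzero[OF N \<tau>]
    by (intro has_sum_cong)
       (simp add: weight2_term_def moebius_mult[OF coset_rep_in_SL2Z N \<tau>] aut_factor_mult[OF N \<tau>] power_mult_distrib)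
  finally show ?thesis using has_sum_weight2_form[OF \<tau>'] has_sum_unique by blast
qed

lemma holomorphic_weight2_form: "weight2_form holomorphic_on {\<tau>. Im \<tau> > 0}"
  unfolding weight2_form_def[abs_def]
  by (intro holomorphic_intros holomorphic_pole_fun holomorphic_tail holomorphic_dedekind_eta)
     (simp add: dedekind_eta_nonzero)

lemma weight2_form_T:
  assumes "Im \<tau> > 0" shows "weight2_form (\<tau> + of_int b) = weight2_form \<tau>"
  using weight2_form_modular[of "mat2 1 b 0 1", OF _ assms] by (simp add: in_SL2Z_iff moebius_def aut_factor_def)

lemma weight2_form_constant_term:
  assumes "y > 0"
  shows "((\<lambda>x. weight2_form (Complex x y)) has_integral 0) {0..1}"
proof (rule weight_2_constant_term[OF holomorphic_weight2_form _ _ assms])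
  fix \<tau> assume \<tau>: "Im \<tau> > 0"
  show "weight2_form (\<tau> + 1) = weight2_form \<tau>" using weight2_form_T[OF \<tau>, of 1] by simp
  show "weight2_form (- 1 / \<tau>) = \<tau>^2 * weight2_form \<tau>"
    using weight2_form_modular[of "mat2 0 (-1) 1 0", OF _ \<tau>] by (simp add: in_SL2Z_iff moebius_def aut_factor_def)
qed

end

section \<open>The partition number as a Fourier coefficient\<close>

lemma integrable_on_period:
  assumes "f holomorphic_on {\<tau>. Im \<tau> > 0}" "y > 0"
  shows "(\<lambda>x. f (Complex x y)) integrable_on {0..1::real}"
proof (rule integrable_continuous_real)
  show "continuous_on {0..1} (\<lambda>x. f (Complex x y))"
    by (rule continuous_on_compose2[OF holomorphic_on_imp_continuous_on[OF assms(1)]])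
       (use assms(2) in \<open>auto simp: Complex_eq intro!: continuous_intros\<close>)
qed

lemma part_gf_minus_1_bound:
  obtains B where "B \<ge> 0" "\<And>q. norm q \<le> 1/2 \<Longrightarrow> norm (part_gf r q - 1) \<le> B * norm q"
proof -
  have sub: "cball (0::complex) (1/2) \<subseteq> ball 0 1" by auto
  have "deriv (part_gf r) holomorphic_on ball 0 1"
    by (rule holomorphic_deriv[OF holomorphic_part_gf]) simp
  hence "continuous_on (cball 0 (1/2)) (deriv (part_gf r))"
    using sub holomorphic_on_imp_continuous_on continuous_on_subset by blast
  hence "bounded (deriv (part_gf r) ` cball 0 (1/2))"
    by (intro compact_imp_bounded compact_continuous_image) auto
  then obtain B where B: "\<And>q. q \<in> cball 0 (1/2) \<Longrightarrow> norm (deriv (part_gf r) q) \<le> B"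
    unfolding bounded_iff by blast
  have "B \<ge> 0" using order_trans[OF norm_ge_zero B[of 0]] by simp
  have "norm (part_gf r q - 1) \<le> B * norm q" if "norm q \<le> 1/2" for q
  proof -
    have "norm (part_gf r q - part_gf r 0) \<le> B * norm (q - 0)"
    proof (rule field_differentiable_bound[where S = "cball 0 (1/2)"])
      fix z :: complex assume z: "z \<in> cball 0 (1/2)"
      show "(part_gf r has_field_derivative deriv (part_gf r) z) (at z within cball 0 (1/2))"
        by (rule has_field_derivative_at_within[OF holomorphic_derivI[OF holomorphic_part_gf]]) (use z in auto)
      show "norm (deriv (part_gf r) z) \<le> B" by (rule B[OF z])
    qed (use that in auto)
    thus ?thesis by (simp add: part_gf_def)
  qed
  with \<open>B \<ge> 0\<close> show ?thesis by (rule that)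
qed

context partition_data
begin

abbreviation nu :: real where "nu \<equiv> real r / 24"

text \<open>Of the weight, at least \<open>5/2 = 9/4 + 1/4\<close>, the part \<open>9/4 > 2\<close> keeps the lattice sum convergent and the part
  \<open>1/4\<close> gives the decay.\<close>

lemma norm_tail_le:
  obtains D where "D \<ge> 0" "\<And>x y. 0 \<le> x \<Longrightarrow> x \<le> 1 \<Longrightarrow> 1 \<le> y \<Longrightarrow> norm (tail (Complex x y)) \<le> D * y powr - (1/4)"
proof -
  define e where "e = exp (2 * pi * \<bar>ord\<bar>)"
  define C where "C = (1 / (2 * (1 + 1 + 2))) powr - (9/4 :: real)"
  define L where "L = (\<lambda>p::int\<times>int. (1 + real_of_int \<bar>fst p\<bar> + real_of_int \<bar>snd p\<bar>) powr - (9/4))"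
  have "L summable_on UNIV"
    using summable_on_lattice_powr[of "9/4"] by (simp add: L_def case_prod_unfold)
  hence "L summable_on cusp_rows" by (rule summable_on_subset) auto
  then obtain T where T: "(L has_sum T) cusp_rows" by (auto simp: summable_on_def)
  have "T \<ge> 0" using T by (rule has_sum_nonneg) (auto simp: L_def)
  have "norm (tail (Complex x y)) \<le> (e * C * T) * y powr - (1/4)" if xy: "0 \<le> x" "x \<le> 1" "1 \<le> y" for x y
  proof -
    have "norm (tail (Complex x y)) \<le> (e * y powr - (1/4) * C) * T"
    proof (rule norm_infsum_le[OF has_sum_tail has_sum_cmult_right[OF T]])
      show "Im (Complex x y) > 0" using xy by simp
      fix p assume p: "p \<in> cusp_rows"
      \<comment> \<open>\<open>J'\<close> lives at height one and gives a majorant that does not depend on the height.\<close>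
      define J J' where "J = of_int (fst p) * Complex x y + of_int (snd p)" and "J' = of_int (fst p) * Complex x 1 + of_int (snd p)"
      have c: "real_of_int (fst p) \<ge> 1" using cusp_rowsD(1)[OF p] by linarith
      have "y \<le> of_int (fst p) * y" using c xy by simp
      also have "\<dots> = Im J" by (simp add: J_def)
      also have "\<dots> \<le> norm J" using abs_Im_le_cmod[of J] by linarith
      finally have Jy: "norm J \<ge> y" .
      have "1 * 1 \<le> y^2" using xy unfolding power2_eq_square by (intro mult_mono) auto
      hence "(of_int (fst p))^2 * 1 \<le> (of_int (fst p))^2 * y^2" by (intro mult_left_mono) auto
      hence "norm J' ^ 2 \<le> norm J ^ 2" unfolding cmod_power2 J_def J'_def by (simp add: power_mult_distrib)
      hence JJ': "norm J' \<le> norm J" by (rule power2_le_imp_le) simp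
      have "J' \<noteq> 0" using c by (auto simp: J'_def complex_eq_iff)
      have "norm (poincare_term wt ord (lower_row_matrix (fst p) (snd p)) (Complex x y)) \<le> exp (2 * pi * \<bar>ord\<bar> / y) * norm J powr - wt"
        using norm_poincare_term_le_linear_form[OF p, of "Complex x y"] xy by (simp add: J_def)
      also have "\<dots> \<le> e * (norm J powr - (1/4) * norm J powr - (9/4))"
      proof (rule mult_mono)
        have "2 * pi * \<bar>ord\<bar> / y \<le> 2 * pi * \<bar>ord\<bar> / 1" using xy by (intro divide_left_mono) auto
        thus "exp (2 * pi * \<bar>ord\<bar> / y) \<le> e" by (simp add: e_def)
        have "norm J powr - wt \<le> norm J powr - (5/2)" using Jy xy wt_ge by (intro powr_mono) auto
        also have "\<dots> = norm J powr - (1/4) * norm J powr - (9/4)" by (simp flip: powr_add)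
        finally show "norm J powr - wt \<le> norm J powr - (1/4) * norm J powr - (9/4)" .
      qed (auto simp: e_def)
      also have "norm J powr - (1/4) * norm J powr - (9/4) \<le> y powr - (1/4) * (C * L p)"
      proof (rule mult_mono)
        show "norm J powr - (1/4) \<le> y powr - (1/4)" using Jy xy by (intro powr_mono2') auto
        have "norm J powr - (9/4) \<le> norm J' powr - (9/4)" using JJ' \<open>J' \<noteq> 0\<close> by (intro powr_mono2') auto
        also have "norm (Complex x 1) \<le> 2" using norm_triangle_ineq[of "of_real x" \<i>] xy by (simp add: Complex_eq)
        hence "norm J' powr - (9/4) \<le> C * L p"
          unfolding J'_def C_def L_def using cusp_rowsD(4)[OF p]
          by (intro norm_linear_form_powr_le) (auto simp: prod_eq_iff)
        finally show "norm J powr - (9/4) \<le> C * L p" .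
      qed auto
      finally show "norm (poincare_term wt ord (lower_row_matrix (fst p) (snd p)) (Complex x y)) \<le> (e * y powr - (1/4) * C) * L p"
        by (simp add: e_def mult_ac)
    qed
    thus ?thesis by (simp only: mult_ac)
  qed
  moreover have "e * C * T \<ge> 0" using \<open>T \<ge> 0\<close> by (simp add: e_def C_def)
  ultimately show ?thesis using that by blast
qed

text \<open>In this normalisation the tail is periodic, and its constant term is the coefficient at \<open>q^\<nu>\<close>.\<close>

definition reduced_tail :: "complex \<Rightarrow> complex" where
  "reduced_tail \<tau> = tail \<tau> * qpow (- nu) \<tau>"

lemma reduced_tail_eq:
  assumes "Im \<tau> > 0"
  shows "reduced_tail \<tau> = (weight2_form \<tau> - pole_fun r n \<tau>) * euler_prod (qpow 1 \<tau>) ^ r"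
proof -
  have "weight2_form \<tau> - pole_fun r n \<tau> = tail \<tau> / (qpow nu \<tau> * euler_prod (qpow 1 \<tau>) ^ r)"
    by (simp add: weight2_form_def dedekind_eta_power)
  thus ?thesis using euler_prod_nonzero[OF norm_nome_less_1[OF assms]]
    by (simp add: reduced_tail_def qpow_minus field_simps)
qed

lemma holomorphic_reduced_tail: "reduced_tail holomorphic_on {\<tau>. Im \<tau> > 0}"
  unfolding reduced_tail_def[abs_def] by (intro holomorphic_intros holomorphic_tail)

lemma reduced_tail_periodic:
  assumes "Im \<tau> > 0"
  shows "reduced_tail (\<tau> + of_int b) = reduced_tail \<tau>"
  using assms by (simp add: reduced_tail_eq weight2_form_T pole_fun_periodic nome_periodic)

text \<open>The three summands contribute to the constant term the number of partitions, the Fourier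
  coefficient and zero.\<close>

lemma weight2_form_eq:
  assumes "Im \<tau> > 0"
  shows "weight2_form \<tau> = pole_fun r n \<tau> + reduced_tail \<tau> + reduced_tail \<tau> * (part_gf r (qpow 1 \<tau>) - 1)"
  using euler_prod_nonzero[OF norm_nome_less_1[OF assms]]
  by (simp add: reduced_tail_eq[OF assms] part_gf_def power_inverse field_simps)

text \<open>The integral over a period does not depend on the height. At large height the tail tends to zero,
  while the product of \<open>q^(-\<nu>)\<close> with the partitions of positive numbers is bounded, because \<open>\<nu> \<le> 1\<close>.\<close>

lemma reduced_tail_higher_part_integral:
  assumes "y > 0"
  shows "((\<lambda>x. reduced_tail (Complex x y) * (part_gf r (qpow 1 (Complex x y)) - 1)) has_integral 0) {0..1}"
proof -
  define W where "W = (\<lambda>\<tau>. reduced_tail \<tau> * (part_gf r (qpow 1 \<tau>) - 1))"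
  have hol: "W holomorphic_on {\<tau>. Im \<tau> > 0}"
    unfolding W_def by (intro holomorphic_intros holomorphic_reduced_tail holomorphic_part_gf_nome)
  have per: "W (\<tau> + 1) = W \<tau>" if "Im \<tau> > 0" for \<tau>
    using reduced_tail_periodic[OF that, of 1] nome_periodic[of \<tau> 1] by (simp add: W_def)
  obtain F C where "\<And>\<tau>. Im \<tau> > 0 \<Longrightarrow> (F has_field_derivative W \<tau>) (at \<tau>)" "\<And>\<tau>. Im \<tau> > 0 \<Longrightarrow> F (\<tau> + 1) = F \<tau> + C"
    and C: "\<And>y. y > 0 \<Longrightarrow> ((\<lambda>x. W (Complex x y)) has_integral C) {0..1}"
    using period_integral_primitive[OF hol per] by blast
  obtain D where D: "D \<ge> 0" "\<And>x y. 0 \<le> x \<Longrightarrow> x \<le> 1 \<Longrightarrow> 1 \<le> y \<Longrightarrow> norm (tail (Complex x y)) \<le> D * y powr - (1/4)"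
    using norm_tail_le by blast
  obtain B where B: "B \<ge> 0" "\<And>q. norm q \<le> 1/2 \<Longrightarrow> norm (part_gf r q - 1) \<le> B * norm q"
    using part_gf_minus_1_bound by blast
  have "norm C \<le> D * y powr - (1/4) * B" if y: "y \<ge> 1" for y
  proof -
    have "norm C \<le> D * y powr - (1/4) * B * measure lborel (cbox 0 (1::real))"
    proof (rule has_integral_bound)
      show "((\<lambda>x. W (Complex x y)) has_integral C) (cbox 0 1)" using C[of y] y by simp
      fix x :: real assume x: "x \<in> cbox 0 1"
      define q where "q = qpow 1 (Complex x y)"
      have nq: "norm q = exp (- 2 * pi * y)" by (simp add: q_def norm_qpow)
      have "1 * 1 \<le> (2 * pi) * y" using pi_gt3 y by (intro mult_mono) auto
      hence "exp 1 \<le> exp (2 * pi * y)" by simp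
      moreover have "(1::real) + 1 \<le> exp 1" by (rule exp_ge_add_one_self)
      ultimately have "2 \<le> exp (2 * pi * y)" by linarith
      hence "norm q \<le> 1/2" by (simp add: nq exp_minus field_simps)
      have "norm (W (Complex x y)) = norm (tail (Complex x y)) * (exp (2 * pi * nu * y) * norm (part_gf r q - 1))"
        by (simp add: W_def reduced_tail_def norm_mult norm_qpow q_def)
      also have "\<dots> \<le> (D * y powr - (1/4)) * B"
      proof (rule mult_mono)
        show "norm (tail (Complex x y)) \<le> D * y powr - (1/4)" using D(2)[of x y] x y by simp
        have "exp (2 * pi * nu * y) * norm (part_gf r q - 1) \<le> exp (2 * pi * nu * y) * (B * norm q)"
          by (intro mult_left_mono B(2) \<open>norm q \<le> 1/2\<close>) auto
        also have "\<dots> = B * (exp (2 * pi * nu * y) * exp (- 2 * pi * y))" by (simp add: nq)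
        also have "\<dots> \<le> B * 1"
        proof (rule mult_left_mono)
          have "exp (2 * pi * nu * y) * exp (- 2 * pi * y) = exp (2 * pi * y * (nu - 1))"
            unfolding exp_add[symmetric] by (simp add: algebra_simps)
          also have "\<dots> \<le> 1" using r y by (simp add: mult_nonneg_nonpos)
          finally show "exp (2 * pi * nu * y) * exp (- 2 * pi * y) \<le> 1" .
        qed (rule B(1))
        finally show "exp (2 * pi * nu * y) * norm (part_gf r q - 1) \<le> B" by simp
      qed (use D(1) in auto)
      finally show "norm (W (Complex x y)) \<le> D * y powr - (1/4) * B" .
    qed (use D B in auto)
    thus ?thesis by simp
  qed
  moreover have "((\<lambda>y. y powr - (1/4)) \<longlongrightarrow> (0::real)) at_top" by real_asymp
  hence "((\<lambda>y. D * y powr - (1/4) * B) \<longlongrightarrow> D * 0 * B) at_top" by (intro tendsto_intros)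
  ultimately have "norm C \<le> D * 0 * B"
    by (intro tendsto_lowerbound[of "\<lambda>y. D * y powr - (1/4) * B" _ at_top]) (auto simp: eventually_at_top_linorder)
  hence "C = 0" by simp
  thus ?thesis using C[OF assms] by (simp add: W_def)
qed

lemma fourier_coeff_poincare_eq:
  assumes y: "y > 0"
  shows "fourier_coeff (poincare_series wt ord) y nu = integral {0..1} (\<lambda>x. reduced_tail (Complex x y))"
proof -
  have eq: "poincare_series wt ord (Complex x y) * qpow (- nu) (Complex x y) = qpow (- real n) (Complex x y) + reduced_tail (Complex x y)" for x
  proof -
    have "qpow ord (Complex x y) * qpow (- nu) (Complex x y) = qpow (- real n) (Complex x y)" by (simp flip: qpow_add)
    thus ?thesis using y by (simp add: poincare_series_eq(2) reduced_tail_def distrib_right)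
  qed
  have "integral {0..1} (\<lambda>x. qpow (- real n) (Complex x y)) = 0"
    using integral_period_power_series_coeff[of "\<lambda>_. 1" y n] y n by (simp add: higher_deriv_const)
  moreover have "(\<lambda>\<tau>. qpow (- real n) \<tau>) holomorphic_on {\<tau>. Im \<tau> > 0}" by (intro holomorphic_intros)
  ultimately show ?thesis unfolding fourier_coeff_def eq
    using integrable_on_period[OF _ y] holomorphic_reduced_tail by (subst integral_add) auto
qed

theorem num_color_partitions_eq_fourier_coeff:
  assumes y: "y > 0"
  shows "of_nat (num_color_partitions r n) = - fourier_coeff (poincare_series wt ord) y nu"
proof -
  have pole: "integral {0..1} (\<lambda>x. pole_fun r n (Complex x y)) = of_nat (num_color_partitions r n)"
    using integral_period_power_series_coeff[OF holomorphic_part_gf y, of r n] deriv_inverse_euler_prod_power[of n r]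
    by (simp add: pole_fun_def part_gf_def[abs_def] mult.commute)
  have "((\<lambda>x. pole_fun r n (Complex x y) + reduced_tail (Complex x y) + reduced_tail (Complex x y) * (part_gf r (qpow 1 (Complex x y)) - 1))
          has_integral (of_nat (num_color_partitions r n) + fourier_coeff (poincare_series wt ord) y nu + 0)) {0..1}"
    unfolding fourier_coeff_poincare_eq[OF y] pole[symmetric]
    by (intro has_integral_add reduced_tail_higher_part_integral y integrable_integral integrable_on_period
              holomorphic_pole_fun holomorphic_reduced_tail)
  moreover have "((\<lambda>x. pole_fun r n (Complex x y) + reduced_tail (Complex x y) + reduced_tail (Complex x y) * (part_gf r (qpow 1 (Complex x y)) - 1))
          has_integral 0) {0..1}"
    using weight2_form_constant_term[OF y] y by (simp add: weight2_form_eq)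
  ultimately have "of_nat (num_color_partitions r n) + fourier_coeff (poincare_series wt ord) y nu + 0 = 0"
    by (rule has_integral_unique)
  thus ?thesis by (simp add: add_eq_0_iff2)
qed

end

section \<open>Fourier coefficients by unfolding\<close>

lemma sum_integral_translates:
  fixes \<phi> :: "real \<Rightarrow> complex"
  assumes cont: "continuous_on UNIV \<phi>"
  shows "(\<Sum>j\<in>{0 - int N..<0 + int N}. integral {0..1} (\<lambda>x. \<phi> (x + of_int j))) = integral {- real N..real N} \<phi>"
proof (induction N)
  case (Suc N)
  have int: "\<phi> integrable_on {a..b}" for a b
    using continuous_on_subset[OF cont] by (intro integrable_continuous_real) auto
  have shift: "integral {0..1} (\<lambda>x. \<phi> (x + c)) = integral {c..1 + c} \<phi>" for c
    using integral_shift_real_ivl[of c c "1 + c" \<phi>] by simp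
  have "{0 - int (Suc N)..<0 + int (Suc N)} = insert (- int (Suc N)) (insert (int N) {0 - int N..<0 + int N})" by auto
  hence "(\<Sum>j\<in>{0 - int (Suc N)..<0 + int (Suc N)}. integral {0..1} (\<lambda>x. \<phi> (x + of_int j))) =
          integral {- real (Suc N)..- real N} \<phi> + (integral {real N..real (Suc N)} \<phi> + integral {- real N..real N} \<phi>)"
    using Suc by (simp add: shift add_ac)
  also have "\<dots> = integral {- real (Suc N)..- real N} \<phi> + integral {- real N..real (Suc N)} \<phi>"
    using Henstock_Kurzweil_Integration.integral_combine[OF _ _ int, of "- real N" "real N" "real (Suc N)"] by (simp add: add_ac)
  also have "\<dots> = integral {- real (Suc N)..real (Suc N)} \<phi>"
    by (rule Henstock_Kurzweil_Integration.integral_combine[OF _ _ int]) auto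
  finally show ?case .
qed simp

text \<open>Up to a constant every term of the Poincare series times \<open>q^(-\<nu>)\<close> has this shape in the variable
  \<open>w = -\<i> (\<tau> + d/c)\<close>.\<close>

definition bessel_kernel :: "real \<Rightarrow> real \<Rightarrow> real \<Rightarrow> complex \<Rightarrow> complex" where
  "bessel_kernel s \<mu> V w = w powr - of_real s * exp (of_real \<mu> / w) * exp (of_real V * w)"

text \<open>Expanding \<open>exp (\<mu> / w)\<close> reduces the integral to Laplace inversions of powers.\<close>

lemma
  assumes s: "s \<ge> 2" and a: "a > 0" and V: "V > 0" and \<mu>: "\<mu> \<ge> 0"
  shows integrable_bessel_kernel: "integrable lborel (\<lambda>x. bessel_kernel s \<mu> V (Complex a x))"
    and sums_bessel_kernel: "(\<lambda>j. of_real (\<mu> ^ j / fact j * (2 * pi * V powr (s + real j - 1) * rGamma (s + real j)))) sums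
           (LINT x|lborel. bessel_kernel s \<mu> V (Complex a x))"
proof -
  define w where "w = (\<lambda>x. Complex a x)"
  have w: "w x \<noteq> 0" "norm (w x) \<ge> a" for x
    using a abs_Re_le_cmod[of "w x"] by (auto simp: w_def complex_eq_iff)
  have [simp]: "Re (w x) = a" for x by (simp add: w_def)
  define f where "f = (\<lambda>j x. (of_real \<mu> / w x) ^ j / fact j * (w x powr - of_real s * exp (of_real V * w x)))"
  have f_eq: "f j x = of_real (\<mu> ^ j / fact j) * (w x powr - of_real (s + real j) * exp (of_real V * w x))" for j x
  proof -
    have "w x powr - of_real (s + real j) = w x powr (- of_real s + - of_nat j)" by simp
    also have "\<dots> = w x powr - of_real s * w x powr - of_nat j" by (rule powr_add)
    also have "w x powr - of_nat j = inverse (w x ^ j)" using w(1)[of x] by (simp add: powr_minus powr_nat)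
    finally show ?thesis unfolding f_def by (simp add: power_mult_distrib power_inverse divide_inverse mult_ac)
  qed
  have norm_e: "norm (exp (of_real V * w x)) = exp (V * a)" for x by (simp add: w_def)
  have intp: "integrable lborel (\<lambda>x. w x powr - of_real t)" if "t \<ge> 2" for t
    unfolding w_def by (rule integrable_vertical_line_powr[OF a that])
  have intpe: "integrable lborel (\<lambda>x. w x powr - of_real t * exp (of_real V * w x))" if "t \<ge> 2" for t
  proof (rule Bochner_Integration.integrable_bound)
    show "integrable lborel (\<lambda>x. exp (V * a) * norm (w x powr - of_real t))"
      using intp[OF that] by (intro integrable_mult_right integrable_norm)
    have "continuous_on UNIV (\<lambda>x. w x powr - of_real t * exp (of_real V * w x))"
      using continuous_on_vertical_line[OF a, of "- of_real t"] unfolding w_def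
      by (intro continuous_on_mult) (auto simp: Complex_eq intro!: continuous_intros)
    thus "(\<lambda>x. w x powr - of_real t * exp (of_real V * w x)) \<in> borel_measurable lborel"
      using borel_measurable_continuous_onI by simp
    show "AE x in lborel. norm (w x powr - of_real t * exp (of_real V * w x)) \<le> norm (exp (V * a) * norm (w x powr - of_real t))"
      by (intro AE_I2) (simp add: norm_mult norm_e)
  qed
  have int: "integrable lborel (f j)" for j
    unfolding f_eq using s by (intro integrable_mult_right intpe) auto
  have sum_f: "(\<lambda>j. f j x) sums bessel_kernel s \<mu> V (w x)" for x
  proof -
    have "(\<lambda>j. (of_real \<mu> / w x) ^ j / fact j) sums exp (of_real \<mu> / w x)"
      using exp_converges[of "of_real \<mu> / w x"] by (simp add: scaleR_conv_of_real divide_inverse mult.commute)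
    from sums_mult2[OF this, of "w x powr - of_real s * exp (of_real V * w x)"]
    show ?thesis by (simp add: f_def bessel_kernel_def mult_ac)
  qed
  have norm_f: "norm (f j x) \<le> (\<mu> / a) ^ j / fact j * (exp (V * a) * norm (w x powr - of_real s))" for j x
  proof -
    have "norm (f j x) = (\<mu> / norm (w x)) ^ j / fact j * (norm (w x powr - of_real s) * exp (V * a))"
      using \<mu> by (simp add: f_def norm_mult norm_divide norm_power norm_e)
    also have "\<dots> \<le> (\<mu> / a) ^ j / fact j * (norm (w x powr - of_real s) * exp (V * a))"
      using \<mu> a w by (intro mult_right_mono divide_right_mono power_mono divide_left_mono mult_pos_pos) (auto simp: zero_less_norm_iff)
    finally show ?thesis by (simp only: mult_ac)
  qed
  define Z where "Z = (LINT x|lborel. exp (V * a) * norm (w x powr - of_real s))"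
  have summ: "summable (\<lambda>j. LINT x|lborel. norm (f j x))"
  proof (rule summable_comparison_test')
    show "summable (\<lambda>j. (\<mu> / a) ^ j / fact j * Z)"
      using summable_exp[of "\<mu> / a"] by (intro summable_mult2) (simp add: divide_inverse mult.commute)
    fix j :: nat
    have "(LINT x|lborel. norm (f j x)) \<le> (LINT x|lborel. (\<mu> / a) ^ j / fact j * (exp (V * a) * norm (w x powr - of_real s)))"
      using intp[OF s] by (intro integral_mono integrable_norm int integrable_mult_right norm_f) auto
    also have "\<dots> = (\<mu> / a) ^ j / fact j * Z" by (simp add: Z_def)
    finally show "norm (LINT x|lborel. norm (f j x)) \<le> (\<mu> / a) ^ j / fact j * Z"
      by (simp add: integral_nonneg_AE)
  qed
  have ptw: "AE x in lborel. summable (\<lambda>j. norm (f j x))"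
  proof (rule AE_I2)
    fix x
    show "summable (\<lambda>j. norm (f j x))"
    proof (rule summable_comparison_test')
      show "summable (\<lambda>j. (\<mu> / a) ^ j / fact j * (exp (V * a) * norm (w x powr - of_real s)))"
        using summable_exp[of "\<mu> / a"] by (intro summable_mult2) (simp add: divide_inverse mult.commute)
    qed (use norm_f in auto)
  qed
  have suminf_eq: "(\<lambda>x. \<Sum>j. f j x) = (\<lambda>x. bessel_kernel s \<mu> V (w x))"
    using sum_f by (auto simp: sums_iff)
  show "integrable lborel (\<lambda>x. bessel_kernel s \<mu> V (Complex a x))"
    using integrable_suminf[OF int ptw summ] unfolding suminf_eq by (simp add: w_def)
  have "(\<lambda>j. LINT x|lborel. f j x) sums (LINT x|lborel. bessel_kernel s \<mu> V (w x))"
    using sums_integral[OF int ptw summ] unfolding suminf_eq .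
  moreover have "(LINT x|lborel. f j x) = of_real (\<mu> ^ j / fact j * (2 * pi * V powr (s + real j - 1) * rGamma (s + real j)))" for j
  proof -
    have "(LINT x|lborel. f j x) = of_real (\<mu> ^ j / fact j) * (LINT x|lborel. w x powr - of_real (s + real j) * exp (of_real V * w x))"
      unfolding f_eq by (rule integral_mult_right_zero)
    also have "(LINT x|lborel. w x powr - of_real (s + real j) * exp (of_real V * w x)) = of_real (2 * pi * V powr (s + real j - 1) * rGamma (s + real j))"
      unfolding w_def using s by (intro bromwich_powr a V) auto
    finally show ?thesis by (simp only: of_real_mult)
  qed
  ultimately show "(\<lambda>j. of_real (\<mu> ^ j / fact j * (2 * pi * V powr (s + real j - 1) * rGamma (s + real j)))) sums
           (LINT x|lborel. bessel_kernel s \<mu> V (Complex a x))" by (simp only: w_def)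
qed

lemma coprime_add_mult_iff: "coprime c (d + c * j) \<longleftrightarrow> coprime c d" for c d j :: int
  using gcd_add_mult[of c j d] by (simp add: coprime_iff_gcd_eq_1 add.commute mult.commute)

lemma ii_times_powr:
  assumes "Re w > 0"
  shows "(\<i> * w) powr t = \<i> powr t * w powr t"
proof -
  have "w \<noteq> 0" using assms by auto
  hence "Ln (\<i> * w) = Ln w + \<i> * of_real pi / 2" using assms by (simp add: Ln_times_ii)
  thus ?thesis using \<open>w \<noteq> 0\<close> by (simp add: powr_def ring_distribs exp_add)
qed

context partition_data
begin

definition coeff_integrand :: "int \<Rightarrow> int \<Rightarrow> complex \<Rightarrow> complex" where
  "coeff_integrand c d \<tau> = poincare_term wt ord (lower_row_matrix c d) \<tau> * qpow (- nu) \<tau>"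

lemma coeff_integrand_eq:
  assumes "coprime c d" "Im \<tau> > 0"
  shows "coeff_integrand c d \<tau> = euler_prod (qpow 1 \<tau>) ^ r * weight2_term \<tau> (lower_row_matrix c d)"
proof -
  have cancel: "q * e * u * inverse q = e * u" if "q \<noteq> 0" for q e u :: complex using that by simp
  show ?thesis
    unfolding coeff_integrand_def poincare_term_weight2[OF lower_row_matrix(1)[OF assms(1)] assms(2)] dedekind_eta_power qpow_minus
    by (rule cancel) simp
qed

text \<open>Replacing \<open>d\<close> by \<open>d + cj\<close> amounts to multiplying \<open>M\<close> by a translation on the right.\<close>

lemma coeff_integrand_shift:
  assumes cd: "coprime c d" and \<tau>: "Im \<tau> > 0"
  shows "coeff_integrand c (d + c * j) \<tau> = coeff_integrand c d (\<tau> + of_int j)"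
proof -
  define M T where "M = lower_row_matrix c d" and "T = mat2 1 j 0 1"
  have cd': "coprime c (d + c * j)" using cd by (simp add: coprime_add_mult_iff)
  have M: "M \<in> carrier SL2Z" "a21 M = c" "a22 M = d" using lower_row_matrix[OF cd] by (simp_all add: M_def)
  have T: "T \<in> carrier SL2Z" by (simp add: T_def in_SL2Z_iff)
  have MT: "M ** T \<in> carrier SL2Z" using M T by (metis SL2Z.m_closed mult_SL2Z)
  have "weight2_term \<tau> (lower_row_matrix c (d + c * j)) = weight2_term \<tau> (M ** T)"
    by (rule weight2_term_cong[OF lower_row_matrix(1)[OF cd'] MT _ _ \<tau>])
       (use lower_row_matrix[OF cd'] M in \<open>simp_all add: matrix_mult_nth_2 T_def algebra_simps\<close>)
  also have "\<dots> = weight2_term (\<tau> + of_int j) M"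
    unfolding weight2_term_def moebius_mult[OF M(1) T \<tau>] aut_factor_mult[OF T \<tau>]
    by (simp add: T_def moebius_def[of "mat2 1 j 0 1"] aut_factor_def[of "mat2 1 j 0 1"])
  finally show ?thesis
    using \<tau> by (simp add: coeff_integrand_eq[OF cd'] coeff_integrand_eq[OF cd] nome_periodic M_def)
qed

lemma holomorphic_coeff_integrand:
  assumes "coprime c d"
  shows "coeff_integrand c d holomorphic_on {\<tau>. Im \<tau> > 0}"
  unfolding coeff_integrand_def[abs_def]
  by (intro holomorphic_intros holomorphic_poincare_term lower_row_matrix(1)[OF assms])

lemma continuous_on_coeff_integrand:
  assumes "coprime c d" "y > 0"
  shows "continuous_on A (\<lambda>x. coeff_integrand c d (Complex x y))"
  by (rule continuous_on_compose2[OF holomorphic_on_imp_continuous_on[OF holomorphic_coeff_integrand[OF assms(1)]]])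
     (use assms(2) in \<open>auto simp: Complex_eq intro!: continuous_intros\<close>)

text \<open>The series converges uniformly on horizontal segments and can be integrated term by term.\<close>

lemma has_sum_coeff_integrals:
  assumes y: "y > 0"
  shows "((\<lambda>(c,d). integral {0..1} (\<lambda>x. coeff_integrand c d (Complex x y))) has_sum
           fourier_coeff (poincare_series wt ord) y nu) cusp_rows"
proof -
  define g where "g = (\<lambda>p x. if p \<in> cusp_rows then poincare_term wt ord (lower_row_matrix (fst p) (snd p)) (Complex x y) else 0)"
  define Q where "Q = (\<lambda>x. qpow (- nu) (Complex x y))"
  have contQ: "continuous_on {0..1} Q" unfolding Q_def Complex_eq by (intro continuous_intros)
  have contt: "continuous_on {0..1} (\<lambda>x. tail (Complex x y))"
    by (rule continuous_on_compose2[OF holomorphic_on_imp_continuous_on[OF holomorphic_tail]])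
       (use y in \<open>auto simp: Complex_eq intro!: continuous_intros\<close>)
  have contg: "continuous_on {0..1} (g p)" for p
  proof (cases "p \<in> cusp_rows")
    case True
    have "continuous_on {0..1} (\<lambda>x. poincare_term wt ord (lower_row_matrix (fst p) (snd p)) (Complex x y))"
      by (rule continuous_on_compose2[OF holomorphic_on_imp_continuous_on[OF holomorphic_poincare_term[OF cusp_rowsD(2)[OF True]]]])
         (use y in \<open>auto simp: Complex_eq intro!: continuous_intros\<close>)
    thus ?thesis using True by (simp add: g_def)
  qed (simp add: g_def)
  have bnd: "bounded (h ` {0..1})" if "continuous_on {0..1} h" for h :: "real \<Rightarrow> complex"
    using that by (intro compact_imp_bounded compact_continuous_image) auto
  have "uniform_limit {0..1} (\<lambda>X x. \<Sum>p\<in>X. poincare_term wt ord (lower_row_matrix (fst p) (snd p)) (Complex x y)) (\<lambda>x. tail (Complex x y)) (finite_subsets_at_top cusp_rows)"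
  proof (rule uniform_limit_compose'[OF uniform_limit_tail[of y "(\<lambda>x. Complex x y) ` {0..1}" "1 + y"]])
    fix \<tau> assume "\<tau> \<in> (\<lambda>x. Complex x y) ` {0..1}"
    then obtain x where x: "0 \<le> x" "x \<le> 1" "\<tau> = Complex x y" by auto
    have "norm \<tau> \<le> \<bar>x\<bar> + \<bar>y\<bar>" using cmod_le[of \<tau>] x by simp
    thus "y \<le> Im \<tau> \<and> norm \<tau> \<le> 1 + y" using x y by simp
  qed (use y in auto)
  also have "?this \<longleftrightarrow> uniform_limit {0..1} (\<lambda>X x. \<Sum>p\<in>X. g p x) (\<lambda>x. tail (Complex x y)) (finite_subsets_at_top cusp_rows)"
    by (intro uniform_limit_cong eventually_finite_subsets_at_top_weakI ballI sum.cong) (auto simp: g_def)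
  finally have "uniform_limit {0..1} (\<lambda>X x. (\<Sum>p\<in>X. g p x) * Q x) (\<lambda>x. tail (Complex x y) * Q x) (finite_subsets_at_top cusp_rows)"
    by (rule uniform_lim_mult[OF _ uniform_limit_const bnd[OF contt] bnd[OF contQ]])
  moreover have "continuous_on {0..1} (\<lambda>x. (\<Sum>p\<in>X. g p x) * Q x)" for X
    by (intro continuous_on_mult continuous_on_sum contg contQ)
  ultimately obtain I J where IJ: "\<And>X. ((\<lambda>x. (\<Sum>p\<in>X. g p x) * Q x) has_integral I X) {0..1}"
     "((\<lambda>x. tail (Complex x y) * Q x) has_integral J) {0..1}" "(I \<longlongrightarrow> J) (finite_subsets_at_top cusp_rows)"
    using uniform_limit_integral[OF _ _ finite_subsets_at_top_neq_bot] by blast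
  have J: "J = fourier_coeff (poincare_series wt ord) y nu"
    using integral_unique[OF IJ(2)] by (simp add: fourier_coeff_poincare_eq[OF y] reduced_tail_def Q_def)
  have I: "I X = (\<Sum>p\<in>X. case p of (c,d) \<Rightarrow> integral {0..1} (\<lambda>x. coeff_integrand c d (Complex x y)))" if "finite X" "X \<subseteq> cusp_rows" for X
  proof -
    have "I X = integral {0..1} (\<lambda>x. \<Sum>p\<in>X. g p x * Q x)"
      using integral_unique[OF IJ(1)[of X]] by (simp add: sum_distrib_right)
    also have "\<dots> = (\<Sum>p\<in>X. integral {0..1} (\<lambda>x. g p x * Q x))"
      using that(1) by (intro integral_sum integrable_continuous_real continuous_on_mult contg contQ)
    also have "\<dots> = (\<Sum>p\<in>X. case p of (c,d) \<Rightarrow> integral {0..1} (\<lambda>x. coeff_integrand c d (Complex x y)))"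
      using that(2) by (intro sum.cong) (auto simp: g_def Q_def coeff_integrand_def)
    finally show ?thesis .
  qed
  have "(sum (\<lambda>(c,d). integral {0..1} (\<lambda>x. coeff_integrand c d (Complex x y))) \<longlongrightarrow> J) (finite_subsets_at_top cusp_rows)"
    by (rule Lim_transform_eventually[OF IJ(3)]) (auto intro!: eventually_finite_subsets_at_top_weakI simp: I)
  thus ?thesis unfolding has_sum_def J .
qed

text \<open>The factor of the integrals over the line that is common to all \<open>d\<close>.\<close>

definition line_integral :: "real \<Rightarrow> real \<Rightarrow> complex" where
  "line_integral y c = (LINT x|lborel. bessel_kernel wt (- 2 * pi * ord / c^2) (2 * pi * nu) (Complex y x))"

lemma coeff_integrand_explicit:
  assumes cd: "coprime c d" and c: "c > 0" and y: "y > 0"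
  shows "coeff_integrand c d (Complex x y) =
     cpow (eta_mult (lower_row_matrix c d)) (- 24 * ord) * exp (2 * of_real pi * \<i> * of_real ((ord * of_int (a11 (lower_row_matrix c d)) + nu * of_int d) / of_int c))
     * of_real (of_int c powr - wt) * cpow \<i> (- wt) * bessel_kernel wt (- 2 * pi * ord / (of_int c)^2) (2 * pi * nu) (Complex y (- (x + of_int d / of_int c)))"
proof -
  define M where "M = lower_row_matrix c d"
  have M: "M \<in> carrier SL2Z" "a21 M = c" "a22 M = d" using lower_row_matrix[OF cd] by (simp_all add: M_def)
  define \<tau> where "\<tau> = Complex x y"
  \<comment> \<open>\<open>c\<tau> + d = cz\<close> and \<open>M\<tau> = a/c - 1/(c\<^sup>2 z)\<close>; the rotation to \<open>w\<close> makes the line vertical.\<close>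
  define z where "z = \<tau> + of_int d / of_int c"
  define w where "w = Complex y (- (x + of_int d / of_int c))"
  define C where "C = (of_int c :: complex)"
  have C: "C \<noteq> 0" "C = of_real (of_int c)" using c by (simp_all add: C_def)
  have zw: "z = \<i> * w" by (simp add: z_def w_def \<tau>_def complex_eq_iff)
  have Imz: "Im z > 0" using y by (simp add: zw w_def)
  have "w \<noteq> 0" using y by (simp add: w_def complex_eq_iff)
  hence znz: "z \<noteq> 0" "w \<noteq> 0" unfolding zw by simp_all
  have J: "aut_factor M \<tau> = C * z"
    using C(1) by (simp add: aut_factor_def M z_def C_def[symmetric] distrib_left)
  have "a11 M * d = 1 + a12 M * c" using M(1) unfolding in_SL2Z_iff M(2,3) by linarith
  hence "complex_of_int (a11 M * d) = of_int (1 + a12 M * c)" by (rule arg_cong)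
  hence det: "of_int (a11 M) * of_int d = 1 + of_int (a12 M) * C"
    by (simp only: C_def of_int_mult of_int_add of_int_1)
  have "of_int (a11 M) * \<tau> + of_int (a12 M) = of_int (a11 M) * z - 1 / C"
  proof -
    have "of_int (a11 M) * z = of_int (a11 M) * \<tau> + (of_int (a11 M) * of_int d) / C"
      by (simp add: z_def distrib_left C_def)
    also have "\<dots> = of_int (a11 M) * \<tau> + of_int (a12 M) + 1 / C"
      unfolding det using C by (simp add: add_divide_distrib)
    finally show ?thesis by simp
  qed
  hence moeb: "moebius M \<tau> = of_int (a11 M) / C - 1 / (C^2 * z)"
    unfolding moebius_def J using C znz by (simp add: diff_divide_distrib power2_eq_square)
  have c1: "cpow (aut_factor M \<tau>) (- wt) = of_real (of_int c powr - wt) * (cpow \<i> (- wt) * w powr - of_real wt)"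
  proof -
    have "cpow (aut_factor M \<tau>) (- wt) = of_real (of_int c powr - wt) * cpow z (- wt)"
      unfolding J C(2) using c by (intro cpow_of_real_mult) simp
    also have "cpow z (- wt) = z powr of_real (- wt)" using Imz by (intro cpow_eq_powr) simp
    also have "\<dots> = \<i> powr of_real (- wt) * w powr of_real (- wt)"
      unfolding zw using y by (intro ii_times_powr) (simp add: w_def)
    also have "\<i> powr of_real (- wt) = cpow \<i> (- wt)" by (rule cpow_eq_powr[symmetric]) simp
    finally show ?thesis by simp
  qed
  have q1: "qpow ord (moebius M \<tau>) = exp (2 * of_real pi * \<i> * of_real (ord * of_int (a11 M) / of_int c)) * exp (of_real (- 2 * pi * ord / (of_int c)^2) / w)"
  proof -
    have "2 * of_real pi * \<i> * of_real ord * (1 / (C^2 * z)) = of_real (2 * pi * ord / (of_int c)^2) / w"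
      unfolding zw using C znz by (simp add: C_def)
    hence "2 * of_real pi * \<i> * of_real ord * (of_int (a11 M) / C - 1 / (C^2 * z)) =
          2 * of_real pi * \<i> * of_real (ord * of_int (a11 M) / of_int c) + of_real (- 2 * pi * ord / (of_int c)^2) / w"
    proof -
      have A: "2 * of_real pi * \<i> * of_real ord * (of_int (a11 M) / C) = 2 * of_real pi * \<i> * of_real (ord * of_int (a11 M) / of_int c)"
        by (simp add: C_def)
      have neg: "of_real (- 2 * pi * ord / (of_int c)^2) = - (of_real (2 * pi * ord / (of_int c)^2) :: complex)"
        by (simp only: of_real_minus[symmetric] of_real_eq_iff mult_minus_left minus_divide_left)
      assume X: "2 * of_real pi * \<i> * of_real ord * (1 / (C^2 * z)) = of_real (2 * pi * ord / (of_int c)^2) / w"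
      have alg: "a - p / w = a + (- p) / w" for a p :: complex by simp
      show ?thesis unfolding right_diff_distrib[of "2 * of_real pi * \<i> * of_real ord"] A X neg by (rule alg)
    qed
    thus ?thesis unfolding qpow_def moeb by (simp only: exp_add)
  qed
  have q2: "qpow (- nu) \<tau> = exp (2 * of_real pi * \<i> * of_real (nu * of_int d / of_int c)) * exp (of_real (2 * pi * nu) * w)"
  proof -
    have "\<tau> = \<i> * w - of_int d / of_int c" unfolding zw[symmetric] by (simp add: z_def)
    hence "2 * of_real pi * \<i> * of_real (- nu) * \<tau> = 2 * of_real pi * \<i> * of_real (nu * of_int d / of_int c) + of_real (2 * pi * nu) * w"
    proof -
      have r1: "of_real (nu * of_int d / of_int c) = of_real nu * (of_int d / of_int c :: complex)"
        and r2: "of_real (2 * pi * nu) = 2 * of_real pi * (of_real nu :: complex)"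
        and r3: "of_real (- nu) = - (of_real nu :: complex)" by simp_all
      have alg: "2 * p * \<i> * (- v) * (\<i> * u - e) = 2 * p * \<i> * (v * e) + 2 * p * v * u" for p v u e :: complex
        by (simp add: algebra_simps)
      assume t: "\<tau> = \<i> * w - of_int d / of_int c"
      show ?thesis unfolding r1 r2 r3 t by (rule alg)
    qed
    thus ?thesis unfolding qpow_def by (simp only: exp_add)
  qed
  have e: "exp (2 * of_real pi * \<i> * of_real ((ord * of_int (a11 M) + nu * of_int d) / of_int c)) =
        exp (2 * of_real pi * \<i> * of_real (ord * of_int (a11 M) / of_int c)) * exp (2 * of_real pi * \<i> * of_real (nu * of_int d / of_int c))"
    by (simp only: add_divide_distrib of_real_add distrib_left exp_add)
  show ?thesis
    unfolding coeff_integrand_def poincare_term_def M_def[symmetric] \<tau>_def[symmetric] c1 q1 q2 e bessel_kernel_def w_def[symmetric]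
    by (simp only: mult_ac)
qed

lemma integral_coeff_integrand:
  assumes cd: "coprime c d" and c: "c > 0" and y: "y > 0"
  shows "integrable lborel (\<lambda>x. coeff_integrand c d (Complex x y))"
    and "(LINT x|lborel. coeff_integrand c d (Complex x y)) =
     cpow (eta_mult (lower_row_matrix c d)) (- 24 * ord) * exp (2 * of_real pi * \<i> * of_real ((ord * of_int (a11 (lower_row_matrix c d)) + nu * of_int d) / of_int c))
     * of_real (of_int c powr - wt) * cpow \<i> (- wt) * line_integral y (of_int c)"
proof -
  define B where "B = (\<lambda>x. bessel_kernel wt (- 2 * pi * ord / (of_int c)^2) (2 * pi * nu) (Complex y x))"
  have "integrable lborel B" unfolding B_def
  proof (rule integrable_bessel_kernel)
    show "- 2 * pi * ord / (of_int c)^2 \<ge> 0" using ord_nonpos by (intro divide_nonneg_nonneg mult_nonpos_nonpos) auto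
  qed (use wt_ge r y in auto)
  hence "integrable lborel (\<lambda>x. B (- of_int d / of_int c + - 1 * x))"
    by (rule lborel_integrable_real_affine) simp
  moreover have "(LINT x|lborel. B x) = \<bar>- 1\<bar> *\<^sub>R (LINT x|lborel. B (- of_int d / of_int c + - 1 * x))"
    by (rule lborel_integral_real_affine) simp
  moreover have "(\<lambda>x. B (- of_int d / of_int c + - 1 * x)) = (\<lambda>x. B (- (x + of_int d / of_int c)))"
    by (simp add: algebra_simps)
  ultimately have B: "integrable lborel (\<lambda>x. B (- (x + of_int d / of_int c)))"
    "(LINT x|lborel. B (- (x + of_int d / of_int c))) = line_integral y (of_int c)"
    by (simp_all add: line_integral_def B_def)
  define K where "K = cpow (eta_mult (lower_row_matrix c d)) (- 24 * ord) * exp (2 * of_real pi * \<i> * of_real ((ord * of_int (a11 (lower_row_matrix c d)) + nu * of_int d) / of_int c))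
     * of_real (of_int c powr - wt) * cpow \<i> (- wt)"
  have eq: "(\<lambda>x. coeff_integrand c d (Complex x y)) = (\<lambda>x. K * B (- (x + of_int d / of_int c)))"
    unfolding K_def B_def by (rule ext) (rule coeff_integrand_explicit[OF cd c y])
  show "integrable lborel (\<lambda>x. coeff_integrand c d (Complex x y))"
    unfolding eq by (intro integrable_mult_right B(1))
  show "(LINT x|lborel. coeff_integrand c d (Complex x y)) =
     cpow (eta_mult (lower_row_matrix c d)) (- 24 * ord) * exp (2 * of_real pi * \<i> * of_real ((ord * of_int (a11 (lower_row_matrix c d)) + nu * of_int d) / of_int c))
     * of_real (of_int c powr - wt) * cpow \<i> (- wt) * line_integral y (of_int c)"
    unfolding eq integral_mult_right_zero B(2) K_def ..
qed

text \<open>The rows with a fixed \<open>c\<close> fall into classes modulo \<open>c\<close>; within a class the translates of the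
  unit interval tile the line.\<close>

theorem sums_fourier_coeff_poincare:
  assumes y: "y > 0"
  shows "(\<lambda>j. kloosterman ord nu (Suc j) * (of_real (real (Suc j) powr - wt) * cpow \<i> (- wt) * line_integral y (real (Suc j)))) sums
           fourier_coeff (poincare_series wt ord) y nu"
proof -
  let ?S = "fourier_coeff (poincare_series wt ord) y nu"
  define D where "D = (\<lambda>c::int. {d \<in> {0..<c}. coprime c d})"
  define R0 where "R0 = Sigma {0<..} D"
  define L where "L = (\<lambda>(c,d). LINT x|lborel. coeff_integrand c d (Complex x y))"
  define I where "I = (\<lambda>(c,d). integral {0..1} (\<lambda>x. coeff_integrand c d (Complex x y)))"
  have cop: "coprime c (d + c * j) \<longleftrightarrow> coprime c d" for c d j :: int
    by (rule coprime_add_mult_iff)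
  have "((\<lambda>((c,d),j). I (c, d + c * j)) has_sum ?S) (R0 \<times> UNIV)"
  proof (subst has_sum_reindex_bij_witness[where h = I and T = cusp_rows and s' = ?S
            and i = "\<lambda>(c,d). ((c, d mod c), d div c)" and j = "\<lambda>((c,d),j). (c, d + c * j)"])
    fix a assume "a \<in> R0 \<times> (UNIV :: int set)"
    then obtain c d j where a: "a = ((c,d),j)" "c > 0" "0 \<le> d" "d < c" "coprime c d" by (auto simp: R0_def D_def)
    show "(\<lambda>(c,d). ((c, d mod c), d div c)) ((\<lambda>((c,d),j). (c, d + c * j)) a) = a" using a by simp
    show "(\<lambda>((c,d),j). (c, d + c * j)) a \<in> cusp_rows" using a cop by (simp add: cusp_rows_def)
    show "I ((\<lambda>((c,d),j). (c, d + c * j)) a) = (\<lambda>((c,d),j). I (c, d + c * j)) a" using a by simp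
  next
    fix b assume "b \<in> cusp_rows"
    then obtain c d where b: "b = (c,d)" "c > 0" "coprime c d" by (auto simp: cusp_rows_def)
    show "(\<lambda>((c,d),j). (c, d + c * j)) ((\<lambda>(c,d). ((c, d mod c), d div c)) b) = b" using b by simp
    have "coprime c (d mod c)" using b cop[of c "d mod c" "d div c"] by simp
    thus "(\<lambda>(c,d). ((c, d mod c), d div c)) b \<in> R0 \<times> UNIV" using b by (simp add: R0_def D_def)
  next
    show "(I has_sum ?S) cusp_rows" using has_sum_coeff_integrals[OF y] by (simp add: I_def)
  qed simp
  hence "(L has_sum ?S) R0"
  proof (rule has_sum_SigmaD)
    fix p assume p: "p \<in> R0"
    then obtain c d where cd: "p = (c,d)" "c > 0" "coprime c d" by (auto simp: R0_def D_def)
    define \<phi> where "\<phi> = (\<lambda>x. coeff_integrand c d (Complex x y))"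
    have shift: "I (c, d + c * j) = integral {0..1} (\<lambda>x. \<phi> (x + of_int j))" for j
    proof -
      have "Complex x y + of_int j = Complex (x + of_int j) y" for x by (simp add: complex_eq_iff)
      thus ?thesis using y by (simp add: I_def \<phi>_def coeff_integrand_shift[OF cd(3)])
    qed
    have "(\<lambda>(q,j). I (fst q, snd q + fst q * j)) summable_on (R0 \<times> UNIV)"
      using \<open>((\<lambda>((c,d),j). I (c, d + c * j)) has_sum ?S) (R0 \<times> UNIV)\<close> by (auto simp: summable_on_def case_prod_unfold)
    from summable_on_SigmaD1[OF this p] obtain S where S: "((\<lambda>j. I (c, d + c * j)) has_sum S) UNIV"
      by (auto simp: cd summable_on_def)
    have "(\<lambda>N. \<Sum>j\<in>{0 - int N..<0 + int N}. I (c, d + c * j)) \<longlonglongrightarrow> S" by (rule has_sum_int_imp_tendsto[OF S])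
    moreover have "(\<Sum>j\<in>{0 - int N..<0 + int N}. I (c, d + c * j)) = integral {- real N..real N} \<phi>" for N
      unfolding shift by (rule sum_integral_translates) (unfold \<phi>_def, rule continuous_on_coeff_integrand[OF cd(3) y])
    moreover have "(\<lambda>N. integral {- real N..real N} \<phi>) \<longlonglongrightarrow> L p"
      unfolding L_def cd prod.case \<phi>_def by (rule tendsto_integral_symmetric_intervals[OF integral_coeff_integrand(1)[OF cd(3,2) y]])
    ultimately have "S = L p" by (simp add: LIMSEQ_unique)
    thus "((\<lambda>j. (\<lambda>((c,d),j). I (c, d + c * j)) (p, j)) has_sum L p) UNIV" using S by (simp add: cd)
  qed
  hence "((\<lambda>c. \<Sum>d\<in>D c. L (c,d)) has_sum ?S) {0<..}"
    unfolding R0_def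
  proof (rule has_sum_SigmaD)
    fix c :: int
    have "finite (D c)" by (rule finite_subset[of _ "{0..<c}"]) (auto simp: D_def)
    thus "((\<lambda>d. L (c,d)) has_sum (\<Sum>d\<in>D c. L (c,d))) (D c)" by (rule has_sum_finite)
  qed
  hence "((\<lambda>j. \<Sum>d\<in>D (int (Suc j)). L (int (Suc j), d)) has_sum ?S) UNIV"
    by (subst has_sum_reindex_bij_witness[where h = "\<lambda>c. \<Sum>d\<in>D c. L (c,d)" and T = "{0<..}" and s' = ?S
            and i = "\<lambda>c. nat (c - 1)" and j = "\<lambda>j. int (Suc j)"]) auto
  hence "(\<lambda>j. \<Sum>d\<in>D (int (Suc j)). L (int (Suc j), d)) sums ?S" by (rule has_sum_imp_sums)
  moreover have "(\<Sum>d\<in>D (int (Suc j)). L (int (Suc j), d)) =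
     kloosterman ord nu (Suc j) * (of_real (real (Suc j) powr - wt) * cpow \<i> (- wt) * line_integral y (real (Suc j)))" for j
  proof -
    define c where "c = int (Suc j)"
    have c: "c > 0" "real_of_int c = real (Suc j)" "of_int c = (of_nat (Suc j) :: complex)" by (simp_all add: c_def)
    have "(\<Sum>d\<in>D c. L (c, d)) = (\<Sum>d\<in>D c. cpow (eta_mult (lower_row_matrix c d)) (- 24 * ord) * exp (2 * of_real pi * \<i> * of_real ((ord * of_int (a11 (lower_row_matrix c d)) + nu * of_int d) / real (Suc j)))
        * (of_real (real (Suc j) powr - wt) * cpow \<i> (- wt) * line_integral y (real (Suc j))))"
      by (intro sum.cong refl) (simp add: L_def D_def integral_coeff_integrand(2)[OF _ c(1) y] c(2) mult.assoc del: of_nat_Suc)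
    also have "\<dots> = (\<Sum>d\<in>D c. cpow (eta_mult (lower_row_matrix c d)) (- 24 * ord) * exp (2 * of_real pi * \<i> * of_real ((ord * of_int (a11 (lower_row_matrix c d)) + nu * of_int d) / real (Suc j))))
        * (of_real (real (Suc j) powr - wt) * cpow \<i> (- wt) * line_integral y (real (Suc j)))"
      by (rule sum_distrib_right[symmetric])
    also have "(\<Sum>d\<in>D c. cpow (eta_mult (lower_row_matrix c d)) (- 24 * ord) * exp (2 * of_real pi * \<i> * of_real ((ord * of_int (a11 (lower_row_matrix c d)) + nu * of_int d) / real (Suc j)))) = kloosterman ord nu (Suc j)"
      unfolding kloosterman_def Let_def lower_row_matrix_def D_def c_def by (rule sum.cong) auto
    finally show ?thesis by (simp only: c_def)
  qed
  ultimately show ?thesis by simp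
qed

end

section \<open>Bessel functions and divisor sums\<close>

lemma sums_of_real_complexD:
  assumes "(\<lambda>j. of_real (a j) :: complex) sums L"
  shows "summable a" "L = of_real (suminf a)"
proof -
  have "summable (\<lambda>j. of_real (a j) :: complex)" using assms by (rule sums_summable)
  thus s: "summable a" by (simp only: summable_of_real_iff)
  show "L = of_real (suminf a)" using sums_unique2[OF assms sums_of_real[OF summable_sums[OF s]]] .
qed

context partition_data
begin

lemma sums_line_integral:
  assumes "y > 0"
  shows "(\<lambda>j. of_real ((- 2 * pi * ord / c^2) ^ j / fact j * (2 * pi * (2 * pi * nu) powr (wt + real j - 1) * rGamma (wt + real j)))) sums line_integral y c"
  unfolding line_integral_def
proof (rule sums_bessel_kernel)
  show "- 2 * pi * ord / c^2 \<ge> 0" using ord_nonpos by (intro divide_nonneg_nonneg mult_nonpos_nonpos) auto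
qed (use wt_ge r assms in auto)

text \<open>Both sides are power series; they agree term by term because the argument \<open>2h\<close> of the Bessel function
  satisfies \<open>h\<^sup>2 = (2\<pi>\<bar>m\<bar> / c\<^sup>2) * (2\<pi>\<nu>)\<close>.\<close>

lemma line_integral_bessel:
  assumes y: "y > 0" and ord: "ord < 0" and c: "c > 0"
  shows "of_real (c powr - wt) * line_integral y c =
           of_real (2 * pi * (nu / \<bar>ord\<bar>) powr ((wt - 1) / 2) / c * bessel_I (wt - 1) (4 * pi * sqrt (\<bar>ord\<bar> * nu) / c))"
proof -
  define p v o' where "p = wt - 1" and "v = nu" and "o' = \<bar>ord\<bar>"
  have pos: "v > 0" "o' > 0" "- ord = o'" using r ord by (auto simp: v_def o'_def)
  define a where "a = (\<lambda>j. (- 2 * pi * ord / c^2) ^ j / fact j * (2 * pi * (2 * pi * nu) powr (wt + real j - 1) * rGamma (wt + real j)))"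
  define h where "h = 2 * pi * sqrt (o' * v) / c"
  define b where "b = (\<lambda>j. h powr (p + 2 * real j) * rGamma (p + real j + 1) / fact j)"
  define K where "K = 2 * pi * (v / o') powr (p / 2) / c"
  have h: "h > 0" using pos c by (simp add: h_def)
  have h2: "h^2 = (2 * pi * o' / c^2) * (2 * pi * v)"
    using pos by (simp add: h_def power_divide power_mult_distrib) (simp add: power2_eq_square)
  have hp: "K * h powr p = c powr - wt * (2 * pi * (2 * pi * v) powr p)"
  proof -
    have "sqrt (o' * v) = v * sqrt (o' / v)"
      using pos by (simp add: real_sqrt_mult real_sqrt_divide field_simps)
    hence "h = (2 * pi * v) * sqrt (o' / v) / c" by (simp add: h_def)
    hence "h powr p = (2 * pi * v) powr p * sqrt (o' / v) powr p / c powr p"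
      by (simp only: powr_divide powr_mult)
    also have "sqrt (o' / v) powr p = (o' / v) powr (p / 2)"
      using pos by (simp add: powr_half_sqrt[symmetric] powr_powr)
    finally have "K * h powr p = 2 * pi * (2 * pi * v) powr p * ((v / o') powr (p / 2) * (o' / v) powr (p / 2)) * (1 / (c * c powr p))"
      by (simp add: K_def)
    also have "(v / o') powr (p / 2) * (o' / v) powr (p / 2) = 1"
      using pos by (simp flip: powr_mult)
    also have "c * c powr p = c powr wt"
      using c powr_add[of c 1 p] by (simp add: p_def)
    finally show ?thesis unfolding powr_minus_divide by simp
  qed
  have ab: "c powr - wt * a j = K * b j" for j
  proof -
    have "- 2 * pi * ord / c^2 = 2 * pi * o' / c^2" unfolding pos(3)[symmetric] by (simp only: mult_minus_left mult_minus_right)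
    moreover have "(2 * pi * nu) powr (wt + real j - 1) = (2 * pi * v) powr p * (2 * pi * v) ^ j"
    proof -
      have "(2 * pi * v) powr (p + real j) = (2 * pi * v) powr p * (2 * pi * v) powr real j" by (rule powr_add)
      thus ?thesis using pos by (simp add: p_def v_def powr_realpow add_ac)
    qed
    ultimately have "c powr - wt * a j = (c powr - wt * (2 * pi * (2 * pi * v) powr p)) * ((2 * pi * o' / c^2) ^ j * (2 * pi * v) ^ j) * rGamma (wt + real j) / fact j"
      by (simp only: a_def) (simp add: mult_ac)
    also have "(2 * pi * o' / c^2) ^ j * (2 * pi * v) ^ j = h ^ (2 * j)" by (simp only: power_mult h2 power_mult_distrib)
    also have "h ^ (2 * j) = h powr (2 * real j)" using h powr_realpow[of h "2 * j"] by simp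
    also have "wt + real j = p + real j + 1" by (simp add: p_def)
    finally show ?thesis unfolding hp[symmetric] b_def by (simp add: powr_add mult_ac)
  qed
  have "K \<noteq> 0" using pos c by (simp add: K_def)
  have a: "summable a" "line_integral y c = of_real (suminf a)"
    using sums_of_real_complexD[of a "line_integral y c"] sums_line_integral[OF y, of c] by (simp_all add: a_def)
  have "summable (\<lambda>j. K * b j)" unfolding ab[symmetric] by (rule summable_mult[OF a(1)])
  hence b: "summable b" using \<open>K \<noteq> 0\<close> by simp
  have "c powr - wt * suminf a = (\<Sum>j. K * b j)" unfolding ab[symmetric] by (rule suminf_mult[OF a(1), symmetric])
  also have "\<dots> = K * suminf b" by (rule suminf_mult[OF b])
  also have "suminf b = bessel_I p (4 * pi * sqrt (o' * v) / c)"
    unfolding bessel_I_def b_def h_def by (simp add: mult.assoc)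
  finally show ?thesis unfolding a(2) by (simp add: K_def p_def v_def o'_def flip: of_real_mult)
qed

theorem fourier_coeff_poincare_bessel:
  assumes y: "y > 0" and ord: "ord < 0"
  shows "summable (\<lambda>j. kloosterman ord nu (Suc j) / of_nat (Suc j) * of_real (bessel_I (wt - 1) (4 * pi * sqrt (\<bar>ord\<bar> * nu) / real (Suc j))))" (is "summable ?f")
    and "fourier_coeff (poincare_series wt ord) y nu =
       2 * of_real pi * cpow \<i> (- wt) * of_real ((nu / \<bar>ord\<bar>) powr ((wt - 1) / 2)) *
       (\<Sum>j. kloosterman ord nu (Suc j) / of_nat (Suc j) * of_real (bessel_I (wt - 1) (4 * pi * sqrt (\<bar>ord\<bar> * nu) / real (Suc j))))"
proof -
  define K where "K = 2 * of_real pi * cpow \<i> (- wt) * of_real ((nu / \<bar>ord\<bar>) powr ((wt - 1) / 2))"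
  have "(nu / \<bar>ord\<bar>) powr ((wt - 1) / 2) \<noteq> 0" using r ord by simp
  hence K: "K \<noteq> 0" unfolding K_def by (simp del: powr_eq_0_iff)
  have eq: "kloosterman ord nu (Suc j) * (of_real (real (Suc j) powr - wt) * cpow \<i> (- wt) * line_integral y (real (Suc j))) = K * ?f j" for j
  proof -
    have "of_real (real (Suc j) powr - wt) * cpow \<i> (- wt) * line_integral y (real (Suc j)) =
          cpow \<i> (- wt) * (of_real (real (Suc j) powr - wt) * line_integral y (real (Suc j)))" by (simp only: mult_ac)
    also have "of_real (real (Suc j) powr - wt) * line_integral y (real (Suc j)) =
       of_real (2 * pi * (nu / \<bar>ord\<bar>) powr ((wt - 1) / 2) / real (Suc j) * bessel_I (wt - 1) (4 * pi * sqrt (\<bar>ord\<bar> * nu) / real (Suc j)))"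
      by (rule line_integral_bessel[OF y ord]) simp
    finally show ?thesis unfolding K_def of_real_mult of_real_divide of_real_of_nat_eq of_real_numeral
      by (simp only: times_divide_eq_left times_divide_eq_right mult_ac)
  qed
  have s: "(\<lambda>j. K * ?f j) sums fourier_coeff (poincare_series wt ord) y nu"
    using sums_fourier_coeff_poincare[OF y] unfolding eq .
  hence "summable (\<lambda>j. K * ?f j)" by (rule sums_summable)
  thus f: "summable ?f" using K by (simp only: summable_cmult_iff simp_thms)
  have "K * suminf ?f = fourier_coeff (poincare_series wt ord) y nu"
    using suminf_mult[OF f, of K] sums_unique[OF s] by simp
  thus "fourier_coeff (poincare_series wt ord) y nu =
       2 * of_real pi * cpow \<i> (- wt) * of_real ((nu / \<bar>ord\<bar>) powr ((wt - 1) / 2)) *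
       (\<Sum>j. kloosterman ord nu (Suc j) / of_nat (Suc j) * of_real (bessel_I (wt - 1) (4 * pi * sqrt (\<bar>ord\<bar> * nu) / real (Suc j))))"
    by (simp only: K_def)
qed

text \<open>For \<open>m = 0\<close> the factor \<open>exp (\<mu> / w)\<close> is one and the series reduces to its first term.\<close>

lemma line_integral_ord_0:
  assumes y: "y > 0" and ord: "ord = 0"
  shows "line_integral y c = of_real (2 * pi * (2 * pi * nu) powr (wt - 1) * rGamma wt)"
proof -
  let ?a = "\<lambda>j. of_real ((- 2 * pi * ord / c^2) ^ j / fact j * (2 * pi * (2 * pi * nu) powr (wt + real j - 1) * rGamma (wt + real j))) :: complex"
  have "?a sums (\<Sum>j\<in>{0}. ?a j)"
    by (rule sums_finite) (auto simp: ord power_0_left simp del: of_real_mult of_real_divide)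
  from sums_unique2[OF sums_line_integral[OF y, of c] this] show ?thesis by simp
qed

end

subsection \<open>Ramanujan sums\<close>

definition ramanujan_sum :: "nat \<Rightarrow> complex" where
  "ramanujan_sum c = (\<Sum>d | d < c \<and> coprime c d. exp (2 * of_real pi * \<i> * of_nat d / of_nat c))"

lemma kloosterman_0_1:
  assumes "c > 0"
  shows "kloosterman 0 1 c = ramanujan_sum c"
proof -
  have nz: "eta_mult (SOME M. M \<in> carrier SL2Z \<and> M$2$1 = int c \<and> M$2$2 = d) \<noteq> 0" if "coprime (int c) d" for d
    using norm_eta_mult[OF lower_row_matrix(1)[OF that]] unfolding lower_row_matrix_def by auto
  have "kloosterman 0 1 c = (\<Sum>d | d \<in> {0..<int c} \<and> coprime (int c) d. exp (2 * of_real pi * \<i> * of_int d / of_nat c))"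
    unfolding kloosterman_def Let_def by (rule sum.cong) (simp_all add: nz)
  also have "\<dots> = ramanujan_sum c"
    unfolding ramanujan_sum_def
  proof (rule sum.reindex_bij_witness[of _ int nat])
    fix a assume "a \<in> {d. d \<in> {0..<int c} \<and> coprime (int c) d}"
    then obtain d where "a = int d" "d < c" "coprime c d" by (auto elim!: nonneg_int_cases)
    thus "int (nat a) = a" "nat a \<in> {d. d < c \<and> coprime c d}"
         "exp (2 * of_real pi * \<i> * of_nat (nat a) / of_nat c) = exp (2 * of_real pi * \<i> * of_int a / of_nat c)"
      by simp_all
  qed auto
  finally show ?thesis .
qed

text \<open>Every fraction \<open>j/N\<close> has a unique reduced form \<open>d/c\<close>, and \<open>c\<close> divides \<open>N\<close>.\<close>

lemma sum_ramanujan_sum_divisors: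
  assumes N: "N > 0"
  shows "(\<Sum>c | c dvd N. ramanujan_sum c) = (if N = 1 then 1 else 0)"
proof -
  let ?e = "\<lambda>j N. exp (2 * of_real pi * \<i> * of_nat j / of_nat N)"
  have fin: "finite {c. c dvd N}" using N by simp
  have "(\<Sum>c | c dvd N. ramanujan_sum c) = (\<Sum>(c,d)\<in>Sigma {c. c dvd N} (\<lambda>c. {d. d < c \<and> coprime c d}). ?e d c)"
    unfolding ramanujan_sum_def using fin by (intro sum.Sigma) auto
  also have "\<dots> = (\<Sum>j<N. ?e j N)"
  proof (rule sum.reindex_bij_witness[of _ "\<lambda>j. (N div gcd j N, j div gcd j N)" "\<lambda>(c,d). d * (N div c)"])
    fix a assume "a \<in> Sigma {c. c dvd N} (\<lambda>c. {d. d < c \<and> coprime c d})"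
    then obtain c d where a: "a = (c,d)" "c dvd N" "d < c" "coprime c d" by auto
    then obtain k where k: "N = c * k" by (auto elim: dvdE)
    have kc: "k > 0" "c > 0" using N k by (cases k; cases c; simp)+
    have g: "gcd (d * k) N = k"
      using a(4) unfolding k by (metis gcd_mult_distrib_nat coprime_iff_gcd_eq_1 gcd.commute mult.commute nat_mult_1_right)
    show "(\<lambda>j. (N div gcd j N, j div gcd j N)) ((\<lambda>(c,d). d * (N div c)) a) = a"
      using kc g by (simp add: a k)
    show "(\<lambda>(c,d). d * (N div c)) a \<in> {..<N}" using kc a by (simp add: k)
    show "?e ((\<lambda>(c,d). d * (N div c)) a) N = (case a of (c,d) \<Rightarrow> ?e d c)" using kc by (simp add: a k mult.assoc)
  next
    fix j assume j: "j \<in> {..<N}"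
    define g where "g = gcd j N"
    have g: "g > 0" "g dvd j" "g dvd N" using N by (auto simp: g_def)
    show "(\<lambda>(c,d). d * (N div c)) (N div gcd j N, j div gcd j N) = j"
      using g N unfolding g_def[symmetric] by (auto elim!: dvdE)
    have "coprime (N div g) (j div g)" unfolding g_def using N by (metis div_gcd_coprime gcd.commute gr_implies_not0)
    moreover have "j div g < N div g" using j g by (auto elim!: dvdE)
    moreover have "N div g dvd N" using g by (metis dvd_div_mult_self dvd_triv_left)
    ultimately show "(N div gcd j N, j div gcd j N) \<in> Sigma {c. c dvd N} (\<lambda>c. {d. d < c \<and> coprime c d})"
      unfolding g_def[symmetric] by simp
  qed
  also have "\<dots> = (\<Sum>j<N. ?e 1 N ^ j)"
    by (intro sum.cong refl) (simp add: mult_ac flip: exp_of_nat_mult)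
  also have "\<dots> = (if N = 1 then 1 else 0)"
  proof (cases "N = 1")
    case False
    have "?e 1 N \<noteq> 1"
    proof
      assume "?e 1 N = 1"
      then obtain m :: int where m: "Im (2 * of_real pi * \<i> * of_nat 1 / of_nat N) = of_int (2 * m) * pi" unfolding exp_eq_1 by blast
      have "Im (2 * of_real pi * \<i> * of_nat 1 / of_nat N) = 2 * pi / real N"
        by (simp add: Im_divide_of_nat)
      hence "1 = real_of_int (m * int N)" using m N by (simp add: field_simps)
      hence "m * int N = 1" by (metis of_int_1 of_int_eq_iff)
      hence "int N dvd 1" by (metis dvd_triv_right)
      thus False using False by simp
    qed
    moreover have "?e 1 N ^ N = 1" using N by (simp flip: exp_of_nat_mult)
    ultimately show ?thesis using False by (simp add: geometric_sum)
  qed simp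
  finally show ?thesis .
qed

lemma norm_ramanujan_sum_le: "norm (ramanujan_sum c) \<le> real c"
proof -
  have "norm (ramanujan_sum c) \<le> (\<Sum>d | d < c \<and> coprime c d. norm (exp (2 * of_real pi * \<i> * of_nat d / of_nat c)))"
    unfolding ramanujan_sum_def by (rule norm_sum)
  also have "\<dots> = real (card {d. d < c \<and> coprime c d})"
    by (simp add: norm_exp_eq_Re)
  also have "\<dots> \<le> real (card {..<c})" by (intro of_nat_mono card_mono) auto
  finally show ?thesis by simp
qed

text \<open>The Dirichlet series of the Ramanujan sums is the inverse of the zeta function, because
  Dirichlet convolution with the constant one gives the indicator of one.\<close>

lemma ramanujan_dirichlet_series_times_zeta:
  assumes s: "s \<ge> 3"
  shows "(\<Sum>j. ramanujan_sum (Suc j) / of_nat (Suc j) ^ s) * riemann_zeta (of_nat s) = 1"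
proof -
  define f where "f = (\<lambda>c. ramanujan_sum c / of_nat c ^ s)"
  define g where "g = (\<lambda>k. 1 / of_nat k ^ s :: complex)"
  have sp: "summable (\<lambda>j. 1 / real (Suc j) ^ t)" if "t \<ge> 2" for t
    using inverse_power_summable[OF that, where 'a = real] by (subst summable_Suc_iff) (simp add: divide_inverse)
  have nf: "norm (f c) \<le> 1 / real c ^ (s - 1)" if "c > 0" for c
  proof -
    have "norm (f c) = norm (ramanujan_sum c) / real c ^ s" by (simp add: f_def norm_divide norm_power)
    also have "\<dots> \<le> real c / real c ^ s" by (intro divide_right_mono norm_ramanujan_sum_le) auto
    also have "\<dots> = 1 / real c ^ (s - 1)" using that s by (cases s) auto
    finally show ?thesis .
  qed
  have nat_pos: "((\<lambda>j. h (Suc j)) has_sum S) UNIV \<longleftrightarrow> (h has_sum S) {0<..}" for h :: "nat \<Rightarrow> 'b::{comm_monoid_add,topological_space}" and S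
    by (rule has_sum_reindex_bij_witness[of _ "\<lambda>n. n - 1" Suc]) auto
  have sf: "summable (\<lambda>j. norm (f (Suc j)))"
    by (rule summable_comparison_test'[OF sp[of "s - 1"]]) (use s nf[OF zero_less_Suc] in \<open>auto simp del: of_nat_Suc\<close>)
  have sg: "summable (\<lambda>j. norm (g (Suc j)))"
    using sp[of s] s by (simp add: g_def norm_divide norm_power del: of_nat_Suc)
  define F G where "F = (\<Sum>j. f (Suc j))" and "G = (\<Sum>j. g (Suc j))"
  have F: "(f has_sum F) {0<..}"
    unfolding nat_pos[symmetric] F_def by (intro norm_summable_imp_has_sum sf summable_sums summable_norm_cancel[OF sf])
  have G: "(g has_sum G) {0<..}"
    unfolding nat_pos[symmetric] G_def by (intro norm_summable_imp_has_sum sg summable_sums summable_norm_cancel[OF sg])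
  define NG where "NG = (\<Sum>j. norm (g (Suc j)))"
  have NG: "((\<lambda>k. norm (g k)) has_sum NG) {0<..}"
    unfolding nat_pos[symmetric] NG_def by (intro norm_summable_imp_has_sum summable_sums) (use sg in auto)
  have "(\<lambda>c. norm (f c)) summable_on {0<..}"
    using norm_summable_imp_has_sum[of "\<lambda>j. norm (f (Suc j))", OF _ summable_sums[OF sf]] sf
      nat_pos[of "\<lambda>c. norm (f c)"] unfolding summable_on_def by auto
  hence "(\<lambda>c. norm (f c) * NG) summable_on {0<..}" by (rule summable_on_cmult_left)
  hence "(\<lambda>p. norm (case p of (c,k) \<Rightarrow> f c * g k)) summable_on {0<..} \<times> {0<..}"
    by (rule summable_on_SigmaI[rotated]) (use has_sum_cmult_right[OF NG] in \<open>auto simp: norm_mult\<close>)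
  hence "(\<lambda>(c,k). f c * g k) summable_on {0<..} \<times> {0<..}" by (rule abs_summable_summable)
  then obtain S where S: "((\<lambda>(c,k). f c * g k) has_sum S) ({0<..} \<times> {0<..})" by (auto simp: summable_on_def)
  have "((\<lambda>c. f c * G) has_sum S) {0<..}"
    by (rule has_sum_SigmaD[OF S]) (use has_sum_cmult_right[OF G] in auto)
  from has_sum_unique[OF this has_sum_cmult_left[OF F]] have SFG: "S = F * G" .
  have "((\<lambda>(N,c). f c * g (N div c)) has_sum S) (Sigma {0<..} (\<lambda>N. {c. c dvd N}))"
    by (subst has_sum_reindex_bij_witness[where h = "\<lambda>(c,k). f c * g k" and T = "{0<..} \<times> {0<..}" and s' = S
          and i = "\<lambda>(c,k). (c * k, c)" and j = "\<lambda>(N,c). (c, N div c)"])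
       (use S in \<open>auto simp: dvd_div_eq_0_iff intro: Nat.gr0I dest: dvd_pos_nat\<close>)
  hence "((\<lambda>N. \<Sum>c | c dvd N. f c * g (N div c)) has_sum S) {0<..}"
  proof (rule has_sum_SigmaD)
    fix N :: nat assume "N \<in> {0<..}"
    hence "finite {c. c dvd N}" by simp
    thus "((\<lambda>c. case (N, c) of (N, c) \<Rightarrow> f c * g (N div c)) has_sum (\<Sum>c | c dvd N. f c * g (N div c))) {c. c dvd N}"
      by (simp add: has_sum_finite)
  qed
  moreover have "(\<Sum>c | c dvd N. f c * g (N div c)) = (if N = 1 then 1 else 0)" if "N \<in> {0<..}" for N
  proof -
    have "(\<Sum>c | c dvd N. f c * g (N div c)) = (\<Sum>c | c dvd N. ramanujan_sum c / of_nat N ^ s)"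
    proof (intro sum.cong refl)
      fix c assume "c \<in> {c. c dvd N}"
      then obtain k where k: "N = c * k" by (auto elim: dvdE)
      hence "c > 0" "k > 0" using that by (cases c; cases k; simp)+
      thus "f c * g (N div c) = ramanujan_sum c / of_nat N ^ s" by (simp add: f_def g_def k power_mult_distrib)
    qed
    also have "\<dots> = (\<Sum>c | c dvd N. ramanujan_sum c) / of_nat N ^ s" by (simp add: sum_divide_distrib)
    also have "\<dots> = (if N = 1 then 1 else 0)" using that by (subst sum_ramanujan_sum_divisors) auto
    finally show ?thesis .
  qed
  ultimately have "((\<lambda>N::nat. if N = 1 then 1 else 0 :: complex) has_sum S) {0<..}"
    using has_sum_cong[of "{0<..}" "\<lambda>N. \<Sum>c | c dvd N. f c * g (N div c)" "\<lambda>N. if N = 1 then 1 else 0" S] by simp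
  moreover have "((\<lambda>N::nat. if N = 1 then 1 else 0 :: complex) has_sum 1) {0<..}"
    by (rule has_sum_finite_neutralI[of "{1::nat}"]) auto
  ultimately have "S = 1" by (rule has_sum_unique)
  moreover have "G = riemann_zeta (of_nat s)"
    unfolding G_def riemann_zeta_def g_def
    by (intro arg_cong[of _ _ suminf] ext) (simp add: powr_nat del: of_nat_Suc)
  ultimately show ?thesis using SFG by (simp add: F_def f_def)
qed

subsection \<open>Small values\<close>

lemma num_color_partitions_1: "num_color_partitions r 1 = r"
proof -
  have "color_partitions r 1 = (\<lambda>i. {#(1, i)#}) ` {..<r}"
  proof (intro equalityI subsetI)
    fix P assume "P \<in> color_partitions r 1"
    hence P: "set_mset P \<subseteq> {1..} \<times> {..<r}" "sum_mset (image_mset fst P) = 1" by (auto simp: color_partitions_def)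
    have "P \<noteq> {#}" using P(2) by auto
    then obtain x Q where x: "P = add_mset x Q" by (meson multiset_cases)
    have fx: "fst x \<ge> 1" "snd x < r" using P(1) x by auto
    have "fst x + sum_mset (image_mset fst Q) = 1" using P(2) x by simp
    hence Q: "sum_mset (image_mset fst Q) = 0" "fst x = 1" using fx(1) by linarith+
    have "Q = {#}"
    proof (rule ccontr)
      assume "Q \<noteq> {#}"
      then obtain z Q' where z: "Q = add_mset z Q'" by (meson multiset_cases)
      have "fst z \<ge> 1" using P(1) x z by auto
      thus False using Q(1) z by simp
    qed
    thus "P \<in> (\<lambda>i. {#(1, i)#}) ` {..<r}" using x fx Q(2) by (intro image_eqI[of _ _ "snd x"]) (auto simp: prod_eq_iff)
  qed (auto simp: color_partitions_def)
  moreover have "inj_on (\<lambda>i. {#(1::nat, i)#}) {..<r}" by (auto intro: inj_onI)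
  ultimately show ?thesis by (simp add: num_color_partitions_def card_image)
qed

lemma bernoulli_number_14: "bernoulli_number 14 = 7 / 6"
proof -
  have rec: "bernoulli_number (numeral n) = - (\<Sum>j\<le>pred_numeral n. of_nat (Suc (numeral n) choose j) * bernoulli_number j) / (real (numeral n) + 1)" for n
    unfolding numeral_eq_Suc[of n] bernoulli_number.simps(2) by (simp del: bernoulli_number.simps)
  have choose: "numeral n choose numeral k = numeral n * (pred_numeral n choose pred_numeral k) div numeral k" for n k
    using binomial_Suc_Suc_eq_times[of "pred_numeral n" "pred_numeral k"] by (simp only: numeral_eq_Suc[symmetric])
  have b0: "bernoulli_number 0 = 1" by simp
  have b1: "bernoulli_number (Suc 0) = - 1 / 2" by simp
  note simps = atMost_nat_numeral atMost_Suc choose b1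
  have b2: "bernoulli_number 2 = 1 / 6"
    unfolding rec by (simp add: simps del: bernoulli_number.simps(2))
  have b3: "bernoulli_number 3 = 0"
    unfolding rec by (simp add: simps b2 del: bernoulli_number.simps(2))
  have b4: "bernoulli_number 4 = - 1 / 30"
    unfolding rec by (simp add: simps b2 b3 del: bernoulli_number.simps(2))
  have b5: "bernoulli_number 5 = 0"
    unfolding rec by (simp add: simps b2 b3 b4 del: bernoulli_number.simps(2))
  have b6: "bernoulli_number 6 = 1 / 42"
    unfolding rec by (simp add: simps b2 b3 b4 b5 del: bernoulli_number.simps(2))
  have b7: "bernoulli_number 7 = 0"
    unfolding rec by (simp add: simps b2 b3 b4 b5 b6 del: bernoulli_number.simps(2))
  have b8: "bernoulli_number 8 = - 1 / 30"
    unfolding rec by (simp add: simps b2 b3 b4 b5 b6 b7 del: bernoulli_number.simps(2))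
  have b9: "bernoulli_number 9 = 0"
    unfolding rec by (simp add: simps b2 b3 b4 b5 b6 b7 b8 del: bernoulli_number.simps(2))
  have b10: "bernoulli_number 10 = 5 / 66"
    unfolding rec by (simp add: simps b2 b3 b4 b5 b6 b7 b8 b9 del: bernoulli_number.simps(2))
  have b11: "bernoulli_number 11 = 0"
    unfolding rec by (simp add: simps b2 b3 b4 b5 b6 b7 b8 b9 b10 del: bernoulli_number.simps(2))
  have b12: "bernoulli_number 12 = - 691 / 2730"
    unfolding rec by (simp add: simps b2 b3 b4 b5 b6 b7 b8 b9 b10 b11 del: bernoulli_number.simps(2))
  have b13: "bernoulli_number 13 = 0"
    unfolding rec by (simp add: simps b2 b3 b4 b5 b6 b7 b8 b9 b10 b11 b12 del: bernoulli_number.simps(2))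
  show ?thesis unfolding rec by (simp add: simps b2 b3 b4 b5 b6 b7 b8 b9 b10 b11 b12 b13 del: bernoulli_number.simps(2))
qed

subsection \<open>The coefficient for \<open>m = 0\<close>\<close>

lemma cpow_ii_minus_14: "cpow \<i> (- 14) = - 1"
proof -
  have "arg_left \<i> = pi / 2" by (simp add: arg_left_def)
  moreover have "- 14 * (pi / 2) = - (of_int 3 * (2 * pi)) - pi" by simp
  ultimately have "cpow \<i> (- 14) = cis (- (of_int 3 * (2 * pi)) - pi)"
    unfolding cpow_def by (simp only: norm_ii powr_one_eq_one of_real_1 mult_1)
  also have "\<dots> = cis (- (of_int 3 * (2 * pi))) * cis (- pi)" unfolding cis_mult by simp
  also have "cis (- (of_int 3 * (2 * pi))) = 1" using cis_multiple_2pi[of "- 3"] by (simp add: mult_ac)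
  finally show ?thesis by (simp add: complex_eq_iff)
qed

context partition_data
begin

lemma fourier_coeff_poincare_ord_0:
  assumes y: "y > 0" and rn: "r = 24" "n = 1"
  shows "summable (\<lambda>j. kloosterman 0 1 (Suc j) / of_nat (Suc j) ^ 14)"
    and "fourier_coeff (poincare_series wt ord) y nu =
           (- 1) ^ 7 * (2 * of_real pi) ^ 14 / fact 13 * (\<Sum>j. kloosterman 0 1 (Suc j) / of_nat (Suc j) ^ 14)"
proof -
  let ?f = "\<lambda>j. kloosterman 0 1 (Suc j) / of_nat (Suc j) ^ 14"
  have v: "wt = 14" "ord = 0" "nu = 1" using rn by simp_all
  define K :: complex where "K = (- 1) ^ 7 * (2 * of_real pi) ^ 14 / fact 13"
  have "rGamma (14 :: real) = 1 / fact 13"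
    using Gamma_fact[of 13, where 'a = real] by (simp add: rGamma_inverse_Gamma divide_inverse)
  moreover have "(2 * pi * 1) powr (14 - 1) = (2 * pi) ^ 13"
    using powr_realpow[of "2 * pi" 13] by simp
  ultimately have L: "line_integral y c = of_real (2 * pi * (2 * pi) ^ 13 * (1 / fact 13))" for c
    using line_integral_ord_0[OF y v(2), of c] unfolding v by simp
  have eq: "kloosterman ord nu (Suc j) * (of_real (real (Suc j) powr - wt) * cpow \<i> (- wt) * line_integral y (real (Suc j))) = K * ?f j" for j
  proof -
    have "real (Suc j) powr - 14 = 1 / real (Suc j) ^ 14"
      using powr_realpow[of "real (Suc j)" 14] by (simp add: powr_minus_divide del: of_nat_Suc)
    thus ?thesis unfolding v(2) unfolding v(1,3) L K_def cpow_ii_minus_14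
      by (simp add: power_Suc[symmetric] power_mult_distrib mult_ac del: of_nat_Suc)
  qed
  have s: "(\<lambda>j. K * ?f j) sums fourier_coeff (poincare_series wt ord) y nu"
    using sums_fourier_coeff_poincare[OF y] unfolding eq .
  have K: "K \<noteq> 0" by (simp add: K_def)
  have "summable (\<lambda>j. K * ?f j)" using s by (rule sums_summable)
  thus f: "summable ?f" using K by (simp only: summable_cmult_iff simp_thms)
  show "fourier_coeff (poincare_series wt ord) y nu =
           (- 1) ^ 7 * (2 * of_real pi) ^ 14 / fact 13 * suminf ?f"
    using suminf_mult[OF f, of K] sums_unique[OF s] by (simp only: K_def)
qed

end

lemma divisor_sigma_1: "divisor_sigma s 1 = 1"
  by (simp add: divisor_sigma_def)

theorem theorem4:
  fixes r n :: nat and k m :: real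
  assumes "1 \<le> r" and "r \<le> 24" and "n > 0"
    and "k = 2 + real r / 2" and "m = - real n + real r / 24"
  shows
    "m \<le> 0 \<and> (m = 0 \<longleftrightarrow> r = 24 \<and> n = 1) \<and>
     (\<forall>y>0. let coeff = fourier_coeff (poincare_series k m) y (real r / 24) in
        of_nat (num_color_partitions r n) = - coeff \<and>
        (m < 0 \<longrightarrow>
           summable (\<lambda>j. let c = Suc j in
             kloosterman m (real r / 24) c / of_nat c *
             of_real (bessel_I (k - 1) (4 * pi * sqrt (\<bar>m\<bar> * real r / 24) / real c))) \<and>
           coeff = 2 * of_real pi * cpow \<i> (- k) *
             of_real (((real r / 24) / \<bar>m\<bar>) powr ((k - 1) / 2)) *
             (\<Sum>j. let c = Suc j in
               kloosterman m (real r / 24) c / of_nat c *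
               of_real (bessel_I (k - 1) (4 * pi * sqrt (\<bar>m\<bar> * real r / 24) / real c)))) \<and>
        (m = 0 \<longrightarrow>
           k = 14 \<and>
           coeff = fourier_coeff (poincare_series k m) y 1 \<and>
           (let K = 14 :: nat in
             summable (\<lambda>j. let c = Suc j in kloosterman 0 1 c / of_nat c ^ K) \<and>
             coeff = (- 1) ^ (K div 2) * (2 * of_real pi) ^ K / fact (K - 1) *
               (\<Sum>j. let c = Suc j in kloosterman 0 1 c / of_nat c ^ K) \<and>
             coeff = (- 1) ^ (K div 2) * (2 * of_real pi) ^ K /
               (fact (K - 1) * riemann_zeta (of_nat K)) * of_nat (divisor_sigma (K - 1) 1) \<and>
             coeff = - (2 * of_nat K / of_real (bernoulli_number K)) *
               of_nat (divisor_sigma (K - 1) 1))))"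
proof -
  interpret partition_data r n using assms by unfold_locales auto
  have km: "k = wt" "m = ord" using assms(4,5) by simp_all
  have m0: "m = 0 \<longleftrightarrow> r = 24 \<and> n = 1" using assms(1-3,5) by auto
  have A: "let coeff = fourier_coeff (poincare_series k m) y (real r / 24) in
        of_nat (num_color_partitions r n) = - coeff \<and>
        (m < 0 \<longrightarrow>
           summable (\<lambda>j. let c = Suc j in
             kloosterman m (real r / 24) c / of_nat c *
             of_real (bessel_I (k - 1) (4 * pi * sqrt (\<bar>m\<bar> * real r / 24) / real c))) \<and>
           coeff = 2 * of_real pi * cpow \<i> (- k) *
             of_real (((real r / 24) / \<bar>m\<bar>) powr ((k - 1) / 2)) *
             (\<Sum>j. let c = Suc j in
               kloosterman m (real r / 24) c / of_nat c *
               of_real (bessel_I (k - 1) (4 * pi * sqrt (\<bar>m\<bar> * real r / 24) / real c)))) \<and>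
        (m = 0 \<longrightarrow>
           k = 14 \<and>
           coeff = fourier_coeff (poincare_series k m) y 1 \<and>
           (let K = 14 :: nat in
             summable (\<lambda>j. let c = Suc j in kloosterman 0 1 c / of_nat c ^ K) \<and>
             coeff = (- 1) ^ (K div 2) * (2 * of_real pi) ^ K / fact (K - 1) *
               (\<Sum>j. let c = Suc j in kloosterman 0 1 c / of_nat c ^ K) \<and>
             coeff = (- 1) ^ (K div 2) * (2 * of_real pi) ^ K /
               (fact (K - 1) * riemann_zeta (of_nat K)) * of_nat (divisor_sigma (K - 1) 1) \<and>
             coeff = - (2 * of_nat K / of_real (bernoulli_number K)) *
               of_nat (divisor_sigma (K - 1) 1)))" if y: "y > 0" for y
    unfolding Let_def
  proof (intro conjI impI)
    note main = num_color_partitions_eq_fourier_coeff[OF y]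
    show "of_nat (num_color_partitions r n) = - fourier_coeff (poincare_series k m) y (real r / 24)"
      unfolding km by (rule main)
    {
      assume m: "m < 0"
      have e: "\<bar>ord\<bar> * real r / 24 = \<bar>ord\<bar> * nu" by (rule times_divide_eq_right[symmetric])
      note b = fourier_coeff_poincare_bessel[OF y m[unfolded km(2)]]
      show "summable (\<lambda>j. kloosterman m (real r / 24) (Suc j) / of_nat (Suc j) *
             of_real (bessel_I (k - 1) (4 * pi * sqrt (\<bar>m\<bar> * real r / 24) / real (Suc j))))"
        unfolding km e by (rule b(1))
      show "fourier_coeff (poincare_series k m) y (real r / 24) = 2 * of_real pi * cpow \<i> (- k) *
             of_real (((real r / 24) / \<bar>m\<bar>) powr ((k - 1) / 2)) *
             (\<Sum>j. kloosterman m (real r / 24) (Suc j) / of_nat (Suc j) *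
               of_real (bessel_I (k - 1) (4 * pi * sqrt (\<bar>m\<bar> * real r / 24) / real (Suc j))))"
        unfolding km e by (rule b(2))
    }
    assume "m = 0"
    hence rn: "r = 24" "n = 1" using m0 by auto
    have nu: "nu = 1" using rn by simp
    show "k = 14" using rn assms(4) by simp
    show "fourier_coeff (poincare_series k m) y (real r / 24) = fourier_coeff (poincare_series k m) y 1"
      by (simp only: nu)
    let ?S = "\<Sum>j. kloosterman 0 1 (Suc j) / of_nat (Suc j) ^ 14"
    note b = fourier_coeff_poincare_ord_0[OF y rn]
    have half: "14 div 2 = (7 :: nat)" and pred: "14 - 1 = (13 :: nat)" by simp_all
    show "summable (\<lambda>j. kloosterman 0 1 (Suc j) / of_nat (Suc j) ^ 14)" by (rule b(1))
    show c: "fourier_coeff (poincare_series k m) y (real r / 24) = (- 1) ^ (14 div 2) * (2 * of_real pi) ^ 14 / fact (14 - 1) * ?S"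
      unfolding km half pred by (rule b(2))
    have "?S = (\<Sum>j. ramanujan_sum (Suc j) / of_nat (Suc j) ^ 14)" by (simp only: kloosterman_0_1[OF zero_less_Suc])
    hence zeta: "?S * riemann_zeta (of_nat 14) = 1" using ramanujan_dirichlet_series_times_zeta[of 14] by simp
    have inv: "a / b * s = a / (b * z) * of_nat 1" if "s * z = 1" for a b s z :: complex
    proof -
      have "z \<noteq> 0" using that by auto
      hence "s = 1 / z" using that by (simp add: eq_divide_eq)
      thus ?thesis by simp
    qed
    show "fourier_coeff (poincare_series k m) y (real r / 24) = (- 1) ^ (14 div 2) * (2 * of_real pi) ^ 14 /
               (fact (14 - 1) * riemann_zeta (of_nat 14)) * of_nat (divisor_sigma (14 - 1) 1)"
      unfolding c divisor_sigma_1 by (rule inv[OF zeta])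
    have "fourier_coeff (poincare_series k m) y (real r / 24) = - of_nat (num_color_partitions r n)"
      unfolding km main by simp
    also have "\<dots> = - 24" unfolding rn num_color_partitions_1 by simp
    finally show "fourier_coeff (poincare_series k m) y (real r / 24) = - (2 * of_nat 14 / of_real (bernoulli_number 14)) *
               of_nat (divisor_sigma (14 - 1) 1)"
      unfolding divisor_sigma_1 bernoulli_number_14 by simp
  qed
  show ?thesis using A m0 ord_nonpos unfolding km(2)[symmetric] by blast
qed

end
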